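(* Let $M,N,P$ be smooth manifolds with $P$ Riemannian, $p\in P$, $h:M\to P$ smooth, and consider the completely high index SDAE $$\mathbf{d}X_t = \Big[V(X_t,U_t) + \tfrac12 \sum_{l=1}^d {}^MG(\sigma_l(X_t,U_t))\Big]dt + \sum_{l=1}^d \sigma_l(X_t,U_t)\,dW^l_t,\qquad h(X_t)=p .$$ Let $$\lambda=\sup_{(x,u)\in S}\sum_{l=1}^d\big((D_xh)\sigma_l(x,u)[\Delta_p^2(h(x))]\big)^2<\infty,\qquad S=\{(X_t(\omega),U_t(\omega))\in M\times N : t\in(0,a],\ \omega\in\Omega\},$$ where $\Omega$ is the sample space. For every $\epsilon>0$ and $\alpha\in(0,1]$ there exists $b>\lambda/(\alpha\epsilon^4)$ such that if there exists a semi-martingale $(X_t,U_t)\in M\times N$ satisfying the SDE $\mathbf{d}X_t = \big[V(X_t,U_t) + \tfrac12 \sum_{l=1}^d {}^MG(\sigma_l(X_t,U_t))\big]dt + \sum_{l=1}^d \sigma_l(X_t,U_t)\,dW^l_t$, with $h(X_0)=p$ and $$\Big(D_{X_t}hV(X_t,U_t)+\tfrac12\sum_{l=1}^d D_{X_t}h\nabla^{{}^MG}_S(\sigma_l)(X_t,U_t)+\tfrac12\sum_{l=1}^d {}^PG_S(D_{X_t}h\sigma_l)(X_t,U_t)\Big)[\Delta_p^2(h(X_t))]=-b\,\Delta_p^2(h(X_t)),$$ then for any $t\in(0,a]$, for some $a>0$ making $(0,a]$ an interval of existence, $$\mathbb{P}\Big(\sup_{s\in[0,t]}\Delta_p(h(X_s))>\epsilon\Big)\le\alpha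 .$$ In other words, the SDAE has a local bounded m-solution for $t\in(0,a]$.
   Context: $W_t=(W^1_t,\dots,W^d_t)$ is a $d$-dimensional Wiener process; $V,\sigma_l:M\times N\to TM$ satisfy $V(x,u),\sigma_l(x,u)\in T_xM$. The diffusion space $\mathfrak{D}_xM$ is the space of second order differential operators at $x$ without constant term, locally $L=a^i\partial_i+b^{ij}\partial^2_{ij}$ ($b$ symmetric), with symmetric part $\hat L=b^{ij}\partial_i\otimes\partial_j$. A diffusion generator on $M$ is a fiber preserving map ${}^MG:TM\to\mathfrak{D}M$ with $\widehat{{}^MG(Y)}=Y\otimes Y$. The intrinsic SDE $\mathbf{d}X_t=[V+\tfrac12\sum_l {}^MG(\sigma_l)]dt+\sum_l\sigma_l\,dW^l_t$ means that for every smooth $f:M\to\mathbb{R}$, $f(X_t)=f(X_0)+\int_0^t (V+\tfrac12\sum_l {}^MG(\sigma_l))[f]ds+\sum_l\int_0^t\sigma_l[f]dW^l_s$ (Itô). $G_S$ is the Stratonovich diffusion generator, $G_S(\sigma)[f]=\sigma[\sigma[f]]$ (for $\sigma(\cdot,u)$ with $u$ held fixed), and $\nabla^{{}^MG}_S={}^MG-{}^MG_S$, which is tangent-vector valued. A tangent vector $D_xhY\in T_{h(x)}P$ acts on $f:P\to\mathbb{R}$ by $(D_xhY)[f(h(x))]=Y[f\circ h](x)$, and ${}^PG_S(D_xh\sigma_l)(x,u)[f(h(x))]=\sigma_l(\cdot,u)[\sigma_l(\cdot,u)[f\circ h]](x)$. $\Delta_p(z)$ is the Riemannian distance from $p$ to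 $z\in P$. Local bounded m-solution: a semi-martingale $(X_t,U_t)$ with $\mathbb{P}(\sup_{s\in[0,t]}\Delta_p(h(X_s))>\epsilon)\le\alpha$ for any $t\in(0,a]$, for some $a>0$ making $(0,a]$ an interval of existence. In the claim, $(X_t,U_t)$ in the definition of $S$ is the semi-martingale under consideration. *)

theory Defs
  imports "HOL-Probability.Probability"
begin

section \<open>Smooth manifolds\<close>

text \<open>
  Only used on open sets, where the Frechet derivative is unique; \<open>Ck_on k f S\<close> then is
  the usual \<open>C\<^sup>k\<close>.
\<close>

primrec Ck_on :: "nat \<Rightarrow> ('a::euclidean_space \<Rightarrow> 'b::euclidean_space) \<Rightarrow> 'a set \<Rightarrow> bool" where
  "Ck_on 0 f S \<longleftrightarrow> continuous_on S f"
| "Ck_on (Suc k) f S \<longleftrightarrow> (\<forall>x\<in>S. f differentiable (at x)) \<and>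
     (\<forall>v. Ck_on k (\<lambda>x. frechet_derivative f (at x) v) S)"

definition smooth_on :: "'a set \<Rightarrow> ('a::euclidean_space \<Rightarrow> 'b::euclidean_space) \<Rightarrow> bool" where
  "smooth_on S f \<longleftrightarrow> (\<forall>k. Ck_on k f S)"

text \<open>A chart is its domain together with its coordinate map; the latter is only relevant on the domain.\<close>

type_synonym ('m, 'a) chart = "'m set \<times> ('m \<Rightarrow> 'a)"

abbreviation chart_inv :: "('m, 'a) chart \<Rightarrow> 'a \<Rightarrow> 'm" where
  "chart_inv c \<equiv> inv_into (fst c) (snd c)"

definition is_chart :: "('m::topological_space, 'a::euclidean_space) chart \<Rightarrow> bool" where
  "is_chart c \<longleftrightarrow> open (fst c) \<and> open (snd c ` fst c) \<and>
     homeomorphism (fst c) (snd c ` fst c) (snd c) (chart_inv c)"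

text \<open>
  The manifold is the whole (Hausdorff, second countable) type \<open>'m\<close>, its smooth structure is
  given by an atlas (not necessarily maximal), and its dimension is \<open>DIM('a)\<close>.
\<close>

definition smooth_manifold ::
    "('m::{t2_space,second_countable_topology}, 'a::euclidean_space) chart set \<Rightarrow> bool" where
  "smooth_manifold A \<longleftrightarrow> (\<forall>c\<in>A. is_chart c) \<and> (\<Union>c\<in>A. fst c) = UNIV \<and>
     (\<forall>c\<in>A. \<forall>c'\<in>A. smooth_on (snd c ` (fst c \<inter> fst c')) (snd c' \<circ> chart_inv c))"

definition smooth_fun_on ::
    "('m::topological_space, 'a::euclidean_space) chart set \<Rightarrow> 'm set \<Rightarrow> ('m \<Rightarrow> real) \<Rightarrow> bool" where
  "smooth_fun_on A Z f \<longleftrightarrow> (\<forall>c\<in>A. smooth_on (snd c ` (fst c \<inter> Z)) (f \<circ> chart_inv c))"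

definition smooth_near ::
    "('m::topological_space, 'a::euclidean_space) chart set \<Rightarrow> 'm \<Rightarrow> ('m \<Rightarrow> real) \<Rightarrow> bool" where
  "smooth_near A x f \<longleftrightarrow> (\<exists>Z. open Z \<and> x \<in> Z \<and> smooth_fun_on A Z f)"

definition smooth_map ::
    "('m::topological_space, 'a::euclidean_space) chart set \<Rightarrow>
     ('p::topological_space, 'c::euclidean_space) chart set \<Rightarrow> ('m \<Rightarrow> 'p) \<Rightarrow> bool" where
  "smooth_map A C h \<longleftrightarrow> continuous_on UNIV h \<and>
     (\<forall>c\<in>A. \<forall>e\<in>C. smooth_on (snd c ` (fst c \<inter> h -` fst e)) (snd e \<circ> h \<circ> chart_inv c))"

definition prod_atlas ::
    "('m, 'a) chart set \<Rightarrow> ('n, 'b) chart set \<Rightarrow> ('m \<times> 'n, 'a \<times> 'b) chart set" where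
  "prod_atlas A B = (\<lambda>(c, e). (fst c \<times> fst e, map_prod (snd c) (snd e))) ` (A \<times> B)"

section \<open>Tangent and diffusion spaces\<close>

definition partial1 ::
    "('m, 'a::euclidean_space) chart \<Rightarrow> 'a \<Rightarrow> ('m \<Rightarrow> real) \<Rightarrow> 'm \<Rightarrow> real" where
  "partial1 c i f x = frechet_derivative (f \<circ> chart_inv c) (at (snd c x)) i"

definition partial2 ::
    "('m, 'a::euclidean_space) chart \<Rightarrow> 'a \<Rightarrow> 'a \<Rightarrow> ('m \<Rightarrow> real) \<Rightarrow> 'm \<Rightarrow> real" where
  "partial2 c i j f x =
     frechet_derivative (\<lambda>z. frechet_derivative (f \<circ> chart_inv c) (at z) j) (at (snd c x)) i"

text \<open>
  An operator at \<open>x\<close> acts on the functions that are smooth on some neighbourhood of \<open>x\<close>.  All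
  other functions are sent to the dummy value 0, so that operators are determined by their
  action on germs and equality of operators is equality of functions.
\<close>

type_synonym 'm diffop = "('m \<Rightarrow> real) \<Rightarrow> real"

definition local_op ::
    "('m::topological_space, 'a::euclidean_space) chart set \<Rightarrow> ('m, 'a) chart \<Rightarrow> 'm \<Rightarrow>
     ('a \<Rightarrow> real) \<Rightarrow> ('a \<Rightarrow> 'a \<Rightarrow> real) \<Rightarrow> 'm diffop" where
  "local_op A c x a b = (\<lambda>f. if smooth_near A x f
     then (\<Sum>i\<in>Basis. a i * partial1 c i f x) + (\<Sum>i\<in>Basis. \<Sum>j\<in>Basis. b i j * partial2 c i j f x)
     else 0)"

definition tangent_space ::
    "('m::topological_space, 'a::euclidean_space) chart set \<Rightarrow> 'm \<Rightarrow> 'm diffop set" where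
  "tangent_space A x = {local_op A c x a (\<lambda>_ _. 0) | c a. c \<in> A \<and> x \<in> fst c}"

definition diffusion_space ::
    "('m::topological_space, 'a::euclidean_space) chart set \<Rightarrow> 'm \<Rightarrow> 'm diffop set" where
  "diffusion_space A x = {local_op A c x a b | c a b. c \<in> A \<and> x \<in> fst c \<and>
     (\<forall>i\<in>Basis. \<forall>j\<in>Basis. b i j = b j i)}"

text \<open>
  The symmetric part \<open>b\<^sup>i\<^sup>j \<partial>\<^sub>i \<otimes> \<partial>\<^sub>j\<close> of an operator and the tensor square of a tangent vector are
  viewed as bilinear forms on smooth functions.
\<close>

definition has_symmetric_part ::
    "('m::topological_space, 'a::euclidean_space) chart set \<Rightarrow> 'm \<Rightarrow> 'm diffop \<Rightarrow>
     (('m \<Rightarrow> real) \<Rightarrow> ('m \<Rightarrow> real) \<Rightarrow> real) \<Rightarrow> bool" where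
  "has_symmetric_part A x L \<beta> \<longleftrightarrow> (\<exists>c\<in>A. \<exists>a b. x \<in> fst c \<and>
     (\<forall>i\<in>Basis. \<forall>j\<in>Basis. b i j = b j i) \<and> L = local_op A c x a b \<and>
     (\<forall>f g. smooth_near A x f \<longrightarrow> smooth_near A x g \<longrightarrow>
        \<beta> f g = (\<Sum>i\<in>Basis. \<Sum>j\<in>Basis. b i j * (partial1 c i f x * partial1 c j g x))))"

definition tensor_square :: "'m diffop \<Rightarrow> ('m \<Rightarrow> real) \<Rightarrow> ('m \<Rightarrow> real) \<Rightarrow> real" where
  "tensor_square Y = (\<lambda>f g. Y f * Y g)"

text \<open>
  A generator takes the base point as a separate argument, because the zero vectors of different
  tangent spaces are the same operator.
\<close>

definition diffusion_generator ::
    "('m::topological_space, 'a::euclidean_space) chart set \<Rightarrow> ('m \<Rightarrow> 'm diffop \<Rightarrow> 'm diffop) \<Rightarrow> bool"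
  where
  "diffusion_generator A G \<longleftrightarrow> (\<forall>x. \<forall>Y\<in>tangent_space A x.
     G x Y \<in> diffusion_space A x \<and> has_symmetric_part A x (G x Y) (tensor_square Y))"

definition strat_generator :: "('m \<Rightarrow> 'm diffop) \<Rightarrow> 'm \<Rightarrow> 'm diffop" where
  "strat_generator Y x = (\<lambda>f. Y x (\<lambda>y. Y y f))"

definition nabla_strat ::
    "('m \<Rightarrow> 'm diffop \<Rightarrow> 'm diffop) \<Rightarrow> ('m \<Rightarrow> 'm diffop) \<Rightarrow> 'm \<Rightarrow> 'm diffop" where
  "nabla_strat G Y x = (\<lambda>f. G x (Y x) f - strat_generator Y x f)"

definition pushforward :: "('m \<Rightarrow> 'p) \<Rightarrow> 'm diffop \<Rightarrow> 'p diffop" where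
  "pushforward h L = (\<lambda>f. L (f \<circ> h))"

text \<open>The Stratonovich generator of \<open>P\<close> applied to the field \<open>Dh Y\<close> along \<open>h\<close>.\<close>

definition strat_generator_along :: "('m \<Rightarrow> 'p) \<Rightarrow> ('m \<Rightarrow> 'm diffop) \<Rightarrow> 'm \<Rightarrow> 'p diffop" where
  "strat_generator_along h Y x = (\<lambda>f. Y x (\<lambda>y. Y y (f \<circ> h)))"

section \<open>Riemannian distance\<close>

definition coord_vector ::
    "('m::topological_space, 'a::euclidean_space) chart set \<Rightarrow> ('m, 'a) chart \<Rightarrow> 'a \<Rightarrow> 'm \<Rightarrow> 'm diffop"
  where
  "coord_vector A c i x = local_op A c x (\<lambda>k. if k = i then 1 else 0) (\<lambda>_ _. 0)"

definition riemannian_metric ::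
    "('p::topological_space, 'c::euclidean_space) chart set \<Rightarrow>
     ('p \<Rightarrow> 'p diffop \<Rightarrow> 'p diffop \<Rightarrow> real) \<Rightarrow> bool" where
  "riemannian_metric C g \<longleftrightarrow>
     (\<forall>z. \<forall>Y\<in>tangent_space C z. \<forall>Y'\<in>tangent_space C z. g z Y Y' = g z Y' Y) \<and>
     (\<forall>z. \<forall>Y\<in>tangent_space C z. \<forall>Y'\<in>tangent_space C z. \<forall>Z\<in>tangent_space C z. \<forall>k.
        g z (\<lambda>f. Y f + k * Y' f) Z = g z Y Z + k * g z Y' Z) \<and>
     (\<forall>z. \<forall>Y\<in>tangent_space C z. Y \<noteq> (\<lambda>_. 0) \<longrightarrow> g z Y Y > 0) \<and>
     (\<forall>c\<in>C. \<forall>i\<in>Basis. \<forall>j\<in>Basis.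
        smooth_fun_on C (fst c) (\<lambda>z. g z (coord_vector C c i z) (coord_vector C c j z)))"

text \<open>Curves from \<open>p\<close> to \<open>z\<close> that are continuous on \<open>[0,1]\<close> and \<open>C\<^sup>1\<close> in charts off finitely many times.\<close>

definition piecewise_C1_curves ::
    "('p::topological_space, 'c::euclidean_space) chart set \<Rightarrow> 'p \<Rightarrow> 'p \<Rightarrow> (real \<Rightarrow> 'p) set" where
  "piecewise_C1_curves C p z = {\<gamma>. continuous_on {0..1} \<gamma> \<and> \<gamma> 0 = p \<and> \<gamma> 1 = z \<and>
     (\<exists>K. finite K \<and> (\<forall>c\<in>C. (snd c \<circ> \<gamma>) C1_differentiable_on ({0<..<1} \<inter> \<gamma> -` fst c - K)))}"

definition velocity ::
    "('p::topological_space, 'c::euclidean_space) chart set \<Rightarrow> (real \<Rightarrow> 'p) \<Rightarrow> real \<Rightarrow> 'p diffop" where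
  "velocity C \<gamma> s = (\<lambda>f. if smooth_near C (\<gamma> s) f then deriv (f \<circ> \<gamma>) s else 0)"

definition curve_length ::
    "('p::topological_space, 'c::euclidean_space) chart set \<Rightarrow>
     ('p \<Rightarrow> 'p diffop \<Rightarrow> 'p diffop \<Rightarrow> real) \<Rightarrow> (real \<Rightarrow> 'p) \<Rightarrow> ennreal" where
  "curve_length C g \<gamma> =
     (\<integral>\<^sup>+ s\<in>{0..1}. ennreal (sqrt (g (\<gamma> s) (velocity C \<gamma> s) (velocity C \<gamma> s))) \<partial>lborel)"

text \<open>The distance is \<open>\<infinity>\<close> between different components.\<close>

definition riem_dist ::
    "('p::topological_space, 'c::euclidean_space) chart set \<Rightarrow>
     ('p \<Rightarrow> 'p diffop \<Rightarrow> 'p diffop \<Rightarrow> real) \<Rightarrow> 'p \<Rightarrow> 'p \<Rightarrow> ennreal" where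
  "riem_dist C g p z = (INF \<gamma>\<in>piecewise_C1_curves C p z. curve_length C g \<gamma>)"

text \<open>
  As a real function.  The conversion of \<open>\<infinity>\<close> is irrelevant for continuous paths
  starting at \<open>p\<close>, which never leave the component of \<open>p\<close>.
\<close>

definition dist_sq ::
    "('p::topological_space, 'c::euclidean_space) chart set \<Rightarrow>
     ('p \<Rightarrow> 'p diffop \<Rightarrow> 'p diffop \<Rightarrow> real) \<Rightarrow> 'p \<Rightarrow> 'p \<Rightarrow> real" where
  "dist_sq C g p z = (enn2real (riem_dist C g p z))\<^sup>2"

section \<open>Wiener processes and the Ito integral\<close>

definition filtered_prob_space :: "'w measure \<Rightarrow> (real \<Rightarrow> 'w measure) \<Rightarrow> bool" where
  "filtered_prob_space Q F \<longleftrightarrow>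
     prob_space Q \<and> filtration (space Q) F \<and> (\<forall>t. sets (F t) \<subseteq> sets Q)"

definition wiener_process ::
    "'w measure \<Rightarrow> (real \<Rightarrow> 'w measure) \<Rightarrow> (real \<Rightarrow> 'w \<Rightarrow> real ^ 'd) \<Rightarrow> bool" where
  "wiener_process Q F W \<longleftrightarrow>
     (AE \<omega> in Q. W 0 \<omega> = 0) \<and>
     (AE \<omega> in Q. continuous_on {0..} (\<lambda>t. W t \<omega>)) \<and>
     (\<forall>t\<ge>0. W t \<in> borel_measurable (F t)) \<and>
     (\<forall>s t. 0 \<le> s \<longrightarrow> s < t \<longrightarrow>
        (\<forall>l. distributed Q lborel (\<lambda>\<omega>. W t \<omega> $ l - W s \<omega> $ l) (normal_density 0 (sqrt (t - s)))) \<and>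
        prob_space.indep_vars Q (\<lambda>_. borel) (\<lambda>l \<omega>. W t \<omega> $ l - W s \<omega> $ l) UNIV \<and>
        prob_space.indep_set Q (sets (F s))
          (sets (vimage_algebra (space Q) (\<lambda>\<omega>. W t \<omega> - W s \<omega>) borel)))"

definition progressive ::
    "(real \<Rightarrow> 'w measure) \<Rightarrow> real \<Rightarrow> (real \<Rightarrow> 'w \<Rightarrow> real) \<Rightarrow> bool" where
  "progressive F T H \<longleftrightarrow> (\<forall>t\<in>{0..T}.
     (\<lambda>(s, \<omega>). H s \<omega>) \<in> borel_measurable (restrict_space borel {0..t} \<Otimes>\<^sub>M F t))"

text \<open>
  A simple process \<open>\<Sum>i<k. \<xi>\<^sub>i 1(\<tau>\<^sub>i, \<tau>\<^sub>i\<^sub>+\<^sub>1]\<close> on \<open>[0,T]\<close>, with deterministic times and bounded \<open>\<xi>\<^sub>i\<close>,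
  is represented by \<open>(k, \<tau>, \<xi>)\<close>.
\<close>

type_synonym 'w simple_proc = "nat \<times> (nat \<Rightarrow> real) \<times> (nat \<Rightarrow> 'w \<Rightarrow> real)"

fun is_simple_proc :: "(real \<Rightarrow> 'w measure) \<Rightarrow> real \<Rightarrow> 'w simple_proc \<Rightarrow> bool" where
  "is_simple_proc F T (k, \<tau>, \<xi>) \<longleftrightarrow> 0 \<le> \<tau> 0 \<and> (\<forall>i<k. \<tau> i \<le> \<tau> (Suc i)) \<and> \<tau> k \<le> T \<and>
     (\<forall>i<k. \<xi> i \<in> borel_measurable (F (\<tau> i)) \<and> (\<exists>K. \<forall>\<omega>\<in>space (F (\<tau> i)). \<bar>\<xi> i \<omega>\<bar> \<le> K))"

fun simple_val :: "'w simple_proc \<Rightarrow> real \<Rightarrow> 'w \<Rightarrow> real" where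
  "simple_val (k, \<tau>, \<xi>) s \<omega> = (\<Sum>i<k. \<xi> i \<omega> * indicator {\<tau> i<..\<tau> (Suc i)} s)"

fun simple_integral :: "(real \<Rightarrow> 'w \<Rightarrow> real) \<Rightarrow> 'w simple_proc \<Rightarrow> real \<Rightarrow> 'w \<Rightarrow> real" where
  "simple_integral B (k, \<tau>, \<xi>) t \<omega> =
     (\<Sum>i<k. \<xi> i \<omega> * (B (min t (\<tau> (Suc i))) \<omega> - B (min t (\<tau> i)) \<omega>))"

definition tends_to_0_in_prob :: "'w measure \<Rightarrow> (nat \<Rightarrow> 'w \<Rightarrow> ennreal) \<Rightarrow> bool" where
  "tends_to_0_in_prob Q Z \<longleftrightarrow> (\<forall>n. Z n \<in> borel_measurable Q) \<and>
     (\<forall>\<delta>>0. (\<lambda>n. measure Q {\<omega>\<in>space Q. Z n \<omega> > ennreal \<delta>}) \<longlonglongrightarrow> 0)"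

text \<open>
  \<open>I\<close> is a version of \<open>(\<integral>\<^sub>0\<^sup>t H dB)\<^sub>t\<close> on \<open>[0,T]\<close>: \<open>H\<close> is progressive with \<open>\<integral>\<^sub>0\<^sup>T H\<^sup>2 ds < \<infinity>\<close> a.s., \<open>I\<close> has a.s.
  continuous paths and is the limit in probability of the integrals of simple processes that
  approximate \<open>H\<close> in \<open>L\<^sup>2([0,T])\<close> in probability.  This determines \<open>I\<close> up to indistinguishability.
\<close>

definition ito_integral ::
    "'w measure \<Rightarrow> (real \<Rightarrow> 'w measure) \<Rightarrow> (real \<Rightarrow> 'w \<Rightarrow> real) \<Rightarrow> real \<Rightarrow>
     (real \<Rightarrow> 'w \<Rightarrow> real) \<Rightarrow> (real \<Rightarrow> 'w \<Rightarrow> real) \<Rightarrow> bool" where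
  "ito_integral Q F B T H I \<longleftrightarrow>
     progressive F T H \<and>
     (AE \<omega> in Q. (\<integral>\<^sup>+ s\<in>{0..T}. ennreal ((H s \<omega>)\<^sup>2) \<partial>lborel) < \<infinity>) \<and>
     (\<forall>t\<in>{0..T}. I t \<in> borel_measurable Q) \<and>
     (AE \<omega> in Q. continuous_on {0..T} (\<lambda>t. I t \<omega>)) \<and>
     (\<exists>S. (\<forall>n. is_simple_proc F T (S n)) \<and>
        tends_to_0_in_prob Q
          (\<lambda>n \<omega>. \<integral>\<^sup>+ s\<in>{0..T}. ennreal ((simple_val (S n) s \<omega> - H s \<omega>)\<^sup>2) \<partial>lborel) \<and>
        (\<forall>t\<in>{0..T}. tends_to_0_in_prob Q
          (\<lambda>n \<omega>. ennreal \<bar>simple_integral B (S n) t \<omega> - I t \<omega>\<bar>)))"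

section \<open>Semi-martingales\<close>

definition martingale_on ::
    "'w measure \<Rightarrow> (real \<Rightarrow> 'w measure) \<Rightarrow> real \<Rightarrow> (real \<Rightarrow> 'w \<Rightarrow> real) \<Rightarrow> bool" where
  "martingale_on Q F T Y \<longleftrightarrow>
     (\<forall>t\<in>{0..T}. Y t \<in> borel_measurable (F t) \<and> integrable Q (Y t)) \<and>
     (\<forall>s t. 0 \<le> s \<longrightarrow> s \<le> t \<longrightarrow> t \<le> T \<longrightarrow> (AE \<omega> in Q. real_cond_exp Q (F s) (Y t) \<omega> = Y s \<omega>))"

definition local_martingale_on ::
    "'w measure \<Rightarrow> (real \<Rightarrow> 'w measure) \<Rightarrow> real \<Rightarrow> (real \<Rightarrow> 'w \<Rightarrow> real) \<Rightarrow> bool" where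
  "local_martingale_on Q F T Y \<longleftrightarrow>
     (\<exists>\<tau> :: nat \<Rightarrow> 'w \<Rightarrow> real.
        (\<forall>n. stopping_time F (\<tau> n) \<and>
             (\<forall>\<omega>\<in>space Q. 0 \<le> \<tau> n \<omega> \<and> \<tau> n \<omega> \<le> T \<and> \<tau> n \<omega> \<le> \<tau> (Suc n) \<omega>)) \<and>
        (AE \<omega> in Q. \<exists>n. \<tau> n \<omega> = T) \<and>
        (\<forall>n. martingale_on Q F T (\<lambda>t \<omega>. Y (min t (\<tau> n \<omega>)) \<omega>)))"

definition finite_variation_on :: "real \<Rightarrow> (real \<Rightarrow> real) \<Rightarrow> bool" where
  "finite_variation_on T y \<longleftrightarrow> (\<exists>K. \<forall>k. \<forall>\<tau> :: nat \<Rightarrow> real. mono \<tau> \<longrightarrow> range \<tau> \<subseteq> {0..T} \<longrightarrow>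
     (\<Sum>i<k. \<bar>y (\<tau> (Suc i)) - y (\<tau> i)\<bar>) \<le> K)"

definition real_semimartingale ::
    "'w measure \<Rightarrow> (real \<Rightarrow> 'w measure) \<Rightarrow> real \<Rightarrow> (real \<Rightarrow> 'w \<Rightarrow> real) \<Rightarrow> bool" where
  "real_semimartingale Q F T Y \<longleftrightarrow>
     (\<forall>t\<in>{0..T}. Y t \<in> borel_measurable (F t)) \<and>
     (\<exists>N A. local_martingale_on Q F T N \<and>
        (\<forall>t\<in>{0..T}. A t \<in> borel_measurable (F t)) \<and>
        (AE \<omega> in Q. N 0 \<omega> = 0 \<and> A 0 \<omega> = 0 \<and>
           continuous_on {0..T} (\<lambda>t. N t \<omega>) \<and> continuous_on {0..T} (\<lambda>t. A t \<omega>) \<and>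
           finite_variation_on T (\<lambda>t. A t \<omega>) \<and>
           (\<forall>t\<in>{0..T}. Y t \<omega> = Y 0 \<omega> + N t \<omega> + A t \<omega>)))"

text \<open>
  Manifold-valued semi-martingales in the sense of Schwartz and Emery: continuous adapted
  processes all of whose images under smooth functions are real semi-martingales.
\<close>

definition manifold_semimartingale ::
    "'w measure \<Rightarrow> (real \<Rightarrow> 'w measure) \<Rightarrow>
     ('z::topological_space, 'e::euclidean_space) chart set \<Rightarrow> real \<Rightarrow> (real \<Rightarrow> 'w \<Rightarrow> 'z) \<Rightarrow> bool" where
  "manifold_semimartingale Q F A T Z \<longleftrightarrow>
     (\<forall>t\<in>{0..T}. Z t \<in> F t \<rightarrow>\<^sub>M borel) \<and>
     (\<forall>\<omega>\<in>space Q. continuous_on {0..T} (\<lambda>t. Z t \<omega>)) \<and>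
     (\<forall>f. smooth_fun_on A UNIV f \<longrightarrow> real_semimartingale Q F T (\<lambda>t \<omega>. f (Z t \<omega>)))"

section \<open>The stochastic differential-algebraic equation\<close>

definition drift_op ::
    "('m \<Rightarrow> 'm diffop \<Rightarrow> 'm diffop) \<Rightarrow> ('m \<Rightarrow> 'n \<Rightarrow> 'm diffop) \<Rightarrow>
     ('d::finite \<Rightarrow> 'm \<Rightarrow> 'n \<Rightarrow> 'm diffop) \<Rightarrow> 'm \<Rightarrow> 'n \<Rightarrow> 'm diffop" where
  "drift_op G V \<sigma> x u = (\<lambda>f. V x u f + 1/2 * (\<Sum>l\<in>UNIV. G x (\<sigma> l x u) f))"

definition solves_sde ::
    "'w measure \<Rightarrow> (real \<Rightarrow> 'w measure) \<Rightarrow> (real \<Rightarrow> 'w \<Rightarrow> real ^ 'd::finite) \<Rightarrow>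
     ('m::topological_space, 'a::euclidean_space) chart set \<Rightarrow>
     ('m \<Rightarrow> 'm diffop \<Rightarrow> 'm diffop) \<Rightarrow> ('m \<Rightarrow> 'n \<Rightarrow> 'm diffop) \<Rightarrow>
     ('d \<Rightarrow> 'm \<Rightarrow> 'n \<Rightarrow> 'm diffop) \<Rightarrow> real \<Rightarrow> (real \<Rightarrow> 'w \<Rightarrow> 'm) \<Rightarrow> (real \<Rightarrow> 'w \<Rightarrow> 'n) \<Rightarrow> bool" where
  "solves_sde Q F W A G V \<sigma> T X U \<longleftrightarrow>
     (\<forall>f. smooth_fun_on A UNIV f \<longrightarrow>
        progressive F T (\<lambda>s \<omega>. drift_op G V \<sigma> (X s \<omega>) (U s \<omega>) f) \<and>
        (AE \<omega> in Q. set_integrable lborel {0..T} (\<lambda>s. drift_op G V \<sigma> (X s \<omega>) (U s \<omega>) f)) \<and>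
        (\<exists>I :: 'd \<Rightarrow> real \<Rightarrow> 'w \<Rightarrow> real.
           (\<forall>l. ito_integral Q F (\<lambda>t \<omega>. W t \<omega> $ l) T (\<lambda>s \<omega>. \<sigma> l (X s \<omega>) (U s \<omega>) f) (I l)) \<and>
           (AE \<omega> in Q. \<forall>t\<in>{0..T}. f (X t \<omega>) = f (X 0 \<omega>)
              + (LBINT s:{0..t}. drift_op G V \<sigma> (X s \<omega>) (U s \<omega>) f) + (\<Sum>l\<in>UNIV. I l t \<omega>))))"

text \<open>
  Semi-martingale solutions on \<open>[0,T]\<close> of the SDE that start on the constraint set; \<open>(0,T]\<close> is then
  an interval of existence.
\<close>

definition solution_from_constraint ::
    "'w measure \<Rightarrow> (real \<Rightarrow> 'w measure) \<Rightarrow> (real \<Rightarrow> 'w \<Rightarrow> real ^ 'd::finite) \<Rightarrow>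
     ('m::topological_space, 'a::euclidean_space) chart set \<Rightarrow>
     ('n::topological_space, 'b::euclidean_space) chart set \<Rightarrow>
     ('m \<Rightarrow> 'm diffop \<Rightarrow> 'm diffop) \<Rightarrow> ('m \<Rightarrow> 'n \<Rightarrow> 'm diffop) \<Rightarrow>
     ('d \<Rightarrow> 'm \<Rightarrow> 'n \<Rightarrow> 'm diffop) \<Rightarrow> ('m \<Rightarrow> 'p) \<Rightarrow> 'p \<Rightarrow> real \<Rightarrow>
     (real \<Rightarrow> 'w \<Rightarrow> 'm) \<Rightarrow> (real \<Rightarrow> 'w \<Rightarrow> 'n) \<Rightarrow> bool" where
  "solution_from_constraint Q F W A B G V \<sigma> h p T X U \<longleftrightarrow>
     manifold_semimartingale Q F (prod_atlas A B) T (\<lambda>t \<omega>. (X t \<omega>, U t \<omega>)) \<and>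
     solves_sde Q F W A G V \<sigma> T X U \<and>
     (AE \<omega> in Q. h (X 0 \<omega>) = p)"

definition constraint_drift ::
    "('m \<Rightarrow> 'm diffop \<Rightarrow> 'm diffop) \<Rightarrow> ('m \<Rightarrow> 'n \<Rightarrow> 'm diffop) \<Rightarrow>
     ('d::finite \<Rightarrow> 'm \<Rightarrow> 'n \<Rightarrow> 'm diffop) \<Rightarrow> ('m \<Rightarrow> 'p) \<Rightarrow> 'm \<Rightarrow> 'n \<Rightarrow> 'p diffop" where
  "constraint_drift G V \<sigma> h x u = (\<lambda>f.
     pushforward h (V x u) f
     + 1/2 * (\<Sum>l\<in>UNIV. pushforward h (nabla_strat G (\<lambda>y. \<sigma> l y u) x) f)
     + 1/2 * (\<Sum>l\<in>UNIV. strat_generator_along h (\<lambda>y. \<sigma> l y u) x f))"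

definition range_set ::
    "'w measure \<Rightarrow> real \<Rightarrow> (real \<Rightarrow> 'w \<Rightarrow> 'm) \<Rightarrow> (real \<Rightarrow> 'w \<Rightarrow> 'n) \<Rightarrow> ('m \<times> 'n) set" where
  "range_set Q T X U = {(X t \<omega>, U t \<omega>) | t \<omega>. t \<in> {0<..T} \<and> \<omega> \<in> space Q}"

text \<open>Measurability is required explicitly, because \<open>measure\<close> vanishes on non-measurable sets.\<close>

definition exceeds_with_prob_le ::
    "'w measure \<Rightarrow> ('p::topological_space, 'c::euclidean_space) chart set \<Rightarrow>
     ('p \<Rightarrow> 'p diffop \<Rightarrow> 'p diffop \<Rightarrow> real) \<Rightarrow> ('m \<Rightarrow> 'p) \<Rightarrow> 'p \<Rightarrow> (real \<Rightarrow> 'w \<Rightarrow> 'm) \<Rightarrow>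
     real \<Rightarrow> real \<Rightarrow> real \<Rightarrow> bool" where
  "exceeds_with_prob_le Q C g h p X \<epsilon> \<alpha> t \<longleftrightarrow>
     (let E = {\<omega>\<in>space Q. (SUP s\<in>{0..t}. riem_dist C g p (h (X s \<omega>))) > ennreal \<epsilon>}
      in E \<in> sets Q \<and> measure Q E \<le> \<alpha>)"

definition local_bounded_m_solution ::
    "'w measure \<Rightarrow> (real \<Rightarrow> 'w measure) \<Rightarrow> (real \<Rightarrow> 'w \<Rightarrow> real ^ 'd::finite) \<Rightarrow>
     ('m::topological_space, 'a::euclidean_space) chart set \<Rightarrow>
     ('n::topological_space, 'b::euclidean_space) chart set \<Rightarrow>
     ('p::topological_space, 'c::euclidean_space) chart set \<Rightarrow>
     ('p \<Rightarrow> 'p diffop \<Rightarrow> 'p diffop \<Rightarrow> real) \<Rightarrow>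
     ('m \<Rightarrow> 'm diffop \<Rightarrow> 'm diffop) \<Rightarrow> ('m \<Rightarrow> 'n \<Rightarrow> 'm diffop) \<Rightarrow>
     ('d \<Rightarrow> 'm \<Rightarrow> 'n \<Rightarrow> 'm diffop) \<Rightarrow> ('m \<Rightarrow> 'p) \<Rightarrow> 'p \<Rightarrow> real \<Rightarrow> real \<Rightarrow>
     (real \<Rightarrow> 'w \<Rightarrow> 'm) \<Rightarrow> (real \<Rightarrow> 'w \<Rightarrow> 'n) \<Rightarrow> bool" where
  "local_bounded_m_solution Q F W A B C g G V \<sigma> h p \<epsilon> \<alpha> X U \<longleftrightarrow>
     (\<exists>T>0. solution_from_constraint Q F W A B G V \<sigma> h p T X U \<and>
        (\<forall>t\<in>{0<..T}. exceeds_with_prob_le Q C g h p X \<epsilon> \<alpha> t))"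

end

theory Submission
  imports Defs
begin

text \<open>
  Along the solution the squared distance from \<open>p\<close> is nonnegative, starts at 0 and has drift \<open>-b\<close> times itself,
  which is nonpositive as soon as \<open>b \<ge> 0\<close>.  Its martingale part therefore dominates it; bounded diffusion
  coefficients make the martingale part a true martingale of expectation 0, so the squared distance vanishes
  almost surely and the exceedance event is a null set for every \<open>b > max (\<Lambda> / (\<alpha> \<epsilon>\<^sup>4)) 0\<close>.

  Since the equation only speaks about globally smooth functions, the squared distance \<open>D\<close> is replaced by \<open>\<theta>(D)\<close>,
  where \<open>\<theta>(y) = exp (-1/\<delta>) - exp (-1/(\<delta> - y))\<close> for \<open>y < \<delta>\<close> and \<open>\<theta>\<close> is constant beyond \<open>\<delta>\<close>.  It is increasing and, for
  \<open>\<delta> \<le> 1/2\<close>, concave on the half line, so its drift stays nonpositive without any stopping times; and it is globally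
  smooth because the Riemannian distance from \<open>p\<close> is bounded below outside a coordinate ball around \<open>p\<close>.
\<close>

section \<open>Calculus of smooth functions\<close>

text \<open>Concavity is forced by the Ito correction: the drift of \<open>\<theta>(D)\<close> is
  \<open>\<theta>'\<close> times the drift of \<open>D\<close> plus half of
  \<open>\<theta>''\<close> times the sum of the squared diffusion coefficients, and this second
  term must not be positive. The Ito integral is given only as a limit in probability of integrals
  of simple processes, so expectation 0 has to be extracted from the approximants: cut down to a
  common energy bound, they have bounded second moments, and this lets their expectations pass to
  the limit. The geometry rests on comparing the metric with the Euclidean norm on compact subsets
  of a chart. The upper comparison makes \<open>riem_dist\<close> continuous, the lower one keeps it
  away from 0 outside a coordinate ball. Smoothness of \<open>D\<close> is assumed only at the
  points visited by the paths; almost all of them start at \<open>p\<close>, which yields smoothness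
  near \<open>p\<close>, and everywhere else the truncated function is constant.\<close>

lemma frechet_derivativeI:
  "(f has_derivative f') (at x) \<Longrightarrow> frechet_derivative f (at x) = f'"
  by (metis frechet_derivative_at)

lemma Ck_on_subset: "Ck_on k f S \<Longrightarrow> T \<subseteq> S \<Longrightarrow> Ck_on k f T"
  by (induction k arbitrary: f) (auto intro: continuous_on_subset)

lemma Ck_on_SucD: "Ck_on (Suc k) f S \<Longrightarrow> Ck_on k f S"
proof (induction k arbitrary: f)
  case 0
  then have "isCont f x" if "x \<in> S" for x
    using that by (auto intro: differentiable_imp_continuous_within)
  then show ?case
    by (auto intro: continuous_at_imp_continuous_on)
next
  case (Suc k)
  then show ?case
    using Ck_on.simps(2) by blast
qed

text \<open>Derivatives are taken in the whole space, so agreement on \<open>S\<close> determines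
  them only because \<open>S\<close> is open.\<close>

lemma Ck_on_cong:
  assumes "open S" and eq: "\<And>x. x \<in> S \<Longrightarrow> f x = g x" and "Ck_on k f S"
  shows "Ck_on k g S"
  using eq assms(3)
proof (induction k arbitrary: f g)
  case 0
  then show ?case
    by (auto cong: continuous_on_cong)
next
  case (Suc k)
  have d: "f differentiable (at x)" if "x \<in> S" for x
    using Suc.prems that by simp
  have "g differentiable (at x)" if "x \<in> S" for x
    using d[OF that] Suc.prems(1) that \<open>open S\<close>
    unfolding differentiable_def by (metis has_derivative_transform_within_open)
  moreover have "frechet_derivative f (at x) v = frechet_derivative g (at x) v" if "x \<in> S" for x v
    using frechet_derivative_transform_within_open[OF d[OF that] \<open>open S\<close> that Suc.prems(1)] by simp
  moreover have "Ck_on k (\<lambda>x. frechet_derivative g (at x) v) S" for v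
    by (rule Suc.IH[of "\<lambda>x. frechet_derivative f (at x) v"]) (use calculation Suc.prems(2) in auto)
  ultimately show ?case
    by simp
qed

lemma Ck_on_local:
  assumes "\<And>x. x \<in> S \<Longrightarrow> \<exists>U. open U \<and> x \<in> U \<and> Ck_on k f U"
  shows "Ck_on k f S"
  using assms
proof (induction k arbitrary: f)
  case 0
  have "isCont f x" if "x \<in> S" for x
    using 0[OF that] by (auto simp: continuous_on_eq_continuous_at)
  then show ?case
    by (auto intro: continuous_at_imp_continuous_on)
next
  case (Suc k)
  have "f differentiable (at x)" if "x \<in> S" for x
    using Suc.prems[OF that] by auto
  moreover have "Ck_on k (\<lambda>x. frechet_derivative f (at x) v) S" for v
    by (rule Suc.IH) (use Suc.prems in fastforce)
  ultimately show ?case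
    by simp
qed

lemma Ck_on_const: "Ck_on k (\<lambda>x. c) S"
  by (induction k arbitrary: c) (auto simp: frechet_derivativeI[OF has_derivative_const])

lemma Ck_on_bounded_linear: "bounded_linear f \<Longrightarrow> Ck_on k f S"
proof (induction k)
  case 0
  then show ?case
    by (simp add: linear_continuous_on)
next
  case (Suc k)
  have d: "(f has_derivative f) (at x)" for x
    using Suc.prems by (simp add: bounded_linear_imp_has_derivative)
  show ?case
    unfolding Ck_on.simps frechet_derivativeI[OF d] using differentiableI[OF d] Ck_on_const by blast
qed

lemma Ck_on_add:
  assumes "open S" "Ck_on k f S" "Ck_on k g S"
  shows "Ck_on k (\<lambda>x. f x + g x) S"
  using assms(2,3)
proof (induction k arbitrary: f g)
  case 0
  then show ?case
    by (simp add: continuous_on_add)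
next
  case (Suc k)
  have d: "((\<lambda>x. f x + g x) has_derivative
      (\<lambda>v. frechet_derivative f (at x) v + frechet_derivative g (at x) v)) (at x)"
    if "x \<in> S" for x
    using Suc.prems that by (auto intro!: has_derivative_add simp: frechet_derivative_works[symmetric])
  have "Ck_on k (\<lambda>x. frechet_derivative (\<lambda>x. f x + g x) (at x) v) S" for v
    by (rule Ck_on_cong[OF \<open>open S\<close> _ Suc.IH[of "\<lambda>x. frechet_derivative f (at x) v"
            "\<lambda>x. frechet_derivative g (at x) v"]])
      (use Suc.prems d[THEN frechet_derivativeI] in auto)
  then show ?case
    using differentiableI[OF d] by simp
qed

lemma Ck_on_sum:
  assumes "open S" "\<And>i. i \<in> I \<Longrightarrow> Ck_on k (f i) S"
  shows "Ck_on k (\<lambda>x. \<Sum>i\<in>I. f i x) S"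
  using assms(2)
  by (induction I rule: infinite_finite_induct) (auto intro: Ck_on_const Ck_on_add[OF \<open>open S\<close>])

text \<open>The product rule, for an arbitrary bilinear product: real multiplication occurs for the
  flat functions, scaling and the inner product in the chain rule.\<close>

lemma Ck_on_bilinear:
  fixes prod :: "'b::euclidean_space \<Rightarrow> 'c::euclidean_space \<Rightarrow> 'd::euclidean_space"
  assumes "bounded_bilinear prod" "open S" "Ck_on k f S" "Ck_on k g S"
  shows "Ck_on k (\<lambda>x. prod (f x) (g x)) S"
  using assms(3,4)
proof (induction k arbitrary: f g)
  case 0
  then show ?case
    by (simp add: bounded_bilinear.continuous_on[OF assms(1)])
next
  case (Suc k)
  have d: "((\<lambda>x. prod (f x) (g x)) has_derivative
      (\<lambda>v. prod (f x) (frechet_derivative g (at x) v) + prod (frechet_derivative f (at x) v) (g x))) (at x)"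
    if "x \<in> S" for x
    using Suc.prems that by (auto intro!: bounded_bilinear.FDERIV[OF assms(1)] simp: frechet_derivative_works[symmetric])
  have "Ck_on k (\<lambda>x. prod (f x) (frechet_derivative g (at x) v)
      + prod (frechet_derivative f (at x) v) (g x)) S" for v
    using Suc.prems Suc.prems[THEN Ck_on_SucD] by (intro Ck_on_add[OF \<open>open S\<close>] Suc.IH) auto
  then have "Ck_on k (\<lambda>x. frechet_derivative (\<lambda>x. prod (f x) (g x)) (at x) v) S" for v
    by (rule Ck_on_cong[OF \<open>open S\<close>, rotated]) (use d[THEN frechet_derivativeI] in auto)
  then show ?case
    using differentiableI[OF d] by simp
qed

text \<open>Expanding the derivative of \<open>f\<close> in the basis turns the derivative of the
  composition into a finite sum of products. Each factor is a derivative of \<open>f\<close> or a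
  partial derivative of \<open>g\<close> composed with \<open>f\<close>, and the latter falls under
  the induction hypothesis.\<close>

lemma Ck_on_compose:
  fixes f :: "'a::euclidean_space \<Rightarrow> 'b::euclidean_space" and g :: "'b \<Rightarrow> 'c::euclidean_space"
  assumes "open S" "f ` S \<subseteq> T" "Ck_on k f S" "Ck_on k g T"
  shows "Ck_on k (g \<circ> f) S"
  using assms(3,4)
proof (induction k arbitrary: g)
  case 0
  then show ?case
    using continuous_on_compose[OF _ continuous_on_subset[OF _ assms(2)]] by simp
next
  case (Suc k)
  have df: "f differentiable (at x)" and dg: "g differentiable (at (f x))" if "x \<in> S" for x
    using Suc.prems assms(2) that by auto
  have "frechet_derivative (g \<circ> f) (at x) v
      = (\<Sum>i\<in>Basis. (frechet_derivative f (at x) v \<bullet> i) *\<^sub>R (frechet_derivative g (at (f x)) i))"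
    if "x \<in> S" for x v
  proof -
    interpret linear "frechet_derivative g (at (f x))"
      using dg[OF that] by (rule linear_frechet_derivative)
    have "frechet_derivative g (at (f x)) (\<Sum>i\<in>Basis. (u \<bullet> i) *\<^sub>R i)
        = (\<Sum>i\<in>Basis. (u \<bullet> i) *\<^sub>R frechet_derivative g (at (f x)) i)" for u
      by (simp add: sum scale del: euclidean_representation)
    from this[of "frechet_derivative f (at x) v"] show ?thesis
      unfolding euclidean_representation frechet_derivative_compose[OF df[OF that] dg[OF that]] by simp
  qed
  moreover have "Ck_on k (\<lambda>x. \<Sum>i\<in>Basis.
      (frechet_derivative f (at x) v \<bullet> i) *\<^sub>R (frechet_derivative g (at (f x)) i)) S" for v
  proof (intro Ck_on_sum[OF \<open>open S\<close>] Ck_on_bilinear[OF bounded_bilinear_scaleR \<open>open S\<close>]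
      Ck_on_bilinear[OF bounded_bilinear_inner \<open>open S\<close>] Ck_on_const)
    show "Ck_on k (\<lambda>x. frechet_derivative f (at x) v) S"
      using Suc.prems by simp
    show "Ck_on k (\<lambda>x. frechet_derivative g (at (f x)) i) S" for i
      using Suc.IH[of "\<lambda>y. frechet_derivative g (at y) i"] Suc.prems
        Suc.prems(1)[THEN Ck_on_SucD] by (simp add: o_def)
  qed
  ultimately have "Ck_on k (\<lambda>x. frechet_derivative (g \<circ> f) (at x) v) S" for v
    by (subst Ck_on_cong[OF \<open>open S\<close>]) auto
  moreover have "(g \<circ> f) differentiable (at x)" if "x \<in> S" for x
    using df[OF that] dg[OF that] differentiable_chain_at by blast
  ultimately show ?case
    unfolding Ck_on.simps by blast
qed

lemma smooth_on_subset: "smooth_on S f \<Longrightarrow> T \<subseteq> S \<Longrightarrow> smooth_on T f"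
  unfolding smooth_on_def using Ck_on_subset by blast

lemma smooth_on_cong:
  "open S \<Longrightarrow> (\<And>x. x \<in> S \<Longrightarrow> f x = g x) \<Longrightarrow> smooth_on S f \<Longrightarrow> smooth_on S g"
  unfolding smooth_on_def using Ck_on_cong by blast

lemma smooth_on_local:
  "(\<And>x. x \<in> S \<Longrightarrow> \<exists>U. open U \<and> x \<in> U \<and> smooth_on U f) \<Longrightarrow> smooth_on S f"
  unfolding smooth_on_def by (intro allI Ck_on_local) blast

lemma smooth_on_const: "smooth_on S (\<lambda>x. c)"
  by (simp add: smooth_on_def Ck_on_const)

lemma smooth_on_bounded_linear: "bounded_linear f \<Longrightarrow> smooth_on S f"
  by (simp add: smooth_on_def Ck_on_bounded_linear)

lemma smooth_on_add:
  "open S \<Longrightarrow> smooth_on S f \<Longrightarrow> smooth_on S g \<Longrightarrow> smooth_on S (\<lambda>x. f x + g x)"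
  by (simp add: smooth_on_def Ck_on_add)

lemma smooth_on_compose:
  "open S \<Longrightarrow> f ` S \<subseteq> T \<Longrightarrow> smooth_on S f \<Longrightarrow> smooth_on T g \<Longrightarrow> smooth_on S (g \<circ> f)"
  by (simp add: smooth_on_def Ck_on_compose)

lemma smooth_on_imp_continuous_on: "smooth_on S f \<Longrightarrow> continuous_on S f"
  unfolding smooth_on_def by (metis Ck_on.simps(1))

lemma smooth_on_differentiable: "smooth_on S f \<Longrightarrow> x \<in> S \<Longrightarrow> f differentiable (at x)"
  unfolding smooth_on_def by (metis Ck_on.simps(2))

lemma smooth_on_frechet_derivative:
  "smooth_on S f \<Longrightarrow> smooth_on S (\<lambda>x. frechet_derivative f (at x) v)"
  unfolding smooth_on_def by (metis Ck_on.simps(2))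

section \<open>A flat function\<close>

text \<open>The polynomial makes the family closed under differentiation; \<open>flat_exp 1\<close> is the function of interest.\<close>

definition flat_exp :: "real poly \<Rightarrow> real \<Rightarrow> real" where
  "flat_exp q s = (if s > 0 then poly q (1 / s) * exp (- 1 / s) else 0)"

text \<open>The derivative of \<open>q(1/s) exp(-1/s)\<close> is
  \<open>s^(-2) (q - q')(1/s) exp(-1/s)\<close>; the polynomial \<open>[:0, 0, 1:]\<close> accounts
  for the factor \<open>s^(-2)\<close>.\<close>

definition flat_diff :: "real poly \<Rightarrow> real poly" where
  "flat_diff q = [:0, 0, 1:] * (q - pderiv q)"

lemma tendsto_poly_exp_at_top: "((\<lambda>x. poly q x * exp (- x)) \<longlongrightarrow> (0::real)) at_top"
proof -
  have "((\<lambda>x. \<Sum>i\<le>degree q. coeff q i * (x ^ i / exp x)) \<longlongrightarrow> (\<Sum>i\<le>degree q. coeff q i * 0)) at_top"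
    by (intro tendsto_intros tendsto_power_div_exp_0)
  moreover have "poly q x * exp (- x) = (\<Sum>i\<le>degree q. coeff q i * (x ^ i / exp x))" for x
    by (simp add: poly_altdef sum_distrib_right exp_minus divide_inverse mult.assoc)
  ultimately show ?thesis
    by simp
qed

lemma flat_exp_has_derivative: "(flat_exp q has_real_derivative flat_exp (flat_diff q) s) (at s)"
proof -
  consider "s > 0" | "s < 0" | "s = 0" by linarith
  then show ?thesis
  proof cases
    case 1
    have "((\<lambda>s. poly q (1 / s) * exp (- 1 / s)) has_real_derivative flat_exp (flat_diff q) s) (at s)"
      using 1 by (auto intro!: derivative_eq_intros poly_DERIV[THEN DERIV_chain2]
          simp: flat_exp_def flat_diff_def power2_eq_square field_simps)
    then show ?thesis
      by (rule has_field_derivative_transform_within_open[of _ _ _ "{0<..}"])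
        (use 1 in \<open>auto simp: flat_exp_def\<close>)
  next
    case 2
    have "((\<lambda>s. 0) has_real_derivative flat_exp (flat_diff q) s) (at s)"
      using 2 by (auto simp: flat_exp_def)
    then show ?thesis
      by (rule has_field_derivative_transform_within_open[of _ _ _ "{..<0}"])
        (use 2 in \<open>auto simp: flat_exp_def\<close>)
  next
    case 3
    \<comment> \<open>\<open>pCons 0 q\<close> is \<open>q\<close> times its argument, so at
      \<open>inverse y\<close> this is the difference quotient \<open>flat_exp q y / y\<close> for
      \<open>y > 0\<close>.\<close>
    have "((\<lambda>y. poly (pCons 0 q) (inverse y) * exp (- inverse y)) \<longlongrightarrow> 0) (at_right (0::real))"
      by (rule filterlim_compose[OF tendsto_poly_exp_at_top filterlim_inverse_at_top_right])
    then have "((\<lambda>y. flat_exp q y / y) \<longlongrightarrow> 0) (at_right 0)"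
      by (rule Lim_transform_eventually)
        (auto simp: flat_exp_def eventually_at_filter field_simps inverse_eq_divide)
    moreover have "((\<lambda>y. flat_exp q y / y) \<longlongrightarrow> 0) (at_left 0)"
      by (rule tendsto_eventually) (auto simp: flat_exp_def eventually_at_filter)
    ultimately have "((\<lambda>y. flat_exp q y / y) \<longlongrightarrow> 0) (at 0)"
      by (simp add: filterlim_at_split)
    then show ?thesis
      using 3 by (simp add: has_field_derivative_iff flat_exp_def)
  qed
qed

lemma flat_exp_smooth: "smooth_on S (flat_exp q)"
proof -
  have "Ck_on k (flat_exp q) UNIV" for k
  proof (induction k arbitrary: q)
    case 0
    show ?case
      using flat_exp_has_derivative by (auto intro!: DERIV_isCont continuous_at_imp_continuous_on)
  next
    case (Suc k)
    have d: "(flat_exp q has_derivative (\<lambda>v. flat_exp (flat_diff q) x * v)) (at x)" for x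
      using flat_exp_has_derivative by (simp add: has_field_derivative_def)
    then show ?case
      unfolding Ck_on.simps frechet_derivativeI[OF d]
      using Ck_on_bilinear[OF bounded_bilinear_mult open_UNIV Suc Ck_on_const]
      by (auto simp: differentiable_def)
  qed
  then show ?thesis
    unfolding smooth_on_def using Ck_on_subset by blast
qed

lemma flat_exp_continuous_on: "continuous_on S (flat_exp q)"
  by (simp add: flat_exp_smooth smooth_on_imp_continuous_on)

lemma flat_exp_1_mono: "s \<le> t \<Longrightarrow> flat_exp 1 s \<le> flat_exp 1 t"
  by (auto simp: flat_exp_def frac_le)

lemma flat_exp_1_strict: "s < t \<Longrightarrow> 0 < t \<Longrightarrow> flat_exp 1 s < flat_exp 1 t"
  by (auto simp: flat_exp_def divide_strict_left_mono)

lemma flat_exp_diff_1_nonneg: "flat_exp (flat_diff 1) s \<ge> 0"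
  by (auto simp: flat_exp_def flat_diff_def)

text \<open>For \<open>s > 0\<close> the second derivative of \<open>exp(-1/s)\<close> is
  \<open>s^(-4) (1 - 2 s) exp(-1/s)\<close>; this is the origin of the constant 1/2.\<close>

lemma flat_exp_diff2_1_nonneg: "s \<le> 1/2 \<Longrightarrow> flat_exp (flat_diff (flat_diff 1)) s \<ge> 0"
  by (auto simp: flat_exp_def flat_diff_def pderiv_mult pderiv_pCons field_simps)

text \<open>The function vanishes on the negative half line, which leaves the compact interval
  \<open>{0..d}\<close>. The argument \<open>\<delta> - D\<close> of the derivative of the cutoff
  ranges over such a half line, as \<open>D\<close> is nonnegative.\<close>

lemma flat_exp_bounded: "\<exists>K\<ge>0. \<forall>s\<le>d. \<bar>flat_exp q s\<bar> \<le> K"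
proof -
  have "compact (flat_exp q ` {0..d})"
    by (intro compact_continuous_image flat_exp_continuous_on) auto
  then obtain K where K: "\<And>s. s \<in> {0..d} \<Longrightarrow> \<bar>flat_exp q s\<bar> \<le> K"
    using compact_imp_bounded bounded_iff by (metis image_eqI real_norm_def)
  have "\<bar>flat_exp q s\<bar> \<le> max K 0" if "s \<le> d" for s
    using K[of s] that by (cases "s > 0") (auto simp: flat_exp_def)
  then show ?thesis
    by (intro exI[of _ "max K 0"]) auto
qed

section \<open>Ito integrals of bounded integrands\<close>

definition clamp_real :: "real \<Rightarrow> real \<Rightarrow> real" where
  "clamp_real c x = max (- c) (min c x)"

lemma clamp_real_measurable [measurable]: "clamp_real c \<in> borel_measurable borel"
  unfolding clamp_real_def by measurable

lemma clamp_real_abs: "c \<ge> 0 \<Longrightarrow> \<bar>clamp_real c x\<bar> \<le> c"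
  by (auto simp: clamp_real_def)

lemma clamp_real_lipschitz: "\<bar>clamp_real c x - clamp_real c y\<bar> \<le> \<bar>x - y\<bar>"
  unfolding clamp_real_def by linarith

text \<open>The error is nonzero only for \<open>\<bar>x\<bar> > c\<close>, where it is at most
  \<open>\<bar>x\<bar>\<close> and hence at most \<open>x^2 / c\<close>. In expectation, a second
  moment bound thus controls the clamping error uniformly.\<close>

lemma clamp_real_error: "c > 0 \<Longrightarrow> \<bar>x - clamp_real c x\<bar> \<le> x\<^sup>2 / c"
proof -
  assume c: "c > 0"
  have "\<bar>x - clamp_real c x\<bar> * c \<le> \<bar>x\<bar> * \<bar>x\<bar>" if "\<bar>x\<bar> > c"
    using c that by (intro mult_mono) (auto simp: clamp_real_def)
  then show ?thesis
    using c by (cases "\<bar>x\<bar> > c") (auto simp: field_simps power2_eq_square clamp_real_def)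
qed

context prob_space
begin

text \<open>
  Boundedness in \<open>L\<^sup>2\<close> gives uniform integrability; clamping makes this explicit.
\<close>

lemma expectation_zero_of_L2_bounded_limit:
  fixes J :: "nat \<Rightarrow> 'a \<Rightarrow> real" and I :: "'a \<Rightarrow> real"
  assumes J: "\<And>n. J n \<in> borel_measurable M" "\<And>n. integrable M (\<lambda>\<omega>. (J n \<omega>)\<^sup>2)"
    "\<And>n. expectation (J n) = 0" "\<And>n. expectation (\<lambda>\<omega>. (J n \<omega>)\<^sup>2) \<le> R"
    and I: "I \<in> borel_measurable M"
    and lim: "\<And>\<delta>. \<delta> > 0 \<Longrightarrow> (\<lambda>n. prob {\<omega>\<in>space M. \<bar>J n \<omega> - I \<omega>\<bar> > \<delta>}) \<longlonglongrightarrow> 0"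
  shows "integrable M I" and "expectation I = 0"
proof -
  note [measurable] = J(1) I
  have intJ: "integrable M (J n)" for n
    using square_integrable_imp_integrable[OF J(1,2)] .
  have R: "R \<ge> 0"
    using J(4)[of 0] by (rule order_trans[rotated]) simp
  have ic: "integrable M (\<lambda>\<omega>. clamp_real c (f \<omega>))" if "c \<ge> 0" "f \<in> borel_measurable M" for c f
    using that by (intro integrable_const_bound[of _ c]) (auto simp: clamp_real_abs)
  have close: "\<exists>n. expectation (\<lambda>\<omega>. \<bar>clamp_real c (J n \<omega>) - clamp_real c (I \<omega>)\<bar>) \<le> \<eta>"
    if c: "c > 0" and \<eta>: "\<eta> > 0" for c \<eta>
  proof -
    \<comment> \<open>The tolerance is split in halves. Off the exceptional event the clamped values
      differ by at most \<open>\<eta> / 2\<close>, since clamping is 1-Lipschitz; on it they differ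
      by at most \<open>2 * c\<close>, which contributes less than \<open>2 * c\<close> times
      \<open>\<eta> / (4 * c)\<close>.\<close>
    have "\<forall>\<^sub>F n in sequentially. prob {\<omega>\<in>space M. \<bar>J n \<omega> - I \<omega>\<bar> > \<eta> / 2} < \<eta> / (4 * c)"
      using lim[of "\<eta> / 2"] c \<eta> by (auto dest!: order_tendstoD(2)[of _ _ _ "\<eta> / (4 * c)"])
    then obtain n where n: "prob {\<omega>\<in>space M. \<bar>J n \<omega> - I \<omega>\<bar> > \<eta> / 2} < \<eta> / (4 * c)" (is "prob ?E < _")
      by (auto simp: eventually_sequentially)
    have "expectation (\<lambda>\<omega>. \<bar>clamp_real c (J n \<omega>) - clamp_real c (I \<omega>)\<bar>)
        \<le> expectation (\<lambda>\<omega>. \<eta> / 2 + 2 * c * indicator ?E \<omega>)"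
    proof (rule integral_mono)
      show "integrable M (\<lambda>\<omega>. \<bar>clamp_real c (J n \<omega>) - clamp_real c (I \<omega>)\<bar>)"
        using c by (intro integrable_abs Bochner_Integration.integrable_diff ic) auto
      show "integrable M (\<lambda>\<omega>. \<eta> / 2 + 2 * c * indicator ?E \<omega>)"
        by (intro Bochner_Integration.integrable_add integrable_mult_right integrable_const
            integrable_real_indicator) (auto simp: emeasure_eq_measure)
      show "\<bar>clamp_real c (J n \<omega>) - clamp_real c (I \<omega>)\<bar> \<le> \<eta> / 2 + 2 * c * indicator ?E \<omega>"
        if "\<omega> \<in> space M" for \<omega>
        using c \<eta> that clamp_real_lipschitz[of c "J n \<omega>" "I \<omega>"]
          clamp_real_abs[of c "J n \<omega>"] clamp_real_abs[of c "I \<omega>"]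
        by (cases "\<omega> \<in> ?E") auto
    qed
    also have "\<dots> = \<eta> / 2 + 2 * c * prob ?E"
      by (subst Bochner_Integration.integral_add)
        (auto simp: emeasure_eq_measure prob_space intro!: integrable_real_indicator)
    also have "\<dots> \<le> \<eta>"
      using n c by (simp add: field_simps)
    finally show ?thesis by blast
  qed
  \<comment> \<open>The bound must not depend on \<open>c\<close>, so that monotone convergence
    applies below; it comes from \<open>\<bar>x\<bar> \<le> 1 + x^2\<close> applied to
    \<open>J n\<close>.\<close>
  have bound_abs: "expectation (\<lambda>\<omega>. \<bar>clamp_real c (I \<omega>)\<bar>) \<le> 2 + R" if c: "c > 0" for c
  proof -
    obtain n where n: "expectation (\<lambda>\<omega>. \<bar>clamp_real c (J n \<omega>) - clamp_real c (I \<omega>)\<bar>) \<le> 1"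
      using close[OF c, of 1] by auto
    have "expectation (\<lambda>\<omega>. \<bar>clamp_real c (I \<omega>)\<bar>)
        \<le> expectation (\<lambda>\<omega>. \<bar>clamp_real c (J n \<omega>) - clamp_real c (I \<omega>)\<bar> + (1 + (J n \<omega>)\<^sup>2))"
    proof (rule integral_mono)
      show "integrable M (\<lambda>\<omega>. \<bar>clamp_real c (I \<omega>)\<bar>)"
        using c by (intro integrable_abs ic) auto
      show "integrable M (\<lambda>\<omega>. \<bar>clamp_real c (J n \<omega>) - clamp_real c (I \<omega>)\<bar> + (1 + (J n \<omega>)\<^sup>2))"
        using c J(2) by (intro Bochner_Integration.integrable_add integrable_abs
            Bochner_Integration.integrable_diff ic) auto
      show "\<bar>clamp_real c (I \<omega>)\<bar> \<le> \<bar>clamp_real c (J n \<omega>) - clamp_real c (I \<omega>)\<bar> + (1 + (J n \<omega>)\<^sup>2)" for \<omega>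
      proof -
        have "\<bar>clamp_real c (J n \<omega>)\<bar> \<le> \<bar>J n \<omega>\<bar>"
          using c by (auto simp: clamp_real_def)
        moreover have "\<bar>x\<bar> \<le> 1 + x\<^sup>2" for x :: real
          using zero_le_power2[of "\<bar>x\<bar> - 1"] zero_le_power2[of x] by (simp add: power2_eq_square algebra_simps)
        ultimately show ?thesis
          by (smt (verit))
      qed
    qed
    also have "\<dots> = expectation (\<lambda>\<omega>. \<bar>clamp_real c (J n \<omega>) - clamp_real c (I \<omega>)\<bar>)
        + (1 + expectation (\<lambda>\<omega>. (J n \<omega>)\<^sup>2))"
      using c J(2) by (subst Bochner_Integration.integral_add)
        (auto simp: prob_space intro!: Bochner_Integration.integrable_add integrable_abs
          Bochner_Integration.integrable_diff ic)
    finally show ?thesis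
      using n J(4)[of n] by linarith
  qed
  \<comment> \<open>As \<open>J n\<close> has expectation 0, the clamped limit has expectation 0 up
    to the clamping error of \<open>J n\<close>, at most \<open>R / c\<close>, and the distance of
    the clamped variables.\<close>
  have bound: "\<bar>expectation (\<lambda>\<omega>. clamp_real c (I \<omega>))\<bar> \<le> R / c" if c: "c > 0" for c
  proof (rule field_le_epsilon)
    fix \<eta> :: real assume "\<eta> > 0"
    then obtain n where n: "expectation (\<lambda>\<omega>. \<bar>clamp_real c (J n \<omega>) - clamp_real c (I \<omega>)\<bar>) \<le> \<eta>"
      using close[OF c, of \<eta>] by auto
    have "expectation (\<lambda>\<omega>. clamp_real c (I \<omega>)) =
        - (expectation (\<lambda>\<omega>. clamp_real c (J n \<omega>) - clamp_real c (I \<omega>)))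
        - expectation (\<lambda>\<omega>. J n \<omega> - clamp_real c (J n \<omega>))"
      using c J(3)[of n] intJ by (simp add: ic Bochner_Integration.integral_diff)
    moreover have "\<bar>expectation (\<lambda>\<omega>. clamp_real c (J n \<omega>) - clamp_real c (I \<omega>))\<bar> \<le> \<eta>"
      using n integral_abs_bound[of M "\<lambda>\<omega>. clamp_real c (J n \<omega>) - clamp_real c (I \<omega>)"] by linarith
    moreover have "\<bar>expectation (\<lambda>\<omega>. J n \<omega> - clamp_real c (J n \<omega>))\<bar> \<le> R / c"
    proof -
      have "\<bar>expectation (\<lambda>\<omega>. J n \<omega> - clamp_real c (J n \<omega>))\<bar>
          \<le> expectation (\<lambda>\<omega>. \<bar>J n \<omega> - clamp_real c (J n \<omega>)\<bar>)"
        by (rule integral_abs_bound)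
      also have "\<dots> \<le> expectation (\<lambda>\<omega>. (J n \<omega>)\<^sup>2 / c)"
        using c J(2) intJ clamp_real_error[OF c] by (intro integral_mono integrable_abs
            Bochner_Integration.integrable_diff ic integrable_divide) auto
      also have "\<dots> \<le> R / c"
        using c J(4)[of n] by (simp add: divide_right_mono)
      finally show ?thesis .
    qed
    ultimately show "\<bar>expectation (\<lambda>\<omega>. clamp_real c (I \<omega>))\<bar> \<le> R / c + \<eta>"
      by linarith
  qed
  have clamp_lim: "(\<lambda>n. clamp_real (real (Suc n)) x) \<longlonglongrightarrow> x" for x
  proof (rule tendsto_eventually, unfold eventually_sequentially, intro exI allI impI)
    fix n assume "n \<ge> nat \<lceil>\<bar>x\<bar>\<rceil>"
    then have "\<bar>x\<bar> \<le> real n"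
      by linarith
    then show "clamp_real (real (Suc n)) x = x"
      by (auto simp: clamp_real_def)
  qed
  show int: "integrable M I"
  proof -
    \<comment> \<open>Integrability has to come first: it follows by monotone convergence from the
      uniform bound \<open>2 + R\<close>, and only then can \<open>\<bar>I\<bar>\<close> serve as
      the dominating function for the expectations themselves.\<close>
    have "integrable M (\<lambda>\<omega>. \<bar>I \<omega>\<bar>)"
    proof (rule integrable_monotone_convergence)
      let ?f = "\<lambda>n \<omega>. \<bar>clamp_real (real (Suc n)) (I \<omega>)\<bar>"
      show "integrable M (?f n)" for n
        by (intro integrable_abs ic) auto
      have m: "mono (\<lambda>n. ?f n \<omega>)" for \<omega>
        by (auto simp: mono_def clamp_real_def)
      then show "AE \<omega> in M. mono (\<lambda>n. ?f n \<omega>)"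
        by simp
      show "AE \<omega> in M. (\<lambda>n. ?f n \<omega>) \<longlonglongrightarrow> \<bar>I \<omega>\<bar>"
        using clamp_lim tendsto_rabs by blast
      have inc: "incseq (\<lambda>n. expectation (?f n))"
        using m by (intro monoI integral_mono integrable_abs ic) (auto simp: mono_def)
      have "\<forall>n. expectation (?f n) \<le> 2 + R"
        using bound_abs by simp
      with inc obtain L where "(\<lambda>n. expectation (?f n)) \<longlonglongrightarrow> L"
        by (rule incseq_convergent)
      then show "(\<lambda>n. expectation (?f n)) \<longlonglongrightarrow> lim (\<lambda>n. expectation (?f n))"
        by (simp only: limI)
    qed measurable
    then show ?thesis
      using integrable_abs_cancel I by blast
  qed
  have "(\<lambda>n. expectation (\<lambda>\<omega>. clamp_real (real (Suc n)) (I \<omega>))) \<longlonglongrightarrow> expectation I"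
  proof (rule integral_dominated_convergence)
    show "AE \<omega> in M. (\<lambda>n. clamp_real (real (Suc n)) (I \<omega>)) \<longlonglongrightarrow> I \<omega>"
      using clamp_lim by simp
    show "AE \<omega> in M. norm (clamp_real (real (Suc n)) (I \<omega>)) \<le> \<bar>I \<omega>\<bar>" for n
      by (auto simp: clamp_real_def)
  qed (use int in auto)
  moreover have "(\<lambda>n. expectation (\<lambda>\<omega>. clamp_real (real (Suc n)) (I \<omega>))) \<longlonglongrightarrow> 0"
  proof (rule Lim_null_comparison)
    show "\<forall>\<^sub>F n in sequentially. norm (expectation (\<lambda>\<omega>. clamp_real (real (Suc n)) (I \<omega>))) \<le> R / real (Suc n)"
      using bound by (intro always_eventually) auto
    show "(\<lambda>n. R / real (Suc n)) \<longlonglongrightarrow> 0"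
      using LIMSEQ_Suc[OF lim_const_over_n[of R]] by simp
  qed
  ultimately show "expectation I = 0"
    using LIMSEQ_unique by blast
qed

end

text \<open>The conditional mean and variance of an increment given the past, expressed through
  weights \<open>Z\<close> that are known at time \<open>s\<close>. In this form they apply directly
  to the products that arise from squaring a sum of increments.\<close>

locale brownian_increments = prob_space Q for Q :: "'w measure" +
  fixes F :: "real \<Rightarrow> 'w measure" and B :: "real \<Rightarrow> 'w \<Rightarrow> real"
  assumes filtration: "filtration (space Q) F" and F_le: "\<And>t. sets (F t) \<subseteq> sets Q"
    and adapted: "\<And>t. 0 \<le> t \<Longrightarrow> B t \<in> borel_measurable (F t)"
    and increment: "\<And>s t Z. 0 \<le> s \<Longrightarrow> s \<le> t \<Longrightarrow> Z \<in> borel_measurable (F s) \<Longrightarrow> integrable Q Z \<Longrightarrow>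
        integrable Q (\<lambda>\<omega>. Z \<omega> * (B t \<omega> - B s \<omega>)) \<and> expectation (\<lambda>\<omega>. Z \<omega> * (B t \<omega> - B s \<omega>)) = 0"
    and increment_square: "\<And>s t Z. 0 \<le> s \<Longrightarrow> s \<le> t \<Longrightarrow> Z \<in> borel_measurable (F s) \<Longrightarrow> integrable Q Z \<Longrightarrow>
        integrable Q (\<lambda>\<omega>. Z \<omega> * (B t \<omega> - B s \<omega>)\<^sup>2)
        \<and> expectation (\<lambda>\<omega>. Z \<omega> * (B t \<omega> - B s \<omega>)\<^sup>2) = expectation Z * (t - s)"
begin

lemma space_F [simp]: "space (F t) = space Q"
  using filtration by (simp add: filtration_def)

lemma measurable_F_mono: "s \<le> t \<Longrightarrow> f \<in> borel_measurable (F s) \<Longrightarrow> f \<in> borel_measurable (F t)"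
  using filtration by (auto simp: filtration_def intro!: measurable_from_subalg[of "F t" "F s"] simp: subalgebra_def)

lemma measurable_F_Q: "f \<in> borel_measurable (F s) \<Longrightarrow> f \<in> borel_measurable Q"
  by (rule measurable_from_subalg[of Q "F s"]) (auto simp: subalgebra_def F_le)

text \<open>One half of the Ito isometry; it is an inequality because \<open>t\<close> may cut the
  sum short inside some interval. The partial sum \<open>Z j\<close> is measurable at time
  \<open>\<tau> j\<close>, so \<open>Z j * \<xi> j\<close> is an admissible weight and the cross
  term with the next increment has expectation 0. The square of that increment contributes at most
  its full share of the energy.\<close>

lemma simple_integral_moments:
  assumes "is_simple_proc F T (k, \<tau>, \<xi>)" "0 \<le> t"
    and R: "\<And>\<omega>. \<omega> \<in> space Q \<Longrightarrow> (\<Sum>i<k. (\<xi> i \<omega>)\<^sup>2 * (\<tau> (Suc i) - \<tau> i)) \<le> R"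
  defines "J \<equiv> simple_integral B (k, \<tau>, \<xi>) t"
  shows "J \<in> borel_measurable Q" "integrable Q (\<lambda>\<omega>. (J \<omega>)\<^sup>2)" "expectation J = 0"
    "expectation (\<lambda>\<omega>. (J \<omega>)\<^sup>2) \<le> R"
proof -
  define Z where "Z j \<omega> = (\<Sum>i<j. \<xi> i \<omega> * (B (min t (\<tau> (Suc i))) \<omega> - B (min t (\<tau> i)) \<omega>))" for j \<omega>
  have \<tau>0: "0 \<le> \<tau> i" if "i \<le> k" for i
    using that assms(1) by (induction i) (auto intro: order_trans)
  have \<xi>m: "\<xi> i \<in> borel_measurable (F (\<tau> i))" and \<tau>S: "\<tau> i \<le> \<tau> (Suc i)" if "i < k" for i
    using assms(1) that by auto
  have \<xi>b: "\<exists>K. \<forall>\<omega>\<in>space Q. \<bar>\<xi> i \<omega>\<bar> \<le> K" if "i < k" for i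
    using assms(1) that by auto
  have \<xi>2: "integrable Q (\<lambda>\<omega>. (\<xi> i \<omega>)\<^sup>2)" if i: "i < k" for i
  proof -
    obtain K where K: "\<And>\<omega>. \<omega> \<in> space Q \<Longrightarrow> \<bar>\<xi> i \<omega>\<bar> \<le> K"
      using \<xi>b[OF i] by auto
    show ?thesis
      using measurable_F_Q[OF \<xi>m[OF i]] K
      by (intro integrable_const_bound[of _ "K\<^sup>2"] AE_I2) (auto intro!: abs_le_square_iff[THEN iffD1] simp: order_trans[OF K])
  qed
  have "Z j \<in> borel_measurable (F (\<tau> j)) \<and> integrable Q (\<lambda>\<omega>. (Z j \<omega>)\<^sup>2) \<and> expectation (Z j) = 0
      \<and> expectation (\<lambda>\<omega>. (Z j \<omega>)\<^sup>2) \<le> (\<Sum>i<j. expectation (\<lambda>\<omega>. (\<xi> i \<omega>)\<^sup>2) * (\<tau> (Suc i) - \<tau> i))"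
    if "j \<le> k" for j
    using that
  proof (induction j)
    case 0
    show ?case by (simp add: Z_def)
  next
    case (Suc j)
    then have j: "j < k" and IH: "Z j \<in> borel_measurable (F (\<tau> j))" "integrable Q (\<lambda>\<omega>. (Z j \<omega>)\<^sup>2)"
      "expectation (Z j) = 0"
      "expectation (\<lambda>\<omega>. (Z j \<omega>)\<^sup>2) \<le> (\<Sum>i<j. expectation (\<lambda>\<omega>. (\<xi> i \<omega>)\<^sup>2) * (\<tau> (Suc i) - \<tau> i))"
      by auto
    have intZ: "integrable Q (Z j)"
      using square_integrable_imp_integrable[OF measurable_F_Q[OF IH(1)] IH(2)] .
    have E0: "expectation (\<lambda>\<omega>. (\<xi> j \<omega>)\<^sup>2) * (\<tau> (Suc j) - \<tau> j) \<ge> 0"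
      using \<tau>S[OF j] by (intro mult_nonneg_nonneg Bochner_Integration.integral_nonneg) auto
    show ?case
    proof (cases "\<tau> j \<le> t")
      case False
      then have "Z (Suc j) = Z j"
        using \<tau>S[OF j] by (auto simp: Z_def min_def)
      then show ?thesis
        using IH measurable_F_mono[OF \<tau>S[OF j]] E0 by auto
    next
      case True
      define t' where "t' = min t (\<tau> (Suc j))"
      define D where "D \<omega> = B t' \<omega> - B (\<tau> j) \<omega>" for \<omega>
      have t': "0 \<le> \<tau> j" "\<tau> j \<le> t'" "t' \<le> \<tau> (Suc j)"
        using True \<tau>S[OF j] \<tau>0[of j] j by (auto simp: t'_def)
      have ZS: "Z (Suc j) \<omega> = Z j \<omega> + \<xi> j \<omega> * D \<omega>" for \<omega>
        using True by (simp add: Z_def D_def t'_def min_def)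
      obtain K where K: "\<And>\<omega>. \<omega> \<in> space Q \<Longrightarrow> \<bar>\<xi> j \<omega>\<bar> \<le> K"
        using \<xi>b[OF j] by auto
      have int\<xi>: "integrable Q (\<xi> j)"
        using K measurable_F_Q[OF \<xi>m[OF j]] by (intro integrable_const_bound[of _ K] AE_I2) auto
      have intZ\<xi>: "integrable Q (\<lambda>\<omega>. Z j \<omega> * \<xi> j \<omega>)"
        by (rule Bochner_Integration.integrable_bound[of _ "\<lambda>\<omega>. K * Z j \<omega>"])
          (use intZ K measurable_F_Q[OF \<xi>m[OF j]] measurable_F_Q[OF IH(1)] in
            \<open>auto intro!: AE_I2 mult_right_mono simp: abs_mult mult.commute[of "\<bar>Z j _\<bar>"] order_trans[OF K]\<close>)
      have 1: "integrable Q (\<lambda>\<omega>. \<xi> j \<omega> * D \<omega>)" "expectation (\<lambda>\<omega>. \<xi> j \<omega> * D \<omega>) = 0"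
        using increment[OF t'(1,2) \<xi>m[OF j] int\<xi>] by (auto simp: D_def)
      have 2: "integrable Q (\<lambda>\<omega>. Z j \<omega> * \<xi> j \<omega> * D \<omega>)" "expectation (\<lambda>\<omega>. Z j \<omega> * \<xi> j \<omega> * D \<omega>) = 0"
        using increment[OF t'(1,2) borel_measurable_times[OF IH(1) \<xi>m[OF j]] intZ\<xi>] by (auto simp: D_def)
      have 3: "integrable Q (\<lambda>\<omega>. (\<xi> j \<omega>)\<^sup>2 * (D \<omega>)\<^sup>2)"
        "expectation (\<lambda>\<omega>. (\<xi> j \<omega>)\<^sup>2 * (D \<omega>)\<^sup>2) = expectation (\<lambda>\<omega>. (\<xi> j \<omega>)\<^sup>2) * (t' - \<tau> j)"
        using increment_square[OF t'(1,2) borel_measurable_power[OF \<xi>m[OF j]] \<xi>2[OF j]] by (auto simp: D_def)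
      have sq: "(Z (Suc j) \<omega>)\<^sup>2 = (Z j \<omega>)\<^sup>2 + (2 * (Z j \<omega> * \<xi> j \<omega> * D \<omega>) + (\<xi> j \<omega>)\<^sup>2 * (D \<omega>)\<^sup>2)" for \<omega>
        by (simp add: ZS power2_eq_square algebra_simps)
      have "Z (Suc j) \<in> borel_measurable (F (\<tau> (Suc j)))"
        unfolding ZS[abs_def] D_def
        using IH(1) \<xi>m[OF j] \<tau>S[OF j] t' adapted[of t'] adapted[of "\<tau> j"]
        by (intro borel_measurable_add borel_measurable_times borel_measurable_diff)
          (auto intro: measurable_F_mono)
      moreover have "integrable Q (\<lambda>\<omega>. (Z (Suc j) \<omega>)\<^sup>2)"
        unfolding sq using IH(2) 2(1) 3(1) by auto
      moreover have "expectation (Z (Suc j)) = 0"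
        unfolding ZS[abs_def] using intZ IH(3) 1 by simp
      moreover have "expectation (\<lambda>\<omega>. (Z (Suc j) \<omega>)\<^sup>2)
          = expectation (\<lambda>\<omega>. (Z j \<omega>)\<^sup>2) + expectation (\<lambda>\<omega>. (\<xi> j \<omega>)\<^sup>2) * (t' - \<tau> j)"
        unfolding sq using IH(2) 2 3 by simp
      moreover have "expectation (\<lambda>\<omega>. (\<xi> j \<omega>)\<^sup>2) * (t' - \<tau> j)
          \<le> expectation (\<lambda>\<omega>. (\<xi> j \<omega>)\<^sup>2) * (\<tau> (Suc j) - \<tau> j)"
        using t' by (intro mult_left_mono Bochner_Integration.integral_nonneg) auto
      ultimately show ?thesis
        using IH(4) by simp
    qed
  qed
  note * = this[OF order_refl]
  have J: "J = Z k"
    by (auto simp: J_def Z_def)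
  show "J \<in> borel_measurable Q" "integrable Q (\<lambda>\<omega>. (J \<omega>)\<^sup>2)" "expectation J = 0"
    using * measurable_F_Q by (auto simp: J)
  have "(\<Sum>i<k. expectation (\<lambda>\<omega>. (\<xi> i \<omega>)\<^sup>2) * (\<tau> (Suc i) - \<tau> i))
      = expectation (\<lambda>\<omega>. \<Sum>i<k. (\<xi> i \<omega>)\<^sup>2 * (\<tau> (Suc i) - \<tau> i))"
    using \<xi>2 by (subst Bochner_Integration.integral_sum) auto
  also have "\<dots> \<le> expectation (\<lambda>\<omega>. R)"
    using \<xi>2 R by (intro integral_mono Bochner_Integration.integrable_sum) auto
  finally show "expectation (\<lambda>\<omega>. (J \<omega>)\<^sup>2) \<le> R"
    using * by (simp add: J prob_space)
qed

end

text \<open>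
  Dropping the summands from the time on when the accumulated energy exceeds \<open>R\<close> keeps a simple process adapted.
  If its \<open>L\<^sup>2\<close>-limit is bounded, then for suitable \<open>R\<close> nothing is dropped, with probability tending to 1.
\<close>

definition truncate_energy :: "real \<Rightarrow> (nat \<Rightarrow> real) \<Rightarrow> (nat \<Rightarrow> 'w \<Rightarrow> real) \<Rightarrow> nat \<Rightarrow> 'w \<Rightarrow> real" where
  "truncate_energy R \<tau> \<xi> i \<omega> =
     (if (\<Sum>j\<le>i. (\<xi> j \<omega>)\<^sup>2 * (\<tau> (Suc j) - \<tau> j)) \<le> R then \<xi> i \<omega> else 0)"

text \<open>Either the full energy up to the last index stays within \<open>R\<close> and dominates
  the truncated one, or the last summand is dropped and the shorter sum remains.\<close>

lemma truncate_energy_le: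
  assumes "R \<ge> 0" "\<And>i. i < k \<Longrightarrow> \<tau> i \<le> \<tau> (Suc i)"
  shows "(\<Sum>i<k. (truncate_energy R \<tau> \<xi> i \<omega>)\<^sup>2 * (\<tau> (Suc i) - \<tau> i)) \<le> R"
  using assms(2)
proof (induction k)
  case 0
  then show ?case using assms(1) by simp
next
  case (Suc k)
  show ?case
  proof (cases "(\<Sum>j\<le>k. (\<xi> j \<omega>)\<^sup>2 * (\<tau> (Suc j) - \<tau> j)) \<le> R")
    case True
    have "(\<Sum>i<Suc k. (truncate_energy R \<tau> \<xi> i \<omega>)\<^sup>2 * (\<tau> (Suc i) - \<tau> i))
        \<le> (\<Sum>i<Suc k. (\<xi> i \<omega>)\<^sup>2 * (\<tau> (Suc i) - \<tau> i))"
      using Suc.prems by (intro sum_mono mult_right_mono) (auto simp: truncate_energy_def)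
    with True show ?thesis
      by (simp add: lessThan_Suc_atMost)
  next
    case False
    then show ?thesis
      using Suc by (simp add: truncate_energy_def)
  qed
qed

lemma truncate_energy_eq:
  assumes "\<And>i. i < k \<Longrightarrow> \<tau> i \<le> \<tau> (Suc i)" "(\<Sum>i<k. (\<xi> i \<omega>)\<^sup>2 * (\<tau> (Suc i) - \<tau> i)) \<le> R" "i < k"
  shows "truncate_energy R \<tau> \<xi> i \<omega> = \<xi> i \<omega>"
proof -
  have "(\<Sum>j\<le>i. (\<xi> j \<omega>)\<^sup>2 * (\<tau> (Suc j) - \<tau> j)) \<le> (\<Sum>i<k. (\<xi> i \<omega>)\<^sup>2 * (\<tau> (Suc i) - \<tau> i))"
    using assms(1,3) by (intro sum_mono2) auto
  then show ?thesis
    using assms(2) by (auto simp: truncate_energy_def)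
qed

text \<open>The half-open intervals are disjoint, so squaring the step function produces no cross
  terms.\<close>

lemma nn_integral_simple_val_square:
  assumes "is_simple_proc F T (k, \<tau>, \<xi>)"
  shows "(\<integral>\<^sup>+ s\<in>{0..T}. ennreal ((simple_val (k, \<tau>, \<xi>) s \<omega>)\<^sup>2) \<partial>lborel)
    = ennreal (\<Sum>i<k. (\<xi> i \<omega>)\<^sup>2 * (\<tau> (Suc i) - \<tau> i))"
proof -
  have mono: "\<tau> i \<le> \<tau> j" if "i \<le> j" "j \<le> k" for i j
    using that assms by (induction rule: dec_induct) (auto intro: order_trans)
  have sub: "{\<tau> i<..\<tau> (Suc i)} \<subseteq> {0..T}" if "i < k" for i
    using mono[of 0 i] mono[of "Suc i" k] that assms by auto
  have sq: "(\<Sum>i<j. \<xi> i \<omega> * indicator {\<tau> i<..\<tau> (Suc i)} s)\<^sup>2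
      = (\<Sum>i<j. (\<xi> i \<omega>)\<^sup>2 * indicator {\<tau> i<..\<tau> (Suc i)} s :: real)" if "j \<le> k" for j s
    using that
  proof (induction j)
    case (Suc j)
    have "(\<Sum>i<j. \<xi> i \<omega> * indicator {\<tau> i<..\<tau> (Suc i)} s) = 0" if "s \<in> {\<tau> j<..\<tau> (Suc j)}"
    proof (rule sum.neutral, rule ballI)
      fix i assume "i \<in> {..<j}"
      then have "\<tau> (Suc i) < s"
        using that mono[of "Suc i" j] Suc.prems by auto
      then show "\<xi> i \<omega> * indicator {\<tau> i<..\<tau> (Suc i)} s = 0"
        by simp
    qed
    then show ?case
      using Suc by (cases "s \<in> {\<tau> j<..\<tau> (Suc j)}") auto
  qed simp
  have "(\<integral>\<^sup>+ s\<in>{0..T}. ennreal ((simple_val (k, \<tau>, \<xi>) s \<omega>)\<^sup>2) \<partial>lborel)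
      = (\<integral>\<^sup>+ s. (\<Sum>i<k. ennreal ((\<xi> i \<omega>)\<^sup>2) * indicator {\<tau> i<..\<tau> (Suc i)} s) \<partial>lborel)"
  proof (intro nn_integral_cong)
    fix s
    have "ennreal ((simple_val (k, \<tau>, \<xi>) s \<omega>)\<^sup>2)
        = (\<Sum>i<k. ennreal ((\<xi> i \<omega>)\<^sup>2) * indicator {\<tau> i<..\<tau> (Suc i)} s)"
      unfolding simple_val.simps sq[OF order_refl]
      by (subst sum_ennreal[symmetric]) (auto intro!: sum.cong split: split_indicator)
    moreover have "(\<Sum>i<k. ennreal ((\<xi> i \<omega>)\<^sup>2) * indicator {\<tau> i<..\<tau> (Suc i)} s) = 0" if "s \<notin> {0..T}"
      using that sub by (intro sum.neutral) (fastforce simp: indicator_def)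
    ultimately show "ennreal ((simple_val (k, \<tau>, \<xi>) s \<omega>)\<^sup>2) * indicator {0..T} s
        = (\<Sum>i<k. ennreal ((\<xi> i \<omega>)\<^sup>2) * indicator {\<tau> i<..\<tau> (Suc i)} s)"
      by (cases "s \<in> {0..T}") auto
  qed
  also have "\<dots> = (\<Sum>i<k. ennreal ((\<xi> i \<omega>)\<^sup>2) * ennreal (\<tau> (Suc i) - \<tau> i))"
    using mono by (subst nn_integral_sum) (auto simp: nn_integral_cmult intro!: sum.cong)
  also have "\<dots> = ennreal (\<Sum>i<k. (\<xi> i \<omega>)\<^sup>2 * (\<tau> (Suc i) - \<tau> i))"
    using mono by (subst sum_ennreal[symmetric]) (auto simp: ennreal_mult' intro!: sum.cong)
  finally show ?thesis .
qed

text \<open>Progressive measurability at the final time is joint measurability on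
  \<open>{0..T}\<close>, and sections of jointly measurable functions are measurable; the indicator
  extends the section by 0 to the real line.\<close>

lemma progressive_section_measurable:
  assumes "progressive F T H" "0 \<le> T" "\<omega> \<in> space (F T)"
  shows "(\<lambda>s. indicator {0..T} s * H s \<omega>) \<in> borel_measurable borel"
proof -
  have "(\<lambda>s. H s \<omega>) \<in> borel_measurable (restrict_space borel {0..T})"
    using measurable_compose[OF measurable_Pair2'[OF assms(3)], of "\<lambda>(s, \<omega>). H s \<omega>"] assms(1,2)
    unfolding progressive_def by fastforce
  then show ?thesis
    by (subst (asm) borel_measurable_restrict_space_iff) auto
qed

text \<open>Integrate \<open>S^2 \<le> 2 (S - H)^2 + 2 H^2\<close> over \<open>{0..T}\<close>, where
  \<open>S\<close> is the simple process: an \<open>L2\<close> error of at most 1 contributes 2, the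
  bound on \<open>H\<close> contributes \<open>2 * K^2 * T\<close>.\<close>

lemma energy_le_of_L2_close:
  assumes S: "is_simple_proc F T (k, \<tau>, \<xi>)" and H: "progressive F T H" and "0 \<le> T" "\<omega> \<in> space (F T)"
    and K: "\<And>s. s \<in> {0<..T} \<Longrightarrow> \<bar>H s \<omega>\<bar> \<le> K"
    and close: "(\<integral>\<^sup>+ s\<in>{0..T}. ennreal ((simple_val (k, \<tau>, \<xi>) s \<omega> - H s \<omega>)\<^sup>2) \<partial>lborel) \<le> 1"
  shows "(\<Sum>i<k. (\<xi> i \<omega>)\<^sup>2 * (\<tau> (Suc i) - \<tau> i)) \<le> 2 + 2 * K\<^sup>2 * T"
proof -
  let ?S = "\<lambda>s. simple_val (k, \<tau>, \<xi>) s \<omega>"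
  define H' where "H' s = indicator {0..T} s * H s \<omega>" for s
  have [measurable]: "H' \<in> borel_measurable borel"
    using progressive_section_measurable[OF H assms(3,4)] by (simp add: H'_def[abs_def])
  have [measurable]: "?S \<in> borel_measurable borel"
    unfolding simple_val.simps by measurable
  have "ennreal (\<Sum>i<k. (\<xi> i \<omega>)\<^sup>2 * (\<tau> (Suc i) - \<tau> i)) = (\<integral>\<^sup>+ s\<in>{0..T}. ennreal ((?S s)\<^sup>2) \<partial>lborel)"
    by (rule nn_integral_simple_val_square[OF S, symmetric])
  also have "\<dots> \<le> (\<integral>\<^sup>+ s. 2 * (ennreal ((?S s - H' s)\<^sup>2) * indicator {0..T} s)
      + ennreal (2 * K\<^sup>2) * indicator {0..T} s \<partial>lborel)"
  proof (rule nn_integral_mono_AE)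
    \<comment> \<open>The bound on \<open>H\<close> leaves out time 0, as \<open>range_set\<close>
      does; a single point is a null set.\<close>
    have "ennreal ((?S s)\<^sup>2) * indicator {0..T} s \<le>
        2 * (ennreal ((?S s - H' s)\<^sup>2) * indicator {0..T} s) + ennreal (2 * K\<^sup>2) * indicator {0..T} s"
      if "s \<noteq> 0" for s
    proof (cases "s \<in> {0..T}")
      case True
      then have "(H' s)\<^sup>2 \<le> K\<^sup>2"
        using K[of s] that by (auto simp: H'_def abs_le_square_iff[symmetric])
      moreover have "(?S s)\<^sup>2 \<le> 2 * (?S s - H' s)\<^sup>2 + 2 * (H' s)\<^sup>2"
        using zero_le_power2[of "?S s - 2 * H' s"] by (simp add: power2_eq_square algebra_simps)
      ultimately have "(?S s)\<^sup>2 \<le> 2 * (?S s - H' s)\<^sup>2 + 2 * K\<^sup>2"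
        by linarith
      then have "ennreal ((?S s)\<^sup>2) \<le> ennreal (2 * (?S s - H' s)\<^sup>2 + 2 * K\<^sup>2)"
        by (rule ennreal_leI)
      also have "\<dots> = 2 * ennreal ((?S s - H' s)\<^sup>2) + ennreal (2 * K\<^sup>2)"
        by (simp add: ennreal_plus ennreal_mult')
      finally show ?thesis
        using True by simp
    qed simp
    note pointwise = this
    show "AE s in lborel. ennreal ((?S s)\<^sup>2) * indicator {0..T} s \<le>
        2 * (ennreal ((?S s - H' s)\<^sup>2) * indicator {0..T} s) + ennreal (2 * K\<^sup>2) * indicator {0..T} s"
      using AE_lborel_singleton[of 0] by eventually_elim (rule pointwise)
  qed
  also have "\<dots> = 2 * (\<integral>\<^sup>+ s\<in>{0..T}. ennreal ((?S s - H' s)\<^sup>2) \<partial>lborel) + ennreal (2 * K\<^sup>2) * ennreal T"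
    using \<open>0 \<le> T\<close> by (subst nn_integral_add) (auto simp: nn_integral_cmult simp del: simple_val.simps)
  also have "(\<integral>\<^sup>+ s\<in>{0..T}. ennreal ((?S s - H' s)\<^sup>2) \<partial>lborel)
      = (\<integral>\<^sup>+ s\<in>{0..T}. ennreal ((?S s - H s \<omega>)\<^sup>2) \<partial>lborel)"
    by (intro nn_integral_cong) (auto simp: H'_def split: split_indicator)
  also have "2 * \<dots> + ennreal (2 * K\<^sup>2) * ennreal T \<le> 2 * 1 + ennreal (2 * K\<^sup>2) * ennreal T"
    using close by (intro add_mono mult_left_mono) auto
  also have "\<dots> = ennreal (2 + 2 * K\<^sup>2 * T)"
    using \<open>0 \<le> T\<close> by (simp add: ennreal_plus ennreal_mult')
  finally show ?thesis
    using \<open>0 \<le> T\<close> by (subst (asm) ennreal_le_iff) auto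
qed

section \<open>Expectation of the Ito integral of a bounded integrand\<close>

context brownian_increments
begin

text \<open>The energy tested at index \<open>i\<close> includes the interval that ends at
  \<open>\<tau> (Suc i)\<close>. The times being deterministic, it involves only
  \<open>\<xi> j\<close> with \<open>j \<le> i\<close> and is known at time
  \<open>\<tau> i\<close>.\<close>

lemma simple_proc_truncate_energy:
  assumes "is_simple_proc F T (k, \<tau>, \<xi>)"
  shows "is_simple_proc F T (k, \<tau>, truncate_energy R \<tau> \<xi>)"
proof -
  have mono: "\<tau> i \<le> \<tau> j" if "i \<le> j" "j \<le> k" for i j
    using that assms by (induction rule: dec_induct) (auto intro: order_trans)
  have "truncate_energy R \<tau> \<xi> i \<in> borel_measurable (F (\<tau> i))" if i: "i < k" for i
  proof -
    have [measurable]: "\<xi> j \<in> borel_measurable (F (\<tau> i))" if "j \<le> i" for j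
      using measurable_F_mono[OF mono[of j i], of "\<xi> j"] assms that i by auto
    have [measurable]: "(\<lambda>\<omega>. \<Sum>j\<le>i. (\<xi> j \<omega>)\<^sup>2 * (\<tau> (Suc j) - \<tau> j)) \<in> borel_measurable (F (\<tau> i))"
      by (intro borel_measurable_sum borel_measurable_times borel_measurable_power) auto
    show ?thesis
      unfolding truncate_energy_def[abs_def] by measurable
  qed
  moreover have "\<exists>K. \<forall>\<omega>\<in>space (F (\<tau> i)). \<bar>truncate_energy R \<tau> \<xi> i \<omega>\<bar> \<le> K" if "i < k" for i
  proof -
    obtain K where "\<forall>\<omega>\<in>space (F (\<tau> i)). \<bar>\<xi> i \<omega>\<bar> \<le> K"
      using assms \<open>i < k\<close> by auto
    then show ?thesis
      by (intro exI[of _ "max K 0"]) (auto simp: truncate_energy_def le_max_iff_disj)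
  qed
  ultimately show ?thesis
    using assms by simp
qed

text \<open>With \<open>R = 2 + 2 * K^2 * T\<close> the truncation leaves a path untouched as soon
  as its \<open>L2\<close> error is at most 1. The truncated integrals therefore have the same limit
  in probability, now with expectation 0 and second moments bounded by \<open>R\<close>.\<close>

lemma ito_integral_bounded_expectation:
  assumes ito: "ito_integral Q F B T H I" and t: "t \<in> {0..T}"
    and K: "\<And>\<omega> s. \<omega> \<in> space Q \<Longrightarrow> s \<in> {0<..T} \<Longrightarrow> \<bar>H s \<omega>\<bar> \<le> K"
  shows "integrable Q (I t)" and "expectation (I t) = 0"
proof -
  have T: "0 \<le> T" using t by auto
  have H: "progressive F T H" and I: "I t \<in> borel_measurable Q"
    using ito t by (auto simp: ito_integral_def)
  define E where "E S \<omega> = (\<integral>\<^sup>+ s\<in>{0..T}. ennreal ((simple_val S s \<omega> - H s \<omega>)\<^sup>2) \<partial>lborel)" for S \<omega>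
  obtain S where S: "\<And>n. is_simple_proc F T (S n)"
    and E: "tends_to_0_in_prob Q (\<lambda>n. E (S n))"
    and J: "tends_to_0_in_prob Q (\<lambda>n \<omega>. ennreal \<bar>simple_integral B (S n) t \<omega> - I t \<omega>\<bar>)"
    using ito t unfolding ito_integral_def E_def[abs_def] by blast
  define k \<tau> \<xi> where "k n = fst (S n)" and "\<tau> n = fst (snd (S n))" and "\<xi> n = snd (snd (S n))" for n
  then have S_eq: "S n = (k n, \<tau> n, \<xi> n)" for n
    by simp
  define R where "R = 2 + 2 * K\<^sup>2 * T"
  have R: "R \<ge> 0"
    using T by (simp add: R_def)
  define S' where "S' n = (k n, \<tau> n, truncate_energy R (\<tau> n) (\<xi> n))" for n
  have S': "is_simple_proc F T (S' n)" for n
    using simple_proc_truncate_energy S[of n] by (simp only: S'_def S_eq)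
  have \<tau>: "\<tau> n i \<le> \<tau> n (Suc i)" if "i < k n" for n i
    using S[of n] that by (auto simp: S_eq)
  have "(\<Sum>i<k n. (truncate_energy R (\<tau> n) (\<xi> n) i \<omega>)\<^sup>2 * (\<tau> n (Suc i) - \<tau> n i)) \<le> R" for n \<omega>
    by (intro truncate_energy_le R \<tau>)
  note m = simple_integral_moments[OF S'[unfolded S'_def] _ this, folded S'_def, of t]
  have eq: "simple_integral B (S' n) t \<omega> = simple_integral B (S n) t \<omega>"
    if \<omega>: "\<omega> \<in> space Q" and "E (S n) \<omega> \<le> 1" for n \<omega>
  proof -
    have "(\<Sum>i<k n. (\<xi> n i \<omega>)\<^sup>2 * (\<tau> n (Suc i) - \<tau> n i)) \<le> R"
      unfolding R_def
      by (rule energy_le_of_L2_close[OF _ H T]) (use S[of n] that K in \<open>auto simp: S_eq E_def\<close>)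
    then have "truncate_energy R (\<tau> n) (\<xi> n) i \<omega> = \<xi> n i \<omega>" if "i < k n" for i
      using that by (intro truncate_energy_eq[where k = "k n"] \<tau>)
    then show ?thesis
      by (simp add: S'_def S_eq)
  qed
  have "(\<lambda>n. prob {\<omega>\<in>space Q. \<bar>simple_integral B (S' n) t \<omega> - I t \<omega>\<bar> > \<delta>}) \<longlonglongrightarrow> 0"
    if \<delta>: "\<delta> > 0" for \<delta>
  proof (rule Lim_null_comparison)
    \<comment> \<open>The truncated integral misses \<open>I t\<close> by more than
      \<open>\<delta>\<close> only if the original one does, or if the truncation acts, which
      requires an \<open>L2\<close> error above 1.\<close>
    let ?a = "\<lambda>n. {\<omega>\<in>space Q. ennreal \<bar>simple_integral B (S n) t \<omega> - I t \<omega>\<bar> > ennreal \<delta>}"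
    let ?b = "\<lambda>n. {\<omega>\<in>space Q. E (S n) \<omega> > ennreal 1}"
    have ab: "?a n \<in> sets Q" "?b n \<in> sets Q" for n
    proof -
      have [measurable]: "E (S n) \<in> borel_measurable Q"
        "(\<lambda>\<omega>. ennreal \<bar>simple_integral B (S n) t \<omega> - I t \<omega>\<bar>) \<in> borel_measurable Q"
        using E J unfolding tends_to_0_in_prob_def by blast+
      show "?a n \<in> sets Q" "?b n \<in> sets Q"
        by measurable
    qed
    have "prob {\<omega>\<in>space Q. \<bar>simple_integral B (S' n) t \<omega> - I t \<omega>\<bar> > \<delta>} \<le> prob (?a n \<union> ?b n)" for n
    proof (rule finite_measure_mono)
      show "{\<omega>\<in>space Q. \<bar>simple_integral B (S' n) t \<omega> - I t \<omega>\<bar> > \<delta>} \<subseteq> ?a n \<union> ?b n"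
        using eq \<delta> by (auto simp: ennreal_less_iff not_less)
    qed (use ab in auto)
    also have "prob (?a n \<union> ?b n) \<le> prob (?a n) + prob (?b n)" for n
      using ab by (rule measure_Un_le)
    finally show "\<forall>\<^sub>F n in sequentially.
        norm (prob {\<omega>\<in>space Q. \<bar>simple_integral B (S' n) t \<omega> - I t \<omega>\<bar> > \<delta>}) \<le> prob (?a n) + prob (?b n)"
      by (intro always_eventually) auto
    show "(\<lambda>n. prob (?a n) + prob (?b n)) \<longlonglongrightarrow> 0"
      using E J \<delta> unfolding tends_to_0_in_prob_def
      by (intro tendsto_add_zero) (auto simp del: ennreal_1)
  qed
  then show "integrable Q (I t)" "expectation (I t) = 0"
    using expectation_zero_of_L2_bounded_limit[of "\<lambda>n. simple_integral B (S' n) t", OF m(1,2,3,4) I] t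
    by auto
qed

end

text \<open>The increment of the whole vector is independent of \<open>F s\<close>, hence so is
  every Borel function of its coordinate \<open>l\<close>. Taking the identity and the square, the
  expectation of the product with \<open>Z\<close> factors into \<open>expectation Z\<close> and a
  moment of the normal distribution.\<close>

lemma wiener_brownian_increments:
  assumes FQ: "filtered_prob_space Q F" and W: "wiener_process Q F W"
  shows "brownian_increments Q F (\<lambda>t \<omega>. W t \<omega> $ l)"
proof -
  interpret prob_space Q using FQ by (simp add: filtered_prob_space_def)
  have sub: "sets (F t) \<subseteq> sets Q" and space_F: "space (F t) = space Q" for t
    using FQ by (auto simp: filtered_prob_space_def filtration_def)
  have FQm: "f \<in> borel_measurable Q" if "f \<in> borel_measurable (F s)" for s and f :: "'a \<Rightarrow> real"
    using that by (rule measurable_from_subalg[of Q "F s", rotated]) (auto simp: subalgebra_def sub space_F)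
  have vec: "(\<lambda>v :: real ^ 'b. v $ l) \<in> borel_measurable borel"
    by (intro borel_measurable_continuous_onI continuous_intros)
  let ?B = "\<lambda>t \<omega>. W t \<omega> $ l"
  have adapted: "?B t \<in> borel_measurable (F t)" if "0 \<le> t" for t
    using W that measurable_compose[OF _ vec] by (auto simp: wiener_process_def)
  have indep: "indep_var borel Z borel (\<lambda>\<omega>. f (?B t \<omega> - ?B s \<omega>))"
    if st: "0 \<le> s" "s < t" and Z: "Z \<in> borel_measurable (F s)" and f [measurable]: "f \<in> borel_measurable borel"
    for s t Z and f :: "real \<Rightarrow> real"
    unfolding indep_var_eq
  proof (intro conjI)
    show "random_variable borel Z" using FQm[OF Z] .
    show "random_variable borel (\<lambda>\<omega>. f (?B t \<omega> - ?B s \<omega>))"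
      using FQm[OF adapted[of t]] FQm[OF adapted[of s]] st
      by (intro measurable_compose[OF _ f] borel_measurable_diff) auto
    let ?V = "vimage_algebra (space Q) (\<lambda>\<omega>. W t \<omega> - W s \<omega>) borel"
    have ind: "indep_set (sets (F s)) (sets ?V)"
      using W st by (auto simp: wiener_process_def)
    have "sigma_sets (space Q) {Z -` A \<inter> space Q |A. A \<in> sets borel} \<subseteq> sets (F s)"
      unfolding space_F[of s, symmetric] by (rule sets.sigma_sets_subset) (use measurable_sets[OF Z] in auto)
    moreover have "sigma_sets (space Q) {(\<lambda>\<omega>. f (?B t \<omega> - ?B s \<omega>)) -` A \<inter> space Q |A. A \<in> sets borel} \<subseteq> sets ?V"
    proof -
      have "{(\<lambda>\<omega>. f (?B t \<omega> - ?B s \<omega>)) -` A \<inter> space Q |A. A \<in> sets borel} \<subseteq> sets ?V"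
      proof safe
        fix A :: "real set" assume "A \<in> sets borel"
        then have "(\<lambda>v. f (v $ l)) -` A \<in> sets borel"
          using measurable_sets[OF measurable_compose[OF vec f], of A] by simp
        then have "(\<lambda>\<omega>. W t \<omega> - W s \<omega>) -` ((\<lambda>v. f (v $ l)) -` A) \<inter> space Q \<in> sets ?V"
          by (rule in_vimage_algebra)
        then show "(\<lambda>\<omega>. f (?B t \<omega> - ?B s \<omega>)) -` A \<inter> space Q \<in> sets ?V"
          by (simp add: vimage_def)
      qed
      then show ?thesis
        using sets.sigma_sets_subset[of _ ?V] by simp
    qed
    ultimately show "indep_set (sigma_sets (space Q) {Z -` A \<inter> space Q |A. A \<in> sets borel})
        (sigma_sets (space Q) {(\<lambda>\<omega>. f (?B t \<omega> - ?B s \<omega>)) -` A \<inter> space Q |A. A \<in> sets borel})"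
      using ind unfolding indep_sets2_eq by blast
  qed
  have normal: "integrable Q (\<lambda>\<omega>. ?B t \<omega> - ?B s \<omega>)" "expectation (\<lambda>\<omega>. ?B t \<omega> - ?B s \<omega>) = 0"
    "integrable Q (\<lambda>\<omega>. (?B t \<omega> - ?B s \<omega>)\<^sup>2)" "expectation (\<lambda>\<omega>. (?B t \<omega> - ?B s \<omega>)\<^sup>2) = t - s"
    if st: "0 \<le> s" "s < t" for s t
  proof -
    have D: "distributed Q lborel (\<lambda>\<omega>. ?B t \<omega> - ?B s \<omega>) (normal_density 0 (sqrt (t - s)))"
      using W st by (auto simp: wiener_process_def)
    have pos: "0 < sqrt (t - s)" using st by simp
    show "integrable Q (\<lambda>\<omega>. ?B t \<omega> - ?B s \<omega>)"
      using distributed_integrable[OF D, of "\<lambda>x. x"] integrable_normal_moment_nz_1[OF pos, of 0] by simp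
    show 0: "expectation (\<lambda>\<omega>. ?B t \<omega> - ?B s \<omega>) = 0"
      using normal_distributed_expectation[OF pos D] .
    show "integrable Q (\<lambda>\<omega>. (?B t \<omega> - ?B s \<omega>)\<^sup>2)"
      using distributed_integrable[OF D, of "\<lambda>x. x\<^sup>2"] integrable_normal_moment[OF pos, of 0 2] by simp
    show "expectation (\<lambda>\<omega>. (?B t \<omega> - ?B s \<omega>)\<^sup>2) = t - s"
      using normal_distributed_variance[OF pos D] st by (simp add: 0)
  qed
  show ?thesis
  proof (rule brownian_increments.intro[OF prob_space_axioms brownian_increments_axioms.intro])
    show "filtration (space Q) F" using FQ by (simp add: filtered_prob_space_def)
    show "sets (F t) \<subseteq> sets Q" for t by (rule sub)
    show "?B t \<in> borel_measurable (F t)" if "0 \<le> t" for t using adapted that .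
    fix s t :: real and Z :: "'a \<Rightarrow> real"
    assume st: "0 \<le> s" "s \<le> t" and Z: "Z \<in> borel_measurable (F s)" "integrable Q Z"
    show "integrable Q (\<lambda>\<omega>. Z \<omega> * (?B t \<omega> - ?B s \<omega>)) \<and> expectation (\<lambda>\<omega>. Z \<omega> * (?B t \<omega> - ?B s \<omega>)) = 0"
    \<comment> \<open>\<open>wiener_process\<close> speaks about \<open>s < t\<close> only, where
      the normal density is not degenerate; for equal times the increment is 0.\<close>
    proof (cases "s = t")
      case False
      then have st': "s < t" using st by simp
      show ?thesis
        using indep[OF st(1) st' Z(1), of "\<lambda>x. x"] normal[OF st(1) st'] Z(2)
        by (auto simp: indep_var_integrable indep_var_lebesgue_integral)
    qed simp
    show "integrable Q (\<lambda>\<omega>. Z \<omega> * (?B t \<omega> - ?B s \<omega>)\<^sup>2)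
        \<and> expectation (\<lambda>\<omega>. Z \<omega> * (?B t \<omega> - ?B s \<omega>)\<^sup>2) = expectation Z * (t - s)"
    proof (cases "s = t")
      case False
      then have st': "s < t" using st by simp
      show ?thesis
        using indep[OF st(1) st' Z(1), of "\<lambda>x. x\<^sup>2"] normal[OF st(1) st'] Z(2)
        by (auto simp: indep_var_integrable indep_var_lebesgue_integral)
    qed simp
  qed
qed

section \<open>Operators on manifolds\<close>

text \<open>Both functions have the same derivatives at \<open>x\<close>, if any, so the choice
  behind \<open>frechet_derivative\<close> agrees even where none exists. This lets the locality of
  operators be stated for arbitrary functions.\<close>

lemma frechet_derivative_cong_open:
  assumes "open S" "x \<in> S" "\<And>y. y \<in> S \<Longrightarrow> f y = g y"
  shows "frechet_derivative f (at x) = frechet_derivative g (at x)"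
proof -
  have "(f has_derivative f') (at x) \<longleftrightarrow> (g has_derivative f') (at x)" for f'
    using assms by (metis has_derivative_transform_within_open)
  then show ?thesis
    by (simp add: frechet_derivative_def)
qed

lemma frechet_derivative_real_comp:
  fixes \<eta> :: "real \<Rightarrow> real" and \<phi> :: "'a::euclidean_space \<Rightarrow> real"
  assumes "(\<eta> has_real_derivative d) (at (\<phi> z))" "\<phi> differentiable (at z)"
  shows "frechet_derivative (\<eta> \<circ> \<phi>) (at z) v = d * frechet_derivative \<phi> (at z) v"
proof -
  have "(\<eta> has_derivative (*) d) (at (\<phi> z))"
    using assms(1) by (simp add: has_field_derivative_def)
  moreover have "(\<phi> has_derivative frechet_derivative \<phi> (at z)) (at z)"
    using assms(2) by (simp add: frechet_derivative_works[symmetric])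
  ultimately show ?thesis
    using frechet_derivativeI[OF diff_chain_at] by (metis comp_apply)
qed

lemma is_chart_inverse: "is_chart c \<Longrightarrow> x \<in> fst c \<Longrightarrow> chart_inv c (snd c x) = x"
  unfolding is_chart_def by (meson homeomorphism_apply1)

lemma is_chart_open_image:
  assumes "is_chart c" "open Z"
  shows "open (snd c ` (fst c \<inter> Z))"
proof -
  have "openin (top_of_set (fst c)) (fst c \<inter> Z)"
    using assms(2) by (simp add: openin_open_Int)
  then have "openin (top_of_set (snd c ` fst c)) (snd c ` (fst c \<inter> Z))"
    using assms(1) homeomorphism_imp_open_map unfolding is_chart_def by blast
  then show ?thesis
    using assms(1) openin_open_trans unfolding is_chart_def by blast
qed

lemma is_chart_open_preimage:
  assumes "is_chart c" "open V"
  shows "open (fst c \<inter> snd c -` V)"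
  using assms by (intro continuous_open_preimage) (auto simp: is_chart_def homeomorphism_def)

locale smooth_atlas =
  fixes A :: "('m::{t2_space,second_countable_topology}, 'a::euclidean_space) chart set"
  assumes atlas: "smooth_manifold A"
begin

lemma is_chart: "c \<in> A \<Longrightarrow> is_chart c"
  using atlas by (simp add: smooth_manifold_def)

lemma chart_inverse [simp]: "c \<in> A \<Longrightarrow> x \<in> fst c \<Longrightarrow> chart_inv c (snd c x) = x"
  by (simp add: is_chart is_chart_inverse)

lemma chart_at: obtains c where "c \<in> A" "x \<in> fst c"
  using atlas unfolding smooth_manifold_def by blast

lemma smooth_transition:
  "c \<in> A \<Longrightarrow> c' \<in> A \<Longrightarrow> smooth_on (snd c ` (fst c \<inter> fst c')) (snd c' \<circ> chart_inv c)"
  using atlas by (simp add: smooth_manifold_def)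

lemma smooth_nearE:
  assumes "smooth_near A x f" "c \<in> A" "x \<in> fst c"
  obtains V where "open V" "snd c x \<in> V" "V \<subseteq> snd c ` fst c" "smooth_on V (f \<circ> chart_inv c)"
proof -
  obtain Z where "open Z" "x \<in> Z" "smooth_fun_on A Z f"
    using assms(1) by (auto simp: smooth_near_def)
  then show ?thesis
    using that[of "snd c ` (fst c \<inter> Z)"] is_chart_open_image[OF is_chart] assms(2,3)
    by (auto simp: smooth_fun_on_def)
qed

text \<open>The transition maps carry smoothness from one chart to all others. Together with
  \<open>smooth_nearE\<close> this reduces local questions about smooth functions to a single
  chart.\<close>

lemma smooth_near_chartI:
  assumes c: "c \<in> A" "x \<in> fst c" and V: "open V" "snd c x \<in> V" "smooth_on V (f \<circ> chart_inv c)"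
  shows "smooth_near A x f"
proof -
  let ?Z = "fst c \<inter> snd c -` V"
  have Z: "open ?Z"
    using is_chart_open_preimage[OF is_chart] c V by blast
  have "smooth_fun_on A ?Z f"
    unfolding smooth_fun_on_def
  proof
    fix c' assume c': "c' \<in> A"
    let ?S = "snd c' ` (fst c' \<inter> ?Z)"
    have S: "open ?S"
      using is_chart_open_image[OF is_chart[OF c'] Z] .
    have "smooth_on ?S ((f \<circ> chart_inv c) \<circ> (snd c \<circ> chart_inv c'))"
    proof (rule smooth_on_compose[OF S _ _ V(3)])
      show "smooth_on ?S (snd c \<circ> chart_inv c')"
        by (rule smooth_on_subset[OF smooth_transition[OF c' c(1)]]) auto
    qed (use c' in auto)
    then show "smooth_on ?S (f \<circ> chart_inv c')"
      by (rule smooth_on_cong[OF S, rotated]) (use c c' in auto)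
  qed
  then show ?thesis
    using Z c V unfolding smooth_near_def by blast
qed

lemma smooth_near_cong:
  assumes "smooth_near A x f" "open Z" "x \<in> Z" "\<And>y. y \<in> Z \<Longrightarrow> f y = f' y"
  shows "smooth_near A x f'"
proof -
  obtain c where c: "c \<in> A" "x \<in> fst c" by (rule chart_at)
  obtain V where V: "open V" "snd c x \<in> V" "V \<subseteq> snd c ` fst c" "smooth_on V (f \<circ> chart_inv c)"
    using smooth_nearE[OF assms(1) c] .
  let ?V = "V \<inter> snd c ` (fst c \<inter> Z)"
  have o: "open ?V"
    using V(1) is_chart_open_image[OF is_chart[OF c(1)] assms(2)] by blast
  show ?thesis
  proof (rule smooth_near_chartI[OF c o])
    show "smooth_on ?V (f' \<circ> chart_inv c)"
      by (rule smooth_on_cong[OF o _ smooth_on_subset[OF V(4)]]) (use assms c in auto)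
  qed (use V c assms in auto)
qed

lemma smooth_near_const: "smooth_near A x (\<lambda>_. k)"
  unfolding smooth_near_def smooth_fun_on_def
  using smooth_on_const[of _ k] by (intro exI[of _ UNIV]) (auto simp: o_def)

lemma smooth_near_comp_real:
  assumes "smooth_near A x f" "smooth_on UNIV (\<eta> :: real \<Rightarrow> real)"
  shows "smooth_near A x (\<eta> \<circ> f)"
proof -
  obtain c where c: "c \<in> A" "x \<in> fst c" by (rule chart_at)
  obtain V where V: "open V" "snd c x \<in> V" "V \<subseteq> snd c ` fst c" "smooth_on V (f \<circ> chart_inv c)"
    using smooth_nearE[OF assms(1) c] .
  have "smooth_on V (\<eta> \<circ> (f \<circ> chart_inv c))"
    by (rule smooth_on_compose[OF V(1) _ V(4) assms(2)]) simp
  then show ?thesis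
    using smooth_near_chartI[OF c V(1,2)] by (simp add: o_assoc)
qed

lemma smooth_near_open:
  assumes "smooth_near A x f"
  obtains Z where "open Z" "x \<in> Z" "\<And>y. y \<in> Z \<Longrightarrow> smooth_near A y f"
  using assms unfolding smooth_near_def by blast

lemma smooth_near_imp_smooth_fun_on:
  assumes "\<And>x. smooth_near A x f"
  shows "smooth_fun_on A UNIV f"
  unfolding smooth_fun_on_def
proof
  fix c assume c: "c \<in> A"
  show "smooth_on (snd c ` (fst c \<inter> UNIV)) (f \<circ> chart_inv c)"
  proof (rule smooth_on_local)
    fix y assume "y \<in> snd c ` (fst c \<inter> UNIV)"
    then obtain x where "x \<in> fst c" "y = snd c x" by auto
    then show "\<exists>U. open U \<and> y \<in> U \<and> smooth_on U (f \<circ> chart_inv c)"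
      using smooth_nearE[OF assms c] by metis
  qed
qed

lemma smooth_near_isCont:
  assumes "smooth_near A x f"
  shows "isCont f x"
proof -
  obtain c where c: "c \<in> A" "x \<in> fst c" by (rule chart_at)
  obtain V where V: "open V" "snd c x \<in> V" "V \<subseteq> snd c ` fst c" "smooth_on V (f \<circ> chart_inv c)"
    using smooth_nearE[OF assms c] .
  let ?Z = "fst c \<inter> snd c -` V"
  have Z: "open ?Z"
    using is_chart_open_preimage[OF is_chart] c V by blast
  have "continuous_on ?Z (snd c)"
    using is_chart[OF c(1)] by (auto simp: is_chart_def homeomorphism_def intro: continuous_on_subset)
  then have "continuous_on ?Z ((f \<circ> chart_inv c) \<circ> snd c)"
    by (rule continuous_on_compose)
      (rule continuous_on_subset[OF smooth_on_imp_continuous_on[OF V(4)]], auto)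
  then have "continuous_on ?Z f"
    by (rule continuous_on_eq) (use c in auto)
  then show ?thesis
    using Z c V by (simp add: continuous_on_eq_continuous_at)
qed

lemma smooth_near_map:
  assumes C: "smooth_atlas C" and h: "smooth_map A C h" and f: "smooth_near C (h x) f"
  shows "smooth_near A x (f \<circ> h)"
proof -
  interpret C: smooth_atlas C by (rule C)
  obtain c where c: "c \<in> A" "x \<in> fst c" by (rule chart_at)
  obtain e where e: "e \<in> C" "h x \<in> fst e" by (rule C.chart_at)
  obtain V where V: "open V" "snd e (h x) \<in> V" "V \<subseteq> snd e ` fst e" "smooth_on V (f \<circ> chart_inv e)"
    using C.smooth_nearE[OF f e] .
  let ?Z = "h -` (fst e \<inter> snd e -` V)"
  have Z: "open ?Z"
    using h is_chart_open_preimage[OF C.is_chart[OF e(1)] V(1)]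
    by (auto simp: smooth_map_def continuous_on_open_vimage[OF open_UNIV])
  let ?S = "snd c ` (fst c \<inter> ?Z)"
  have S: "open ?S"
    using is_chart_open_image[OF is_chart[OF c(1)] Z] .
  have "smooth_on ?S ((f \<circ> chart_inv e) \<circ> (snd e \<circ> h \<circ> chart_inv c))"
  proof (rule smooth_on_compose[OF S _ _ V(4)])
    have "smooth_on (snd c ` (fst c \<inter> h -` fst e)) (snd e \<circ> h \<circ> chart_inv c)"
      using h c e by (simp add: smooth_map_def)
    then show "smooth_on ?S (snd e \<circ> h \<circ> chart_inv c)"
      by (rule smooth_on_subset) auto
  qed (use c in auto)
  then have "smooth_on ?S ((f \<circ> h) \<circ> chart_inv c)"
    by (rule smooth_on_cong[OF S, rotated]) (use c e in auto)
  then show ?thesis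
    using smooth_near_chartI[OF c S] c e V by auto
qed

lemma partial_cong:
  assumes c: "c \<in> A" "x \<in> fst c" and Z: "open Z" "x \<in> Z" "\<And>y. y \<in> Z \<Longrightarrow> f y = f' y"
  shows "partial1 c i f x = partial1 c i f' x" "partial2 c i j f x = partial2 c i j f' x"
proof -
  let ?V = "snd c ` (fst c \<inter> Z)"
  have V: "open ?V" "snd c x \<in> ?V"
    using is_chart_open_image[OF is_chart[OF c(1)] Z(1)] c Z by auto
  have *: "frechet_derivative (f \<circ> chart_inv c) (at z) = frechet_derivative (f' \<circ> chart_inv c) (at z)"
    if "z \<in> ?V" for z
    by (rule frechet_derivative_cong_open[OF V(1) that]) (use c Z in auto)
  then show "partial1 c i f x = partial1 c i f' x"
    using V by (simp add: partial1_def)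
  show "partial2 c i j f x = partial2 c i j f' x"
    unfolding partial2_def
    by (rule fun_cong[OF frechet_derivative_cong_open[OF V]]) (simp add: *)
qed

text \<open>Partial derivatives depend on germs, and so does the choice between the two branches of
  \<open>local_op\<close>. It is this locality that allows the truncated function to be replaced
  near a point by a composition with \<open>D\<close> or by a constant.\<close>

lemma local_op_cong:
  assumes "c \<in> A" "x \<in> fst c" "open Z" "x \<in> Z" "\<And>y. y \<in> Z \<Longrightarrow> f y = f' y"
  shows "local_op A c x a b f = local_op A c x a b f'"
proof -
  have "smooth_near A x f \<longleftrightarrow> smooth_near A x f'"
    using smooth_near_cong assms(3-5) by metis
  then show ?thesis
    using partial_cong[OF assms] by (simp add: local_op_def)
qed

lemma diffusion_space_cong:
  assumes "L \<in> diffusion_space A x" "open Z" "x \<in> Z" "\<And>y. y \<in> Z \<Longrightarrow> f y = f' y"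
  shows "L f = L f'"
  using assms(1) local_op_cong[where f = f and f' = f', OF _ _ assms(2-4)] unfolding diffusion_space_def by blast

lemma tangent_space_cong:
  assumes "Y \<in> tangent_space A x" "open Z" "x \<in> Z" "\<And>y. y \<in> Z \<Longrightarrow> f y = f' y"
  shows "Y f = Y f'"
  using assms(1) local_op_cong[where f = f and f' = f', OF _ _ assms(2-4)] unfolding tangent_space_def by blast

lemma local_op_const: "local_op A c x a b (\<lambda>_. k) = 0"
  by (simp add: local_op_def partial1_def partial2_def o_def frechet_derivativeI[OF has_derivative_const])

lemma tangent_space_const: "Y \<in> tangent_space A x \<Longrightarrow> Y (\<lambda>_. k) = 0"
  by (auto simp: tangent_space_def local_op_const)

lemma diffusion_space_const: "L \<in> diffusion_space A x \<Longrightarrow> L (\<lambda>_. k) = 0"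
  by (auto simp: diffusion_space_def local_op_const)

section \<open>Second order chain rule for operators\<close>

lemma partial_comp_real:
  assumes c: "c \<in> A" "x \<in> fst c" and f: "smooth_near A x f"
    and \<eta>: "\<And>y. (\<eta> has_real_derivative \<eta>' y) (at y)" "\<And>y. (\<eta>' has_real_derivative \<eta>'' y) (at y)"
  shows "partial1 c i (\<eta> \<circ> f) x = \<eta>' (f x) * partial1 c i f x"
    "partial2 c i j (\<eta> \<circ> f) x = \<eta>' (f x) * partial2 c i j f x
      + \<eta>'' (f x) * (partial1 c i f x * partial1 c j f x)"
proof -
  define \<phi> where "\<phi> = f \<circ> chart_inv c"
  obtain V where V: "open V" "snd c x \<in> V" "V \<subseteq> snd c ` fst c" "smooth_on V \<phi>"
    using smooth_nearE[OF f c] unfolding \<phi>_def .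
  have \<phi>x: "\<phi> (snd c x) = f x"
    using c by (simp add: \<phi>_def)
  have D: "frechet_derivative (\<eta> \<circ> \<phi>) (at z) v = \<eta>' (\<phi> z) * frechet_derivative \<phi> (at z) v"
    if "z \<in> V" for z v
    using frechet_derivative_real_comp[OF \<eta>(1)] smooth_on_differentiable[OF V(4) that] by blast
  have comp: "\<eta> \<circ> f \<circ> chart_inv c = \<eta> \<circ> \<phi>"
    by (auto simp: \<phi>_def)
  show "partial1 c i (\<eta> \<circ> f) x = \<eta>' (f x) * partial1 c i f x"
    using D[OF V(2)] by (simp add: partial1_def comp \<phi>x flip: \<phi>_def)
  let ?\<psi> = "\<lambda>z. frechet_derivative \<phi> (at z) j"
  \<comment> \<open>The first derivative is rewritten on a whole neighbourhood, which is what
    permits differentiating it once more by the product rule.\<close>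
  have "frechet_derivative (\<lambda>z. frechet_derivative (\<eta> \<circ> \<phi>) (at z) j) (at (snd c x))
      = frechet_derivative (\<lambda>z. (\<eta>' \<circ> \<phi>) z * ?\<psi> z) (at (snd c x))"
    by (rule frechet_derivative_cong_open[OF V(1,2)]) (simp add: D)
  also have "\<dots> = (\<lambda>v. (\<eta>' \<circ> \<phi>) (snd c x) * frechet_derivative ?\<psi> (at (snd c x)) v
      + frechet_derivative (\<eta>' \<circ> \<phi>) (at (snd c x)) v * ?\<psi> (snd c x))"
  proof (rule frechet_derivativeI, rule has_derivative_mult)
    have "\<phi> differentiable (at (snd c x))"
      using smooth_on_differentiable[OF V(4) V(2)] .
    then have "(\<eta>' \<circ> \<phi>) differentiable (at (snd c x))"
      using \<eta>(2) by (intro differentiable_chain_at) (auto simp: real_differentiable_def[symmetric] intro: differentiableI[OF has_field_derivative_imp_has_derivative])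
    then show "(\<eta>' \<circ> \<phi> has_derivative frechet_derivative (\<eta>' \<circ> \<phi>) (at (snd c x))) (at (snd c x))"
      by (simp add: frechet_derivative_works[symmetric])
    show "(?\<psi> has_derivative frechet_derivative ?\<psi> (at (snd c x))) (at (snd c x))"
      using smooth_on_differentiable[OF smooth_on_frechet_derivative[OF V(4)] V(2)]
      by (simp add: frechet_derivative_works[symmetric])
  qed
  finally have "frechet_derivative (\<lambda>z. frechet_derivative (\<eta> \<circ> \<phi>) (at z) j) (at (snd c x)) i
      = \<eta>' (f x) * frechet_derivative ?\<psi> (at (snd c x)) i
        + \<eta>'' (f x) * frechet_derivative \<phi> (at (snd c x)) i * ?\<psi> (snd c x)"
    using frechet_derivative_real_comp[OF \<eta>(2), of \<phi> "snd c x" i] smooth_on_differentiable[OF V(4) V(2)]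
    by (simp add: \<phi>x)
  then show "partial2 c i j (\<eta> \<circ> f) x = \<eta>' (f x) * partial2 c i j f x
      + \<eta>'' (f x) * (partial1 c i f x * partial1 c j f x)"
    by (simp add: partial1_def partial2_def comp flip: \<phi>_def)
qed

lemma tangent_space_comp_real:
  assumes "Y \<in> tangent_space A x" "smooth_near A x f" "smooth_on UNIV \<eta>"
    and \<eta>: "\<And>y. (\<eta> has_real_derivative \<eta>' y) (at y)" "\<And>y. (\<eta>' has_real_derivative \<eta>'' y) (at y)"
  shows "Y (\<eta> \<circ> f) = \<eta>' (f x) * Y f"
  using assms(1) partial_comp_real(1)[OF _ _ assms(2) \<eta>] assms(2) smooth_near_comp_real[OF assms(2,3)]
  by (auto simp: tangent_space_def local_op_def sum_distrib_left algebra_simps)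

text \<open>Contracting the extra term
  \<open>\<eta>'' \<partial>\<^sub>i f \<partial>\<^sub>j f\<close> of the second partial
  derivatives with \<open>b\<close> gives the symmetric part at \<open>(f, f)\<close>. The chart and
  the coefficients are those supplied by \<open>has_symmetric_part\<close>, so the same
  \<open>b\<close> occurs in \<open>L\<close> and in \<open>\<beta>\<close>.\<close>

lemma diffusion_comp_real:
  assumes "has_symmetric_part A x L \<beta>" "smooth_near A x f" "smooth_on UNIV \<eta>"
    and \<eta>: "\<And>y. (\<eta> has_real_derivative \<eta>' y) (at y)" "\<And>y. (\<eta>' has_real_derivative \<eta>'' y) (at y)"
  shows "L (\<eta> \<circ> f) = \<eta>' (f x) * L f + \<eta>'' (f x) * \<beta> f f"
proof -
  obtain c a b where c: "c \<in> A" "x \<in> fst c" and L: "L = local_op A c x a b"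
    and \<beta>: "\<beta> f f = (\<Sum>i\<in>Basis. \<Sum>j\<in>Basis. b i j * (partial1 c i f x * partial1 c j f x))"
    using assms(1,2) unfolding has_symmetric_part_def by blast
  have sn: "smooth_near A x (\<eta> \<circ> f)"
    using smooth_near_comp_real[OF assms(2,3)] .
  show ?thesis
    using assms(2) sn unfolding L \<beta> local_op_def
    by (simp add: partial_comp_real[OF c assms(2) \<eta>] sum_distrib_left sum.distrib algebra_simps)
qed

text \<open>Ito's formula at the level of the generator: the symmetric part of a diffusion generator
  is the tensor square of the vector, so the factor of \<open>\<eta>''\<close> is half a sum of
  squares and its sign is known.\<close>

lemma drift_op_comp_real:
  assumes G: "diffusion_generator A G" and V: "V x u \<in> tangent_space A x"
    and \<sigma>: "\<And>l. \<sigma> l x u \<in> tangent_space A x" and f: "smooth_near A x f" "smooth_on UNIV \<eta>"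
    and \<eta>: "\<And>y. (\<eta> has_real_derivative \<eta>' y) (at y)" "\<And>y. (\<eta>' has_real_derivative \<eta>'' y) (at y)"
  shows "drift_op G V \<sigma> x u (\<eta> \<circ> f) = \<eta>' (f x) * drift_op G V \<sigma> x u f
    + \<eta>'' (f x) / 2 * (\<Sum>l\<in>UNIV. (\<sigma> l x u f)\<^sup>2)"
proof -
  have "G x (\<sigma> l x u) (\<eta> \<circ> f) = \<eta>' (f x) * G x (\<sigma> l x u) f + \<eta>'' (f x) * (\<sigma> l x u f)\<^sup>2" for l
    using diffusion_comp_real[OF _ f \<eta>, of "G x (\<sigma> l x u)" "tensor_square (\<sigma> l x u)"] G \<sigma>[of l]
    by (auto simp: diffusion_generator_def tensor_square_def power2_eq_square)
  then show ?thesis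
    using tangent_space_comp_real[OF V f \<eta>]
    by (simp add: drift_op_def sum.distrib sum_distrib_left[symmetric] field_simps)
qed

lemma drift_op_cong:
  assumes G: "diffusion_generator A G" and V: "V x u \<in> tangent_space A x"
    and \<sigma>: "\<And>l. \<sigma> l x u \<in> tangent_space A x"
    and Z: "open Z" "x \<in> Z" "\<And>y. y \<in> Z \<Longrightarrow> f y = f' y"
  shows "drift_op G V \<sigma> x u f = drift_op G V \<sigma> x u f'"
proof -
  have "G x (\<sigma> l x u) f = G x (\<sigma> l x u) f'" for l
    using G \<sigma>[of l] by (intro diffusion_space_cong[OF _ Z]) (auto simp: diffusion_generator_def)
  moreover have "V x u f = V x u f'"
    by (rule tangent_space_cong[OF V Z])
  ultimately show ?thesis
    by (simp add: drift_op_def)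
qed

lemma drift_op_const:
  assumes G: "diffusion_generator A G" and V: "V x u \<in> tangent_space A x"
    and \<sigma>: "\<And>l. \<sigma> l x u \<in> tangent_space A x"
  shows "drift_op G V \<sigma> x u (\<lambda>_. k) = 0"
proof -
  have "G x (\<sigma> l x u) (\<lambda>_. k) = 0" for l
    using G \<sigma>[of l] by (intro diffusion_space_const) (auto simp: diffusion_generator_def)
  then show ?thesis
    using tangent_space_const[OF V] by (simp add: drift_op_def)
qed

end

text \<open>The Stratonovich terms cancel: what \<open>nabla_strat\<close> subtracts,
  \<open>strat_generator_along\<close> adds, since both differentiate \<open>f \<circ> h\<close>
  twice along the field. The condition imposed on the constraint drift is thereby a condition on the
  drift of the squared distance along the solution.\<close>

lemma constraint_drift_eq_drift_op: "constraint_drift G V \<sigma> h x u f = drift_op G V \<sigma> x u (f \<circ> h)"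
  by (simp add: constraint_drift_def drift_op_def pushforward_def nabla_strat_def strat_generator_def
      strat_generator_along_def sum_subtractf algebra_simps)

section \<open>Length and distance\<close>

text \<open>The fundamental theorem for the gauge integral tolerates finitely many exceptional
  points and supplies measurability of \<open>D\<close>. If the right-hand side is finite,
  \<open>D\<close> is then Lebesgue integrable and the norm inequality for integrals applies; if it
  is infinite, the claim is trivial.\<close>

lemma norm_le_nn_integral_derivative:
  fixes f :: "real \<Rightarrow> 'a::euclidean_space"
  assumes "a \<le> b" "continuous_on {a..b} f" "finite K"
    and D: "\<And>s. s \<in> {a<..<b} - K \<Longrightarrow> (f has_vector_derivative D s) (at s)"
  shows "ennreal (norm (f b - f a)) \<le> (\<integral>\<^sup>+ s\<in>{a..b}. ennreal (norm (D s)) \<partial>lborel)"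
proof (cases "(\<integral>\<^sup>+ s\<in>{a..b}. ennreal (norm (D s)) \<partial>lborel) = \<infinity>")
  case False
  have hi: "(D has_integral f b - f a) {a..b}"
    using fundamental_theorem_of_calculus_interior_strong[OF assms(3,1) D assms(2)] by blast
  \<comment> \<open>The gauge integral yields measurability of \<open>D\<close> only for the
    completed measure, while \<open>curve_length\<close> integrates with respect to
    \<open>lborel\<close>; completion leaves nonnegative integrals unchanged.\<close>
  have eq: "(\<integral>\<^sup>+ s. ennreal (norm (indicator {a..b} s *\<^sub>R D s)) \<partial>lebesgue)
      = (\<integral>\<^sup>+ s\<in>{a..b}. ennreal (norm (D s)) \<partial>lborel)"
    by (auto simp: nn_integral_completion intro!: nn_integral_cong split: split_indicator)
  have int: "integrable lebesgue (\<lambda>s. indicator {a..b} s *\<^sub>R D s)"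
  proof (rule integrableI_bounded[OF has_integral_implies_lebesgue_measurable[OF hi]])
    show "(\<integral>\<^sup>+ s. ennreal (norm (indicator {a..b} s *\<^sub>R D s)) \<partial>lebesgue) < \<infinity>"
      using False unfolding eq by (simp add: less_top)
  qed
  then have "D absolutely_integrable_on {a..b}"
    by (simp add: set_integrable_def)
  then have "(LINT s|lebesgue. indicator {a..b} s *\<^sub>R D s) = f b - f a"
    using set_lebesgue_integral_eq_integral(2) integral_unique[OF hi]
    unfolding set_lebesgue_integral_def by metis
  then show ?thesis
    using integral_norm_bound_ennreal[OF int] by (simp only: eq)
qed simp

text \<open>
  The next three facts hold for arbitrary integrands; hence no measurability of the speed of a curve
  has to be established.
\<close>

lemma nn_integral_leI:
  assumes "\<And>u. u \<in> borel_measurable M \<Longrightarrow> u \<le> f \<Longrightarrow> integral\<^sup>N M u \<le> B"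
  shows "integral\<^sup>N M f \<le> B"
  unfolding nn_integral_def[of M f]
proof (rule SUP_least)
  fix u assume "u \<in> {u. simple_function M u \<and> u \<le> f}"
  then show "integral\<^sup>S M u \<le> B"
    using assms[of u] by (auto simp: borel_measurable_simple_function simp flip: nn_integral_eq_simple_integral)
qed

lemma nn_integral_split_le:
  assumes "S \<in> sets M"
  shows "integral\<^sup>N M f \<le> (\<integral>\<^sup>+ x. f x * indicator S x \<partial>M) + (\<integral>\<^sup>+ x. f x * indicator (- S) x \<partial>M)"
proof (rule nn_integral_leI)
  fix u assume [measurable]: "u \<in> borel_measurable M" and u: "u \<le> f"
  have "integral\<^sup>N M u = (\<integral>\<^sup>+ x. u x * indicator S x + u x * indicator (space M - S) x \<partial>M)"
    by (intro nn_integral_cong) (auto split: split_indicator)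
  also have "\<dots> = (\<integral>\<^sup>+ x. u x * indicator S x \<partial>M) + (\<integral>\<^sup>+ x. u x * indicator (space M - S) x \<partial>M)"
    using assms by (intro nn_integral_add) auto
  also have "\<dots> \<le> (\<integral>\<^sup>+ x. f x * indicator S x \<partial>M) + (\<integral>\<^sup>+ x. f x * indicator (- S) x \<partial>M)"
    using u by (intro add_mono nn_integral_mono) (auto simp: le_fun_def split: split_indicator)
  finally show "integral\<^sup>N M u \<le> \<dots>" .
qed

lemma nn_integral_affine_le:
  fixes f :: "real \<Rightarrow> ennreal"
  assumes "c > 0"
  shows "(\<integral>\<^sup>+ x. ennreal c * f (c * x + t) \<partial>lborel) \<le> integral\<^sup>N lborel f"
proof (rule nn_integral_leI)
  fix u :: "real \<Rightarrow> ennreal"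
  assume u [measurable]: "u \<in> borel_measurable lborel" and le: "u \<le> (\<lambda>x. ennreal c * f (c * x + t))"
  \<comment> \<open>A measurable minorant \<open>u\<close> of the rescaled integrand is transported
    back to a minorant \<open>v\<close> of \<open>f\<close>; the change of variables is then carried
    out for the measurable \<open>v\<close>.\<close>
  define v where "v y = u ((y - t) / c) / ennreal c" for y
  have "v y \<le> f y" for y
  proof -
    have "u ((y - t) / c) \<le> ennreal c * f y"
      using le_funD[OF le, of "(y - t) / c"] assms by simp
    then have "v y \<le> ennreal c * f y / ennreal c"
      unfolding v_def by (rule divide_right_mono_ennreal)
    also have "\<dots> = f y"
      using assms by (simp add: ennreal_mult_divide_eq mult.commute[of "ennreal c"])
    finally show ?thesis .
  qed
  then have "integral\<^sup>N lborel v \<le> integral\<^sup>N lborel f"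
    by (intro nn_integral_mono)
  moreover have "integral\<^sup>N lborel v = ennreal c * (\<integral>\<^sup>+ x. v (t + c * x) \<partial>lborel)"
    using assms by (subst nn_integral_real_affine[of v c t]) (auto simp: v_def[abs_def])
  moreover have "\<dots> = (\<integral>\<^sup>+ x. ennreal c * v (t + c * x) \<partial>lborel)"
    by (subst nn_integral_cmult) (auto simp: v_def[abs_def])
  moreover have "ennreal c * v (t + c * x) = u x" for x
    using assms by (simp add: v_def ennreal_times_divide ennreal_mult_divide_eq mult.commute[of "ennreal c"])
  ultimately show "integral\<^sup>N lborel u \<le> integral\<^sup>N lborel f"
    by simp
qed

lemma C1_differentiable_on_local:
  assumes "\<And>x. x \<in> S \<Longrightarrow> \<exists>U. open U \<and> x \<in> U \<and> f C1_differentiable_on (S \<inter> U)"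
  shows "f C1_differentiable_on S"
  unfolding C1_differentiable_on_eq
proof (intro conjI ballI)
  fix x assume x: "x \<in> S"
  then obtain U where "open U" "x \<in> U" "f C1_differentiable_on (S \<inter> U)"
    using assms by blast
  then show "f differentiable at x"
    using x by (auto simp: C1_differentiable_on_eq)
next
  show "continuous_on S (\<lambda>x. vector_derivative f (at x))"
    unfolding continuous_on_eq_continuous_within
  proof
    fix x assume x: "x \<in> S"
    then obtain U where U: "open U" "x \<in> U" "f C1_differentiable_on (S \<inter> U)"
      using assms by blast
    then have "continuous (at x within S \<inter> U) (\<lambda>x. vector_derivative f (at x))"
      using x by (auto simp: C1_differentiable_on_eq continuous_on_eq_continuous_within)
    moreover have "at x within S \<inter> U = at x within S"
      using U by (intro at_within_nhd[of x U]) auto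
    ultimately show "continuous (at x within S) (\<lambda>x. vector_derivative f (at x))"
      by simp
  qed
qed

text \<open>Meant for the two halves of a joined curve. Derivatives at points of \<open>T\<close>
  are two-sided, hence the open \<open>U\<close> around \<open>T\<close> on which \<open>f'\<close>
  coincides with the rescaled \<open>f\<close>.\<close>

lemma C1_differentiable_on_affine:
  assumes f: "f C1_differentiable_on S" and "open U" "T \<subseteq> U" "\<And>s. s \<in> T \<Longrightarrow> a * s + b \<in> S"
    and eq: "\<And>s. s \<in> U \<Longrightarrow> f' s = f (a * s + b)"
  shows "f' C1_differentiable_on T"
proof -
  obtain D where D: "\<And>x. x \<in> S \<Longrightarrow> (f has_vector_derivative D x) (at x)" "continuous_on S D"
    using f by (auto simp: C1_differentiable_on_def)
  have "(f' has_vector_derivative a *\<^sub>R D (a * s + b)) (at s)" if s: "s \<in> T" for s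
  proof (rule has_vector_derivative_transform_within_open[of _ _ _ U])
    have "((\<lambda>s. a * s + b) has_vector_derivative a) (at s)"
      by (auto intro!: derivative_eq_intros simp: has_real_derivative_iff_has_vector_derivative[symmetric])
    then have "(f \<circ> (\<lambda>s. a * s + b) has_vector_derivative a *\<^sub>R D (a * s + b)) (at s)"
      using D(1)[OF assms(4)[OF s]] by (rule vector_diff_chain_at)
    then show "((\<lambda>s. f (a * s + b)) has_vector_derivative a *\<^sub>R D (a * s + b)) (at s)"
      by (simp add: o_def)
  qed (use assms s in auto)
  moreover have "continuous_on T (\<lambda>s. a *\<^sub>R D (a * s + b))"
    by (intro continuous_intros continuous_on_compose2[OF D(2)]) (use assms in auto)
  ultimately show ?thesis
    unfolding C1_differentiable_on_def by (intro exI[of _ "\<lambda>s. a *\<^sub>R D (a * s + b)"]) auto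
qed

section \<open>Tangent vectors and the metric in coordinates\<close>

definition chart_vec ::
    "('m::topological_space, 'a::euclidean_space) chart set \<Rightarrow> ('m, 'a) chart \<Rightarrow> 'm \<Rightarrow> 'a \<Rightarrow> 'm diffop"
  where "chart_vec A c z v = local_op A c z (\<lambda>i. v \<bullet> i) (\<lambda>_ _. 0)"

lemma chart_vec_tangent: "c \<in> A \<Longrightarrow> z \<in> fst c \<Longrightarrow> chart_vec A c z v \<in> tangent_space A z"
  unfolding chart_vec_def tangent_space_def by blast

lemma chart_vec_Basis: "i \<in> Basis \<Longrightarrow> chart_vec A c z i = coord_vector A c i z"
  unfolding chart_vec_def coord_vector_def local_op_def
  by (auto simp: inner_Basis if_distrib cong: if_cong intro!: ext sum.cong)

lemma chart_vec_add_scaleR: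
  "chart_vec A c z (v + k *\<^sub>R w) = (\<lambda>f. chart_vec A c z v f + k * chart_vec A c z w f)"
  unfolding chart_vec_def local_op_def
  by (auto simp: inner_left_distrib sum.distrib sum_distrib_left algebra_simps intro!: ext)

context smooth_atlas
begin

text \<open>Coordinates are test functions that read off the coefficients of a tangent vector; this
  makes \<open>chart_vec\<close> injective, without which the metric would not be definite in
  coordinates.\<close>

lemma coordinate_functional:
  assumes c: "c \<in> A" "z \<in> fst c"
  shows "smooth_near A z (\<lambda>y. snd c y \<bullet> i)" "partial1 c j (\<lambda>y. snd c y \<bullet> i) z = j \<bullet> i"
proof -
  let ?U = "snd c ` fst c"
  have U: "open ?U" "snd c z \<in> ?U"
    using is_chart[OF c(1)] c by (auto simp: is_chart_def)
  have inv: "snd c (chart_inv c y) = y" if "y \<in> ?U" for y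
    using that c(1) by auto
  have "smooth_on ?U (\<lambda>y. y \<bullet> i)"
    by (intro smooth_on_bounded_linear bounded_linear_inner_left)
  then have "smooth_on ?U ((\<lambda>y. snd c y \<bullet> i) \<circ> chart_inv c)"
    by (rule smooth_on_cong[OF U(1), rotated]) (simp only: inv o_apply)
  then show "smooth_near A z (\<lambda>y. snd c y \<bullet> i)"
    by (rule smooth_near_chartI[OF c U])
  have "frechet_derivative ((\<lambda>y. snd c y \<bullet> i) \<circ> chart_inv c) (at (snd c z))
      = frechet_derivative (\<lambda>y. y \<bullet> i) (at (snd c z))"
    by (rule frechet_derivative_cong_open[OF U]) (simp only: inv o_apply)
  also have "\<dots> = (\<lambda>y. y \<bullet> i)"
    by (intro frechet_derivativeI bounded_linear_imp_has_derivative bounded_linear_inner_left)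
  finally show "partial1 c j (\<lambda>y. snd c y \<bullet> i) z = j \<bullet> i"
    by (simp add: partial1_def)
qed

lemma chart_vec_eq_0D:
  assumes c: "c \<in> A" "z \<in> fst c" and "chart_vec A c z v = (\<lambda>_. 0)"
  shows "v = 0"
proof (rule euclidean_eqI)
  fix i :: 'a assume "i \<in> Basis"
  then have "(\<Sum>j\<in>Basis. (v \<bullet> j) * (j \<bullet> i)) = v \<bullet> i"
    by (simp add: inner_Basis if_distrib cong: if_cong)
  then have "chart_vec A c z v (\<lambda>y. snd c y \<bullet> i) = v \<bullet> i"
    using coordinate_functional[OF c] by (simp add: chart_vec_def local_op_def)
  then show "v \<bullet> i = 0 \<bullet> i"
    using assms(3) by simp
qed

text \<open>The chain rule in the chart. Continuity keeps the curve in the chart domain near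
  \<open>s\<close>, where \<open>f \<circ> \<gamma>\<close> agrees with its coordinate
  expression.\<close>

lemma velocity_eq_chart_vec:
  assumes c: "c \<in> A" "\<gamma> s \<in> fst c" and \<gamma>: "isCont \<gamma> s"
    and D: "(snd c \<circ> \<gamma> has_vector_derivative v) (at s)"
  shows "velocity A \<gamma> s = chart_vec A c (\<gamma> s) v"
proof
  fix f
  show "velocity A \<gamma> s f = chart_vec A c (\<gamma> s) v f"
  proof (cases "smooth_near A (\<gamma> s) f")
    case True
    obtain V where V: "open V" "snd c (\<gamma> s) \<in> V" "smooth_on V (f \<circ> chart_inv c)"
      using smooth_nearE[OF True c] .
    let ?D = "frechet_derivative (f \<circ> chart_inv c) (at (snd c (\<gamma> s)))"
    have d: "f \<circ> chart_inv c differentiable (at (snd c (\<gamma> s)))"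
      using smooth_on_differentiable[OF V(3,2)] .
    then have "((f \<circ> chart_inv c) \<circ> (snd c \<circ> \<gamma>) has_derivative ?D \<circ> (\<lambda>t. t *\<^sub>R v)) (at s)"
      using D by (intro diff_chain_at) (auto simp: has_vector_derivative_def frechet_derivative_works[symmetric])
    moreover have lin: "linear ?D"
      using d by (rule linear_frechet_derivative)
    moreover have "?D \<circ> (\<lambda>t. t *\<^sub>R v) = (*) (?D v)"
      by (auto simp: linear_cmul[OF lin])
    ultimately have "((f \<circ> chart_inv c) \<circ> (snd c \<circ> \<gamma>) has_real_derivative ?D v) (at s)"
      by (simp only: has_field_derivative_def)
    moreover have "\<forall>\<^sub>F t in nhds s. ((f \<circ> chart_inv c) \<circ> (snd c \<circ> \<gamma>)) t = (f \<circ> \<gamma>) t"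
    proof -
      have "\<forall>\<^sub>F t in nhds s. \<gamma> t \<in> fst c"
        using \<gamma> c is_chart[OF c(1)]
        by (intro topological_tendstoD[of \<gamma> "\<gamma> s"])
          (auto simp: isCont_def is_chart_def tendsto_at_iff_tendsto_nhds)
      then show ?thesis
        by eventually_elim (use c in auto)
    qed
    ultimately have "(f \<circ> \<gamma> has_real_derivative ?D v) (at s)"
      using DERIV_cong_ev[OF refl _ refl] by blast
    then have "velocity A \<gamma> s f = ?D v"
      using True by (simp add: velocity_def DERIV_imp_deriv)
    also have "\<dots> = ?D (\<Sum>i\<in>Basis. (v \<bullet> i) *\<^sub>R i)"
      by (simp add: euclidean_representation)
    also have "\<dots> = (\<Sum>i\<in>Basis. (v \<bullet> i) * ?D i)"
      using lin by (simp add: linear_sum linear_cmul del: euclidean_representation)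
    finally show ?thesis
      using True by (simp add: chart_vec_def local_op_def partial1_def)
  qed (simp add: velocity_def chart_vec_def local_op_def)
qed

end

locale riemannian_atlas = smooth_atlas C
  for C :: "('p::{t2_space,second_countable_topology}, 'c::euclidean_space) chart set" +
  fixes g :: "'p \<Rightarrow> 'p diffop \<Rightarrow> 'p diffop \<Rightarrow> real"
  assumes metric: "riemannian_metric C g"
begin

definition chart_form :: "('p, 'c) chart \<Rightarrow> 'p \<Rightarrow> 'c \<Rightarrow> 'c \<Rightarrow> real" where
  "chart_form c z v w = g z (chart_vec C c z v) (chart_vec C c z w)"

lemma chart_form_sym: "c \<in> C \<Longrightarrow> z \<in> fst c \<Longrightarrow> chart_form c z v w = chart_form c z w v"
  using metric chart_vec_tangent unfolding riemannian_metric_def chart_form_def by blast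

lemma chart_form_add_scaleR:
  "c \<in> C \<Longrightarrow> z \<in> fst c \<Longrightarrow>
    chart_form c z (v + k *\<^sub>R v') w = chart_form c z v w + k * chart_form c z v' w"
  using metric chart_vec_tangent[of c C z] unfolding riemannian_metric_def chart_form_def chart_vec_add_scaleR
  by blast

lemma chart_form_linear:
  assumes "c \<in> C" "z \<in> fst c"
  shows "linear (\<lambda>v. chart_form c z v w)"
proof (rule linearI)
  note add = chart_form_add_scaleR[OF assms]
  have 0: "chart_form c z 0 w = 0"
    using add[of 0 1 0 w] by simp
  show "chart_form c z (v + v') w = chart_form c z v w + chart_form c z v' w" for v v'
    using add[of v 1 v' w] by simp
  show "chart_form c z (k *\<^sub>R v) w = k *\<^sub>R chart_form c z v w" for k v
    using add[of 0 k v w] 0 by simp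
qed

lemma chart_form_scaleR:
  assumes "c \<in> C" "z \<in> fst c"
  shows "chart_form c z (k *\<^sub>R v) (k *\<^sub>R v) = k\<^sup>2 * chart_form c z v v"
proof -
  have "chart_form c z (k *\<^sub>R v) w = k * chart_form c z v w" for v w
    using linear_cmul[OF chart_form_linear[OF assms]] by simp
  then show ?thesis
    using chart_form_sym[OF assms] by (metis power2_eq_square mult.assoc)
qed

lemma chart_form_pos:
  assumes "c \<in> C" "z \<in> fst c" "v \<noteq> 0"
  shows "chart_form c z v v > 0"
  using metric chart_vec_tangent[OF assms(1,2)] chart_vec_eq_0D[OF assms(1,2)] assms(3)
  unfolding riemannian_metric_def chart_form_def by blast

text \<open>\<open>riemannian_metric\<close> provides smoothness for the components on coordinate
  vectors; the expansion turns it into joint continuity in base point and vector.\<close>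

lemma chart_form_expand:
  assumes "c \<in> C" "z \<in> fst c"
  shows "chart_form c z v w = (\<Sum>i\<in>Basis. \<Sum>j\<in>Basis. (v \<bullet> i) * (w \<bullet> j) *
    g z (coord_vector C c i z) (coord_vector C c j z))"
proof -
  have 1: "chart_form c z v w = (\<Sum>i\<in>Basis. (v \<bullet> i) * chart_form c z i w)" for v w
  proof -
    have "chart_form c z (\<Sum>i\<in>Basis. (v \<bullet> i) *\<^sub>R i) w = (\<Sum>i\<in>Basis. (v \<bullet> i) * chart_form c z i w)"
      by (simp add: linear_sum[OF chart_form_linear[OF assms]] linear_cmul[OF chart_form_linear[OF assms]]
          del: euclidean_representation)
    then show ?thesis
      unfolding euclidean_representation .
  qed
  have "chart_form c z v w = (\<Sum>i\<in>Basis. (v \<bullet> i) * (\<Sum>j\<in>Basis. (w \<bullet> j) * chart_form c z j i))"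
    by (subst 1, rule sum.cong[OF refl], subst chart_form_sym[OF assms], subst 1, simp)
  also have "\<dots> = (\<Sum>i\<in>Basis. \<Sum>j\<in>Basis. (v \<bullet> i) * (w \<bullet> j) * chart_form c z i j)"
    using chart_form_sym[OF assms] by (simp add: sum_distrib_left mult.assoc)
  finally show ?thesis
    by (simp add: chart_form_def chart_vec_Basis)
qed

lemma continuous_on_chart_form:
  assumes c: "c \<in> C"
  shows "continuous_on (snd c ` fst c \<times> UNIV) (\<lambda>(y, v). chart_form c (chart_inv c y) v v)"
proof -
  have "continuous_on (snd c ` fst c)
      ((\<lambda>z. g z (coord_vector C c i z) (coord_vector C c j z)) \<circ> chart_inv c)"
    if "i \<in> Basis" "j \<in> Basis" for i j
  proof -
    have "smooth_fun_on C (fst c) (\<lambda>z. g z (coord_vector C c i z) (coord_vector C c j z))"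
      using metric c that unfolding riemannian_metric_def by blast
    then have "smooth_on (snd c ` (fst c \<inter> fst c))
        ((\<lambda>z. g z (coord_vector C c i z) (coord_vector C c j z)) \<circ> chart_inv c)"
      using c unfolding smooth_fun_on_def by blast
    then show ?thesis
      unfolding Int_absorb by (rule smooth_on_imp_continuous_on)
  qed
  then have "continuous_on (snd c ` fst c \<times> UNIV)
      (\<lambda>x. ((\<lambda>z. g z (coord_vector C c i z) (coord_vector C c j z)) \<circ> chart_inv c) (fst x))"
    if "i \<in> Basis" "j \<in> Basis" for i j
    using that by (intro continuous_on_compose2[OF _ continuous_on_fst[OF continuous_on_id]]) auto
  then have "continuous_on (snd c ` fst c \<times> UNIV) (\<lambda>x. \<Sum>i\<in>Basis. \<Sum>j\<in>Basis.
      (snd x \<bullet> i) * (snd x \<bullet> j) *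
      ((\<lambda>z. g z (coord_vector C c i z) (coord_vector C c j z)) \<circ> chart_inv c) (fst x))"
    by (intro continuous_intros)
  then show ?thesis
    by (rule continuous_on_eq) (use c in \<open>auto simp: chart_form_expand\<close>)
qed

text \<open>On the compact product of \<open>K\<close> with the unit sphere the form is continuous
  and positive, so it attains a positive minimum and maximum; homogeneity extends the bounds to all
  vectors.\<close>

lemma chart_form_bounds:
  assumes c: "c \<in> C" and K: "compact K" "K \<subseteq> snd c ` fst c"
  obtains m M where "m > 0" "M > 0"
    "\<And>y v. y \<in> K \<Longrightarrow> m * norm v \<le> sqrt (chart_form c (chart_inv c y) v v)"
    "\<And>y v. y \<in> K \<Longrightarrow> sqrt (chart_form c (chart_inv c y) v v) \<le> M * norm v"
proof (cases "K = {}")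
  case True
  then show ?thesis using that[of 1 1] by auto
next
  case False
  let ?f = "\<lambda>(y, v). chart_form c (chart_inv c y) v v"
  let ?S = "K \<times> sphere 0 1 :: ('c \<times> 'c) set"
  have S: "compact ?S" "?S \<noteq> {}" "continuous_on ?S ?f"
    using K False by (auto intro!: compact_Times continuous_on_subset[OF continuous_on_chart_form[OF c]])
  obtain y0 v0 where 0: "y0 \<in> K" "v0 \<in> sphere 0 1" and min: "\<And>y v. y \<in> K \<Longrightarrow> v \<in> sphere 0 1 \<Longrightarrow>
      chart_form c (chart_inv c y0) v0 v0 \<le> chart_form c (chart_inv c y) v v"
    using continuous_attains_inf[OF S] by auto
  obtain y1 v1 where 1: "y1 \<in> K" "v1 \<in> sphere 0 1" and max: "\<And>y v. y \<in> K \<Longrightarrow> v \<in> sphere 0 1 \<Longrightarrow>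
      chart_form c (chart_inv c y) v v \<le> chart_form c (chart_inv c y1) v1 v1"
    using continuous_attains_sup[OF S] by auto
  have dom: "chart_inv c y \<in> fst c" if "y \<in> K" for y
    using that K c by auto
  have pos: "chart_form c (chart_inv c y) v v > 0" if "y \<in> K" "v \<in> sphere 0 1" for y v
    using chart_form_pos[OF c dom[OF that(1)], of v] that(2) by (cases "v = 0") auto
  have eq: "sqrt (chart_form c (chart_inv c y) v v)
      = sqrt (chart_form c (chart_inv c y) (v /\<^sub>R norm v) (v /\<^sub>R norm v)) * norm v"
    if "y \<in> K" "v \<noteq> 0" for y v
  proof -
    have "v = norm v *\<^sub>R (v /\<^sub>R norm v)"
      using that by simp
    then have "chart_form c (chart_inv c y) v v
        = (norm v)\<^sup>2 * chart_form c (chart_inv c y) (v /\<^sub>R norm v) (v /\<^sub>R norm v)"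
      using chart_form_scaleR[OF c dom[OF that(1)], of "norm v" "v /\<^sub>R norm v"] by simp
    then show ?thesis
      by (simp add: real_sqrt_mult)
  qed
  have zero: "chart_form c (chart_inv c y) 0 0 = 0" if "y \<in> K" for y
    using chart_form_scaleR[OF c dom[OF that], of 0 0] by simp
  show ?thesis
  proof (rule that)
    show "sqrt (chart_form c (chart_inv c y0) v0 v0) > 0" "sqrt (chart_form c (chart_inv c y1) v1 v1) > 0"
      using pos 0 1 by auto
    fix y and v :: 'c assume y: "y \<in> K"
    have v: "v /\<^sub>R norm v \<in> sphere 0 1" if "v \<noteq> 0"
      using that by simp
    show "sqrt (chart_form c (chart_inv c y0) v0 v0) * norm v \<le> sqrt (chart_form c (chart_inv c y) v v)"
      using min[OF y v] zero[OF y] eq[OF y, of v] by (cases "v = 0") (auto intro!: mult_right_mono)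
    show "sqrt (chart_form c (chart_inv c y) v v) \<le> sqrt (chart_form c (chart_inv c y1) v1 v1) * norm v"
      using max[OF y v] zero[OF y] eq[OF y, of v] by (cases "v = 0") (auto intro!: mult_right_mono)
  qed
qed

end

section \<open>Concatenation of curves and the triangle inequality\<close>

lemma ennreal_le_INF_add_INF:
  fixes f :: "'a \<Rightarrow> ennreal" and f' :: "'b \<Rightarrow> ennreal"
  assumes "\<And>x y. x \<in> S \<Longrightarrow> y \<in> T \<Longrightarrow> b \<le> f x + f' y"
  shows "b \<le> (INF x\<in>S. f x) + (INF y\<in>T. f' y)"
proof (rule ennreal_le_epsilon)
  fix e :: real assume "(INF x\<in>S. f x) + (INF y\<in>T. f' y) < top" and e: "0 < e"
  then have fin: "(INF x\<in>S. f x) \<noteq> \<infinity>" "(INF y\<in>T. f' y) \<noteq> \<infinity>"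
    by (metis ennreal_add_eq_top infinity_ennreal_def less_irrefl)+
  have "e / 2 > 0"
    using e by simp
  obtain x where x: "x \<in> S" "f x < (INF x\<in>S. f x) + ennreal (e / 2)"
    using INF_approx_ennreal[OF \<open>e / 2 > 0\<close> refl fin(1)] by blast
  obtain y where y: "y \<in> T" "f' y < (INF y\<in>T. f' y) + ennreal (e / 2)"
    using INF_approx_ennreal[OF \<open>e / 2 > 0\<close> refl fin(2)] by blast
  have "b \<le> f x + f' y"
    using assms x(1) y(1) .
  also have "\<dots> \<le> ((INF x\<in>S. f x) + ennreal (e / 2)) + ((INF y\<in>T. f' y) + ennreal (e / 2))"
    using x(2) y(2) by (intro add_mono) auto
  also have "\<dots> = (INF x\<in>S. f x) + (INF y\<in>T. f' y) + (ennreal (e / 2) + ennreal (e / 2))"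
    by (simp add: ac_simps)
  also have "ennreal (e / 2) + ennreal (e / 2) = ennreal e"
    using e by (simp flip: ennreal_plus)
  finally show "b \<le> (INF x\<in>S. f x) + (INF y\<in>T. f' y) + ennreal e" .
qed

lemma AE_lborel_not_in_finite: "finite K \<Longrightarrow> AE s in lborel. s \<notin> (K :: real set)"
  by (intro AE_not_in finite_imp_null_set_lborel)

context riemannian_atlas
begin

definition speed :: "(real \<Rightarrow> 'p) \<Rightarrow> real \<Rightarrow> real" where
  "speed \<gamma> s = sqrt (g (\<gamma> s) (velocity C \<gamma> s) (velocity C \<gamma> s))"

lemma curve_length_eq: "curve_length C g \<gamma> = (\<integral>\<^sup>+ s. ennreal (speed \<gamma> s) * indicator {0..1} s \<partial>lborel)"
  by (simp add: curve_length_def speed_def)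

lemma speed_eq_chart_form:
  assumes "c \<in> C" "\<gamma> s \<in> fst c" "isCont \<gamma> s" "(snd c \<circ> \<gamma> has_vector_derivative v) (at s)"
  shows "speed \<gamma> s = sqrt (chart_form c (\<gamma> s) v v)"
  by (simp add: speed_def chart_form_def velocity_eq_chart_vec[OF assms])

lemma piecewise_C1_curves_isCont:
  "\<gamma> \<in> piecewise_C1_curves C p z \<Longrightarrow> s \<in> {0<..<1} \<Longrightarrow> isCont \<gamma> s"
  unfolding piecewise_C1_curves_def
  by (auto intro: continuous_on_interior[of "{0..1}"])

lemma speed_affine:
  assumes \<gamma>: "isCont \<gamma> (a * s + b)" "\<And>c. c \<in> C \<Longrightarrow> \<gamma> (a * s + b) \<in> fst c \<Longrightarrow>
      (snd c \<circ> \<gamma>) differentiable (at (a * s + b))"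
    and U: "open U" "s \<in> U" "\<And>t. t \<in> U \<Longrightarrow> \<gamma>' t = \<gamma> (a * t + b)" and "a > 0"
  shows "speed \<gamma>' s = a * speed \<gamma> (a * s + b)"
proof -
  obtain c where c: "c \<in> C" "\<gamma> (a * s + b) \<in> fst c"
    by (rule chart_at)
  obtain v where v: "(snd c \<circ> \<gamma> has_vector_derivative v) (at (a * s + b))"
    using \<gamma>(2)[OF c] vector_derivative_works by blast
  have "((\<lambda>s. a * s + b) has_vector_derivative a) (at s)"
    by (auto intro!: derivative_eq_intros simp: has_real_derivative_iff_has_vector_derivative[symmetric])
  then have "((snd c \<circ> \<gamma>) \<circ> (\<lambda>s. a * s + b) has_vector_derivative a *\<^sub>R v) (at s)"
    using v by (rule vector_diff_chain_at)
  then have D: "(snd c \<circ> \<gamma>' has_vector_derivative a *\<^sub>R v) (at s)"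
    by (rule has_vector_derivative_transform_within_open[OF _ U(1,2)]) (simp add: U(3))
  have "isCont (\<lambda>t. \<gamma> (a * t + b)) s"
    using \<gamma>(1) by (intro isCont_o2[of s "\<lambda>t. a * t + b" \<gamma>] continuous_intros)
  moreover have "\<forall>\<^sub>F t in nhds s. \<gamma>' t = \<gamma> (a * t + b)"
    using U eventually_nhds by blast
  ultimately have "isCont \<gamma>' s"
    using isCont_cong[of \<gamma>' "\<lambda>t. \<gamma> (a * t + b)" s] by simp
  then show ?thesis
    using speed_eq_chart_form[of c \<gamma>' s, OF _ _ _ D] speed_eq_chart_form[OF c \<gamma>(1) v] c U \<open>a > 0\<close>
    by (simp add: chart_form_scaleR real_sqrt_mult)
qed

text \<open>An inequality between the lengths is all that the triangle inequality asks for, and it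
  is what \<open>nn_integral_split_le\<close> and \<open>nn_integral_affine_le\<close> give for
  integrands of unknown measurability.\<close>

lemma join_curves:
  assumes \<gamma>1: "\<gamma>1 \<in> piecewise_C1_curves C p z" and \<gamma>2: "\<gamma>2 \<in> piecewise_C1_curves C z w"
  shows "\<gamma>1 +++ \<gamma>2 \<in> piecewise_C1_curves C p w"
    and "curve_length C g (\<gamma>1 +++ \<gamma>2) \<le> curve_length C g \<gamma>1 + curve_length C g \<gamma>2"
proof -
  let ?\<gamma> = "\<gamma>1 +++ \<gamma>2"
  obtain K1 where K1: "finite K1" "\<And>c. c \<in> C \<Longrightarrow>
      (snd c \<circ> \<gamma>1) C1_differentiable_on ({0<..<1} \<inter> \<gamma>1 -` fst c - K1)"
    using \<gamma>1 by (auto simp: piecewise_C1_curves_def)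
  obtain K2 where K2: "finite K2" "\<And>c. c \<in> C \<Longrightarrow>
      (snd c \<circ> \<gamma>2) C1_differentiable_on ({0<..<1} \<inter> \<gamma>2 -` fst c - K2)"
    using \<gamma>2 by (auto simp: piecewise_C1_curves_def)
  \<comment> \<open>The summands \<open>+ 0\<close> here and \<open>+ - 1\<close> below keep the
    shape \<open>a * s + b\<close> of the affine lemmas.\<close>
  have l: "?\<gamma> t = \<gamma>1 (2 * t + 0)" if "t \<in> {..<1/2}" for t
    using that by (auto simp: joinpaths_def)
  have r: "?\<gamma> t = \<gamma>2 (2 * t + - 1)" if "t \<in> {1/2<..}" for t
    using that by (auto simp: joinpaths_def)
  \<comment> \<open>The exceptional times of both curves, rescaled to the two halves, and the
    junction, where the joined curve may have a corner.\<close>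
  define K where "K = insert (1/2) ((\<lambda>s. s / 2) ` K1 \<union> (\<lambda>s. (s + 1) / 2) ` K2)"
  have K: "finite K"
    using K1 K2 by (simp add: K_def)
  have K1': "2 * s + 0 \<notin> K1" if "s \<notin> K" for s
  proof
    assume "2 * s + 0 \<in> K1"
    then have "s \<in> (\<lambda>s. s / 2) ` K1"
      by (rule rev_image_eqI) simp
    then show False
      using that by (simp add: K_def)
  qed
  have K2': "2 * s + - 1 \<notin> K2" if "s \<notin> K" for s
  proof
    assume "2 * s + - 1 \<in> K2"
    then have "s \<in> (\<lambda>s. (s + 1) / 2) ` K2"
      by (rule rev_image_eqI) simp
    then show False
      using that by (simp add: K_def)
  qed
  have C1: "(snd c \<circ> ?\<gamma>) C1_differentiable_on ({0<..<1} \<inter> ?\<gamma> -` fst c - K)" (is "_ C1_differentiable_on ?S")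
    if c: "c \<in> C" for c
  proof (rule C1_differentiable_on_local)
    fix s assume s: "s \<in> ?S"
    then consider "s \<in> {..<1/2}" | "s \<in> {1/2<..}"
      by (auto simp: K_def) argo
    then show "\<exists>U. open U \<and> s \<in> U \<and> (snd c \<circ> ?\<gamma>) C1_differentiable_on (?S \<inter> U)"
    proof cases
      case 1
      have "(snd c \<circ> ?\<gamma>) C1_differentiable_on (?S \<inter> {..<1/2})"
        by (rule C1_differentiable_on_affine[OF K1(2)[OF c], of "{..<1/2}" _ 2 0])
          (use l K1' in auto)
      then show ?thesis
        using 1 by (intro exI[of _ "{..<1/2}"]) simp
    next
      case 2
      have "(snd c \<circ> ?\<gamma>) C1_differentiable_on (?S \<inter> {1/2<..})"
        by (rule C1_differentiable_on_affine[OF K2(2)[OF c], of "{1/2<..}" _ 2 "- 1"])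
          (use r K2' in auto)
      then show ?thesis
        using 2 by (intro exI[of _ "{1/2<..}"]) simp
    qed
  qed
  have "path ?\<gamma>"
    using \<gamma>1 \<gamma>2 by (intro path_join_imp) (auto simp: piecewise_C1_curves_def path_def pathfinish_def pathstart_def)
  then show "?\<gamma> \<in> piecewise_C1_curves C p w"
    using \<gamma>1 \<gamma>2 K C1 unfolding piecewise_C1_curves_def
    by (auto simp: path_def joinpaths_def)
  have speed_l: "speed ?\<gamma> s = 2 * speed \<gamma>1 (2 * s + 0)" if s: "s \<in> {0<..<1/2} - K" for s
  proof (rule speed_affine[of _ _ _ _ "{..<1/2}"])
    have *: "2 * s + 0 \<in> {0<..<1} - K1"
      using s K1' by auto
    then show "isCont \<gamma>1 (2 * s + 0)"
      using piecewise_C1_curves_isCont[OF \<gamma>1] by blast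
    show "(snd c \<circ> \<gamma>1) differentiable (at (2 * s + 0))" if "c \<in> C" "\<gamma>1 (2 * s + 0) \<in> fst c" for c
      using K1(2)[OF that(1)] * that(2) unfolding C1_differentiable_on_eq by blast
  qed (use s l in auto)
  have speed_r: "speed ?\<gamma> s = 2 * speed \<gamma>2 (2 * s + - 1)" if s: "s \<in> {1/2<..<1} - K" for s
  proof (rule speed_affine[of _ _ _ _ "{1/2<..}"])
    have *: "2 * s + - 1 \<in> {0<..<1} - K2"
      using s K2' by auto
    then show "isCont \<gamma>2 (2 * s + - 1)"
      using piecewise_C1_curves_isCont[OF \<gamma>2] by blast
    show "(snd c \<circ> \<gamma>2) differentiable (at (2 * s + - 1))" if "c \<in> C" "\<gamma>2 (2 * s + - 1) \<in> fst c" for c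
      using K2(2)[OF that(1)] * that(2) unfolding C1_differentiable_on_eq by blast
  qed (use s r in auto)
  define f where "f \<gamma> s = ennreal (speed \<gamma> s) * indicator {0..1} s" for \<gamma> s
  have AE: "AE s in lborel. s \<notin> K \<union> {0, 1}"
    using K by (intro AE_lborel_not_in_finite) auto
  have "curve_length C g ?\<gamma> \<le> (\<integral>\<^sup>+ s. f ?\<gamma> s * indicator {..1/2} s \<partial>lborel)
      + (\<integral>\<^sup>+ s. f ?\<gamma> s * indicator (- {..1/2}) s \<partial>lborel)"
    unfolding curve_length_eq f_def[symmetric] by (rule nn_integral_split_le) simp
  also have "\<dots> \<le> (\<integral>\<^sup>+ s. ennreal 2 * f \<gamma>1 (2 * s + 0) \<partial>lborel)
      + (\<integral>\<^sup>+ s. ennreal 2 * f \<gamma>2 (2 * s + - 1) \<partial>lborel)"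
  proof (rule add_mono; rule nn_integral_mono_AE)
    show "AE s in lborel. f ?\<gamma> s * indicator {..1/2} s \<le> ennreal 2 * f \<gamma>1 (2 * s + 0)"
      using AE
    proof eventually_elim
      case (elim s)
      show ?case
      proof (cases "s \<in> {0<..<1/2}")
        case True
        then show ?thesis
          using elim by (auto simp: f_def speed_l[of s] ennreal_mult')
      next
        case False
        then have "s < 0 \<or> s > 1/2"
          using elim by (auto simp: K_def)
        then show ?thesis
          by (auto simp: f_def)
      qed
    qed
    show "AE s in lborel. f ?\<gamma> s * indicator (- {..1/2}) s \<le> ennreal 2 * f \<gamma>2 (2 * s + - 1)"
      using AE
    proof eventually_elim
      case (elim s)
      show ?case
      proof (cases "s \<in> {1/2<..<1}")
        case True
        then show ?thesis
          using elim by (auto simp: f_def speed_r[of s] ennreal_mult')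
      next
        case False
        then have "s \<le> 1/2 \<or> s > 1"
          using elim by (auto simp: K_def)
        then show ?thesis
          by (auto simp: f_def)
      qed
    qed
  qed
  also have "\<dots> \<le> integral\<^sup>N lborel (f \<gamma>1) + integral\<^sup>N lborel (f \<gamma>2)"
    by (intro add_mono nn_integral_affine_le) auto
  finally show "curve_length C g ?\<gamma> \<le> curve_length C g \<gamma>1 + curve_length C g \<gamma>2"
    by (simp add: curve_length_eq f_def[abs_def])
qed

lemma riem_dist_triangle: "riem_dist C g p w \<le> riem_dist C g p z + riem_dist C g z w"
  unfolding riem_dist_def[of _ _ p z] riem_dist_def[of _ _ z w]
proof (rule ennreal_le_INF_add_INF)
  fix \<gamma>1 \<gamma>2 assume "\<gamma>1 \<in> piecewise_C1_curves C p z" "\<gamma>2 \<in> piecewise_C1_curves C z w"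
  note * = join_curves[OF this]
  show "riem_dist C g p w \<le> curve_length C g \<gamma>1 + curve_length C g \<gamma>2"
    unfolding riem_dist_def using * by (rule INF_lower2[where f = "curve_length C g"])
qed

text \<open>In the chart \<open>c\<close> the curve is a straight line of constant velocity; in any
  other chart it is the image of that line under a smooth transition map, hence \<open>C1\<close>
  without exceptional times.\<close>

lemma chart_segment:
  assumes c: "c \<in> C" and S: "convex S" "S \<subseteq> snd c ` fst c" "y \<in> S" "y' \<in> S"
  defines "\<gamma> \<equiv> (\<lambda>s. chart_inv c (y + s *\<^sub>R (y' - y)))"
  shows "\<gamma> \<in> piecewise_C1_curves C (chart_inv c y) (chart_inv c y')"
    and "s \<in> {0<..<1} \<Longrightarrow> speed \<gamma> s = sqrt (chart_form c (\<gamma> s) (y' - y) (y' - y))"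
proof -
  let ?l = "\<lambda>s. y + s *\<^sub>R (y' - y)"
  let ?U = "snd c ` fst c"
  have U: "open ?U" and cont: "continuous_on ?U (chart_inv c)"
    using is_chart[OF c] by (auto simp: is_chart_def homeomorphism_def)
  have lS: "?l s \<in> S" if "s \<in> {0..1}" for s
    using convexD_alt[OF S(1,3,4), of s] that by (simp add: algebra_simps)
  then have lU: "?l s \<in> ?U" if "s \<in> {0..1}" for s
    using S(2) that by blast
  have inv: "snd c (chart_inv c y) = y" "chart_inv c y \<in> fst c" if "y \<in> ?U" for y
    using that c by auto
  have dl: "(?l has_vector_derivative (y' - y)) (at s)" for s
    by (auto intro!: derivative_eq_intros)
  have cont\<gamma>: "continuous_on {0..1} \<gamma>"
    unfolding \<gamma>_def by (intro continuous_on_compose2[OF cont] continuous_intros) (use lU in auto)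
  have "(snd c' \<circ> \<gamma>) C1_differentiable_on ({0<..<1} \<inter> \<gamma> -` fst c' - {})" if c': "c' \<in> C" for c'
  proof -
    let ?T = "snd c' \<circ> chart_inv c" and ?V = "snd c ` (fst c \<inter> fst c')"
    let ?D = "\<lambda>s. frechet_derivative ?T (at (?l s)) (y' - y)"
    have T: "smooth_on ?V ?T"
      using smooth_transition[OF c c'] .
    have lV: "?l s \<in> ?V" if "s \<in> {0<..<1} \<inter> \<gamma> -` fst c'" for s
      using inv[OF lU, of s] that by (auto simp: \<gamma>_def intro!: image_eqI[of _ _ "\<gamma> s"])
    have "(?T \<circ> ?l has_vector_derivative ?D s) (at s)" if "s \<in> {0<..<1} \<inter> \<gamma> -` fst c'" for s
    proof -
      have d: "?T differentiable (at (?l s))"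
        using smooth_on_differentiable[OF T lV[OF that]] .
      have "(?T \<circ> ?l has_derivative frechet_derivative ?T (at (?l s)) \<circ> (\<lambda>t. t *\<^sub>R (y' - y))) (at s)"
        using dl d by (intro diff_chain_at) (auto simp: has_vector_derivative_def frechet_derivative_works[symmetric])
      moreover have "frechet_derivative ?T (at (?l s)) \<circ> (\<lambda>t. t *\<^sub>R (y' - y)) = (\<lambda>t. t *\<^sub>R ?D s)"
        using linear_cmul[OF linear_frechet_derivative[OF d]] by auto
      ultimately show ?thesis
        by (simp only: has_vector_derivative_def)
    qed
    moreover have "continuous_on ({0<..<1} \<inter> \<gamma> -` fst c') ?D"
      by (rule continuous_on_compose2[OF smooth_on_imp_continuous_on[OF smooth_on_frechet_derivative[OF T]]])
        (use lV in \<open>auto intro!: continuous_intros\<close>)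
    moreover have "snd c' \<circ> \<gamma> = ?T \<circ> ?l"
      by (auto simp: \<gamma>_def)
    ultimately show ?thesis
      unfolding C1_differentiable_on_def by (intro exI[of _ ?D]) auto
  qed
  then show \<gamma>: "\<gamma> \<in> piecewise_C1_curves C (chart_inv c y) (chart_inv c y')"
    using cont\<gamma> unfolding piecewise_C1_curves_def by (auto simp: \<gamma>_def intro!: exI[of _ "{}"])
  assume s: "s \<in> {0<..<1}"
  show "speed \<gamma> s = sqrt (chart_form c (\<gamma> s) (y' - y) (y' - y))"
  proof (rule speed_eq_chart_form[OF c])
    show "\<gamma> s \<in> fst c"
      using inv(2)[OF lU, of s] s by (auto simp: \<gamma>_def)
    show "isCont \<gamma> s"
      using piecewise_C1_curves_isCont[OF \<gamma> s] .
    show "(snd c \<circ> \<gamma> has_vector_derivative y' - y) (at s)"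
      by (rule has_vector_derivative_transform_within_open[OF dl, of "{0<..<1}"])
        (use s inv(1)[OF lU] in \<open>auto simp: \<gamma>_def\<close>)
  qed
qed

text \<open>Estimated by the length of the coordinate segment, which stays in the compact convex set
  where the metric is bounded by \<open>M\<close> times the Euclidean norm.\<close>

lemma riem_dist_chart_le:
  assumes c: "c \<in> C" and S: "compact S" "convex S" "S \<subseteq> snd c ` fst c"
  obtains M where "M > 0"
    "\<And>y y'. y \<in> S \<Longrightarrow> y' \<in> S \<Longrightarrow> riem_dist C g (chart_inv c y) (chart_inv c y') \<le> ennreal (M * norm (y' - y))"
proof -
  obtain m M where M: "M > 0" "\<And>y v. y \<in> S \<Longrightarrow> sqrt (chart_form c (chart_inv c y) v v) \<le> M * norm v"
    using chart_form_bounds[OF c S(1,3)] by metis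
  have "riem_dist C g (chart_inv c y) (chart_inv c y') \<le> ennreal (M * norm (y' - y))"
    if y: "y \<in> S" "y' \<in> S" for y y'
  proof -
    let ?\<gamma> = "\<lambda>s. chart_inv c (y + s *\<^sub>R (y' - y))"
    note \<gamma> = chart_segment[OF c S(2,3) y]
    have "riem_dist C g (chart_inv c y) (chart_inv c y') \<le> curve_length C g ?\<gamma>"
      unfolding riem_dist_def by (rule INF_lower[OF \<gamma>(1)])
    also have "\<dots> \<le> (\<integral>\<^sup>+ s. ennreal (M * norm (y' - y)) * indicator {0..1::real} s \<partial>lborel)"
      unfolding curve_length_eq
    proof (rule nn_integral_mono_AE)
      have "AE s in lborel. s \<notin> {0, 1::real}"
        by (intro AE_lborel_not_in_finite) auto
      then show "AE s in lborel. ennreal (speed ?\<gamma> s) * indicator {0..1} s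
          \<le> ennreal (M * norm (y' - y)) * indicator {0..1} s"
      proof eventually_elim
        case (elim s)
        show ?case
        proof (cases "s \<in> {0<..<1}")
          case True
          then have "y + s *\<^sub>R (y' - y) \<in> S"
            using convexD_alt[OF S(2) y, of s] by (simp add: algebra_simps)
          then show ?thesis
            using \<gamma>(2)[OF True] M(2) True by (auto intro!: ennreal_leI)
        next
          case False
          then show ?thesis
            using elim by auto
        qed
      qed
    qed
    also have "\<dots> = ennreal (M * norm (y' - y))"
      by (simp add: nn_integral_cmult)
    finally show ?thesis .
  qed
  with M(1) show ?thesis
    using that by blast
qed

lemma chart_cball_at:
  obtains c r where "c \<in> C" "z \<in> fst c" "r > 0" "cball (snd c z) r \<subseteq> snd c ` fst c"
proof -
  obtain c where c: "c \<in> C" "z \<in> fst c" by (rule chart_at)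
  then have "open (snd c ` fst c)" "snd c z \<in> snd c ` fst c"
    using is_chart[OF c(1)] by (auto simp: is_chart_def)
  then show ?thesis
    using that c open_contains_cball by blast
qed

lemma riem_dist_self: "riem_dist C g z z = 0"
proof -
  obtain c r where c: "c \<in> C" "z \<in> fst c" and r: "r > 0" "cball (snd c z) r \<subseteq> snd c ` fst c"
    by (rule chart_cball_at)
  obtain M where "\<And>y y'. y \<in> cball (snd c z) r \<Longrightarrow> y' \<in> cball (snd c z) r \<Longrightarrow>
      riem_dist C g (chart_inv c y) (chart_inv c y') \<le> ennreal (M * norm (y' - y))"
    using riem_dist_chart_le[OF c(1) compact_cball convex_cball r(2)] by metis
  from this[of "snd c z" "snd c z"] show ?thesis
    using c r by simp
qed

text \<open>The triangle inequality squeezes the distance to \<open>w\<close> between the distance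
  to \<open>z\<close> minus and plus a small error, the chart estimate bounding both
  \<open>riem_dist C g w z\<close> and \<open>riem_dist C g z w\<close>. In the extended reals this
  also covers points at infinite distance.\<close>

lemma isCont_riem_dist: "isCont (riem_dist C g p) z"
proof -
  obtain c r where c: "c \<in> C" "z \<in> fst c" and r: "r > 0" "cball (snd c z) r \<subseteq> snd c ` fst c"
    by (rule chart_cball_at)
  obtain M where M: "\<And>y y'. y \<in> cball (snd c z) r \<Longrightarrow> y' \<in> cball (snd c z) r \<Longrightarrow>
      riem_dist C g (chart_inv c y) (chart_inv c y') \<le> ennreal (M * norm (y' - y))"
    using riem_dist_chart_le[OF c(1) compact_cball convex_cball r(2)] by metis
  let ?Z = "fst c \<inter> snd c -` ball (snd c z) r"
  let ?e = "\<lambda>w. ennreal (M * norm (snd c w - snd c z))"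
  have Z: "open ?Z" "z \<in> ?Z"
    using is_chart_open_preimage[OF is_chart[OF c(1)] open_ball] c r by auto
  have ev: "\<forall>\<^sub>F w in at z. w \<in> ?Z"
    using Z eventually_at_topological by blast
  have d: "riem_dist C g w z \<le> ?e w" "riem_dist C g z w \<le> ?e w" if "w \<in> ?Z" for w
    using M[of "snd c w" "snd c z"] M[of "snd c z" "snd c w"] that c r by (auto simp: norm_minus_commute)
  have "continuous_on (fst c) (snd c)" "open (fst c)"
    using is_chart[OF c(1)] by (auto simp: is_chart_def homeomorphism_def)
  then have "isCont (snd c) z"
    using c by (simp add: continuous_on_eq_continuous_at)
  then have "((\<lambda>w. M * norm (snd c w - snd c z)) \<longlongrightarrow> M * norm (snd c z - snd c z)) (at z)"
    by (intro tendsto_intros) (simp add: isCont_def)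
  then have e: "(?e \<longlongrightarrow> 0) (at z)"
    using tendsto_ennrealI by fastforce
  show ?thesis
    unfolding isCont_def
  proof (rule tendsto_sandwich)
    show "\<forall>\<^sub>F w in at z. riem_dist C g p z - ?e w \<le> riem_dist C g p w"
      using ev
    proof eventually_elim
      case (elim w)
      have "riem_dist C g p z \<le> riem_dist C g p w + ?e w"
        using riem_dist_triangle[of p z w] d(1)[OF elim] by (meson add_left_mono order_trans)
      then show ?case
        by (simp add: ennreal_minus_le_iff add.commute)
    qed
    show "\<forall>\<^sub>F w in at z. riem_dist C g p w \<le> riem_dist C g p z + ?e w"
      using ev
      by eventually_elim (meson riem_dist_triangle d(2) add_left_mono order_trans)
    show "((\<lambda>w. riem_dist C g p z - ?e w) \<longlongrightarrow> riem_dist C g p z) (at z)"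
      using tendsto_diff_ennreal_general[OF tendsto_const e, of "riem_dist C g p z"] by simp
    show "((\<lambda>w. riem_dist C g p z + ?e w) \<longlongrightarrow> riem_dist C g p z) (at z)"
      using tendsto_add[OF tendsto_const e, of "riem_dist C g p z"] by simp
  qed
qed

text \<open>
  A curve that leaves a coordinate ball first crosses it, and there the metric dominates the Euclidean one.
\<close>

lemma riem_dist_outside_ball:
  assumes c: "c \<in> C" "p \<in> fst c" and r: "r > 0" "cball (snd c p) r \<subseteq> snd c ` fst c"
  obtains \<delta> where "\<delta> > 0"
    "\<And>z. z \<notin> fst c \<inter> snd c -` ball (snd c p) r \<Longrightarrow> ennreal \<delta> \<le> riem_dist C g p z"
proof -
  let ?N = "fst c \<inter> snd c -` ball (snd c p) r"
  let ?B = "cball (snd c p) r"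
  let ?K = "chart_inv c ` ?B"
  have chart: "continuous_on (fst c) (snd c)" "open (fst c)" "continuous_on (snd c ` fst c) (chart_inv c)"
    using is_chart[OF c(1)] by (auto simp: is_chart_def homeomorphism_def)
  have N: "open ?N"
    by (rule is_chart_open_preimage[OF is_chart[OF c(1)] open_ball])
  have "compact ?K"
    using chart(3) r(2) by (intro compact_continuous_image continuous_on_subset[OF chart(3)]) auto
  then have K: "closed ?K"
    by (rule compact_imp_closed)
  have NK: "?N \<subseteq> ?K"
  proof
    fix z assume "z \<in> ?N"
    then show "z \<in> ?K"
      using c by (intro image_eqI[of _ _ "snd c z"]) auto
  qed
  have Kdom: "z \<in> fst c" "snd c z \<in> ?B" if "z \<in> ?K" for z
    using that r(2) c by auto
  obtain m M where m: "m > 0" "\<And>y v. y \<in> ?B \<Longrightarrow> m * norm v \<le> sqrt (chart_form c (chart_inv c y) v v)"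
    using chart_form_bounds[OF c(1) compact_cball r(2)] by metis
  have "ennreal (m * r) \<le> curve_length C g \<gamma>" if z: "z \<notin> ?N" and \<gamma>: "\<gamma> \<in> piecewise_C1_curves C p z" for z \<gamma>
  proof -
    have cont: "continuous_on {0..1} \<gamma>" and ends: "\<gamma> 0 = p" "\<gamma> 1 = z"
      using \<gamma> by (auto simp: piecewise_C1_curves_def)
    obtain E where E: "finite E" "(snd c \<circ> \<gamma>) C1_differentiable_on ({0<..<1} \<inter> \<gamma> -` fst c - E)"
      using \<gamma> c by (auto simp: piecewise_C1_curves_def)
    let ?T = "{0..1} \<inter> \<gamma> -` (- ?N)"
    \<comment> \<open>The time of first exit from the open coordinate ball. The set of times outside
      is closed, so the infimum belongs to it.\<close>
    define s1 where "s1 = Inf ?T"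
    have closedT: "closed ?T"
      using closed_Compl[OF N] by (rule continuous_closed_preimage[OF cont closed_atLeastAtMost])
    have "1 \<in> ?T"
      using z ends by simp
    then have T: "?T \<noteq> {}" "bdd_below ?T"
      by blast simp
    then have s1T: "s1 \<in> ?T"
      unfolding s1_def using closedT by (rule closed_contains_Inf)
    have before: "\<gamma> s \<in> ?N" if "s \<in> {0..<s1}" for s
      using cInf_lower[OF _ T(2), of s] that s1T by (force simp: s1_def)
    have s1: "0 < s1" "s1 \<le> 1"
      using s1T ends c r by (auto simp: less_le)
    have cont': "continuous_on {0..s1} \<gamma>"
      using s1 by (intro continuous_on_subset[OF cont]) auto
    \<comment> \<open>At the exit time itself the curve must still be in the chart domain to have
      coordinates. This holds because \<open>?K\<close> is compact, hence closed in the Hausdorff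
      manifold, and contains the curve up to that time.\<close>
    have inK: "\<gamma> s \<in> ?K" if "s \<in> {0..s1}" for s
    proof -
      have "{0..<s1} \<subseteq> {0..s1} \<inter> \<gamma> -` ?K"
        using before NK by (intro subsetI IntI vimageI2) (simp, blast)
      then have "closure {0..<s1} \<subseteq> {0..s1} \<inter> \<gamma> -` ?K"
        using K by (intro closure_minimal continuous_closed_preimage cont') auto
      then show ?thesis
        using that s1 by auto
    qed
    let ?u = "snd c \<circ> \<gamma>"
    let ?D = "\<lambda>s. vector_derivative ?u (at s)"
    have D: "(?u has_vector_derivative ?D s) (at s)" if "s \<in> {0<..<s1} - E" for s
    proof -
      have "?u differentiable (at s)"
        using E(2) that s1 Kdom(1)[OF inK] unfolding C1_differentiable_on_eq by auto
      then show ?thesis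
        by (simp add: vector_derivative_works)
    qed
    have "continuous_on {0..s1} ?u"
      using inK Kdom by (intro continuous_on_compose cont' continuous_on_subset[OF chart(1)]) auto
    then have "continuous_on {0..s1} (\<lambda>s. m *\<^sub>R ?u s)"
      by (rule continuous_on_scaleR[OF continuous_on_const])
    moreover have "((\<lambda>s. m *\<^sub>R ?u s) has_vector_derivative m *\<^sub>R ?D s) (at s)"
      if "s \<in> {0<..<s1} - E" for s
      by (rule bounded_linear.has_vector_derivative[OF bounded_linear_scaleR_right D[OF that]])
    ultimately have "ennreal (norm (m *\<^sub>R ?u s1 - m *\<^sub>R ?u 0)) \<le>
        (\<integral>\<^sup>+ s\<in>{0..s1}. ennreal (norm (m *\<^sub>R ?D s)) \<partial>lborel)"
      using s1(1) E(1) norm_le_nn_integral_derivative[of 0 s1 "\<lambda>s. m *\<^sub>R ?u s" E "\<lambda>s. m *\<^sub>R ?D s"]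
      by simp
    \<comment> \<open>The exit point lies in the chart domain but not in \<open>?N\<close>, so its
      coordinates are at distance at least \<open>r\<close> from those of \<open>p\<close>.\<close>
    moreover have "m * r \<le> norm (m *\<^sub>R ?u s1 - m *\<^sub>R ?u 0)"
    proof -
      have "r \<le> norm (?u s1 - ?u 0)"
        using s1T Kdom(1)[OF inK, of s1] s1 by (auto simp: ends dist_norm norm_minus_commute)
      then show ?thesis
        using m(1) by (simp flip: scaleR_diff_right)
    qed
    ultimately have "ennreal (m * r) \<le> (\<integral>\<^sup>+ s\<in>{0..s1}. ennreal (norm (m *\<^sub>R ?D s)) \<partial>lborel)"
      by (meson ennreal_leI order_trans)
    also have "\<dots> \<le> curve_length C g \<gamma>"
      unfolding curve_length_eq
    proof (rule nn_integral_mono_AE)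
      have "AE s in lborel. s \<notin> E \<union> {0, s1}"
        using E by (intro AE_lborel_not_in_finite) auto
      then show "AE s in lborel. ennreal (norm (m *\<^sub>R ?D s)) * indicator {0..s1} s
          \<le> ennreal (speed \<gamma> s) * indicator {0..1} s"
      proof eventually_elim
        case (elim s)
        show ?case
        proof (cases "s \<in> {0<..<s1}")
          case True
          then have s: "s \<in> {0<..<s1} - E" "s \<in> {0<..<1}" "\<gamma> s \<in> ?K"
            using elim s1 inK by auto
          have "m * norm (?D s) \<le> sqrt (chart_form c (\<gamma> s) (?D s) (?D s))"
            using m(2)[OF Kdom(2)[OF s(3)]] Kdom(1)[OF s(3)] c by simp
          also have "\<dots> = speed \<gamma> s"
            using speed_eq_chart_form[of c \<gamma> s, OF c(1) Kdom(1)[OF s(3)] piecewise_C1_curves_isCont[OF \<gamma> s(2)] D[OF s(1)]]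
            by simp
          finally show ?thesis
            using s m(1) by (auto intro!: ennreal_leI)
        next
          case False
          then show ?thesis
            using elim by auto
        qed
      qed
    qed
    finally show ?thesis .
  qed
  then have "ennreal (m * r) \<le> riem_dist C g p z" if "z \<notin> ?N" for z
    unfolding riem_dist_def using that by (intro INF_greatest) blast
  then show ?thesis
    using that[of "m * r"] m r by simp
qed

end

section \<open>The truncated squared distance\<close>

text \<open>The reflection \<open>\<delta> - y\<close> turns the convexity of
  \<open>flat_exp 1\<close> below 1/2 into concavity for \<open>y \<ge> 0\<close> when
  \<open>\<delta> \<le> 1/2\<close>; the constant moves the value at 0 to 0.\<close>

definition concave_cutoff :: "real \<Rightarrow> real \<Rightarrow> real" where
  "concave_cutoff \<delta> y = flat_exp 1 \<delta> - flat_exp 1 (\<delta> - y)"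

lemma concave_cutoff_smooth: "smooth_on UNIV (concave_cutoff \<delta>)"
proof -
  have lin: "smooth_on UNIV (\<lambda>y. k + - y)" for k :: real
    by (intro smooth_on_add smooth_on_const smooth_on_bounded_linear bounded_linear_minus bounded_linear_ident) auto
  have "smooth_on UNIV (flat_exp 1 \<circ> (\<lambda>y. \<delta> + - y))"
    by (rule smooth_on_compose[OF open_UNIV subset_UNIV lin flat_exp_smooth])
  then have "smooth_on UNIV ((\<lambda>y. flat_exp 1 \<delta> + - y) \<circ> (flat_exp 1 \<circ> (\<lambda>y. \<delta> + - y)))"
    by (rule smooth_on_compose[OF open_UNIV subset_UNIV _ lin])
  then show ?thesis
    by (simp add: o_def concave_cutoff_def[abs_def])
qed

lemma concave_cutoff_derivs:
  "(concave_cutoff \<delta> has_real_derivative flat_exp (flat_diff 1) (\<delta> - y)) (at y)"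
  "((\<lambda>y. flat_exp (flat_diff 1) (\<delta> - y)) has_real_derivative
    - flat_exp (flat_diff (flat_diff 1)) (\<delta> - y)) (at y)"
proof -
  have "((\<lambda>y. \<delta> - y) has_real_derivative - 1) (at y)"
    by (auto intro!: derivative_eq_intros)
  note * = DERIV_chain2[OF flat_exp_has_derivative this]
  show "(concave_cutoff \<delta> has_real_derivative flat_exp (flat_diff 1) (\<delta> - y)) (at y)"
    using DERIV_diff[OF DERIV_const *[of 1], of "flat_exp 1 \<delta>"] by (simp add: concave_cutoff_def[abs_def])
  show "((\<lambda>y. flat_exp (flat_diff 1) (\<delta> - y)) has_real_derivative
      - flat_exp (flat_diff (flat_diff 1)) (\<delta> - y)) (at y)"
    using *[of "flat_diff 1"] by simp
qed

lemma concave_cutoff_nonneg: "y \<ge> 0 \<Longrightarrow> concave_cutoff \<delta> y \<ge> 0"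
  using flat_exp_1_mono[of "\<delta> - y" \<delta>] by (simp add: concave_cutoff_def)

lemma concave_cutoff_eq_0: "\<delta> > 0 \<Longrightarrow> y \<ge> 0 \<Longrightarrow> concave_cutoff \<delta> y = 0 \<Longrightarrow> y = 0"
  using flat_exp_1_strict[of "\<delta> - y" \<delta>] by (cases "y = 0") (auto simp: concave_cutoff_def)

lemma concave_cutoff_ge: "y \<ge> \<delta> \<Longrightarrow> concave_cutoff \<delta> y = flat_exp 1 \<delta>"
  by (simp add: concave_cutoff_def flat_exp_def)

text \<open>The bridge between rational and real times: it makes the exceedance event a countable
  union, and it collects the null sets of the single times into one.\<close>

lemma rational_in_open_preimage:
  fixes f :: "real \<Rightarrow> 'b::topological_space"
  assumes "continuous_on {0..a} f" "open V" "0 < a" "s \<in> {0..a}" "f s \<in> V"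
  obtains q where "q \<in> {0..a} \<inter> \<rat>" "f q \<in> V"
proof -
  obtain W where W: "open W" "{0..a} \<inter> f -` V = {0..a} \<inter> W"
    using continuous_openin_preimage_gen[OF assms(1,2)] by (auto simp: openin_open)
  then obtain e where e: "e > 0" "ball s e \<subseteq> W"
    using assms(4,5) open_contains_ball by blast
  have "max 0 (s - e) < min a (s + e)"
    using assms(3,4) e by auto
  then obtain q where "q \<in> \<rat>" "max 0 (s - e) < q" "q < min a (s + e)"
    using Rats_dense_in_real by blast
  then have "q \<in> {0..a} \<inter> \<rat>" "q \<in> ball s e"
    by (auto simp: dist_real_def)
  then show ?thesis
    using that[of q] W e by blast
qed

lemma dist_sq_nonneg: "dist_sq C g p z \<ge> 0"
  by (simp add: dist_sq_def)

context riemannian_atlas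
begin

text \<open>
  The squared distance is smooth only near the points of interest and takes the junk value 0 on other components
  of the manifold; the truncated function has neither defect.
\<close>

lemma truncated_dist_sq:
  assumes D: "smooth_near C p (dist_sq C g p)"
  obtains \<delta> f where "0 < \<delta>" "\<delta> \<le> 1/2" "\<And>z. smooth_near C z f" "\<And>z. f z \<ge> 0" "f p = 0"
    "\<And>z. f z = 0 \<Longrightarrow> riem_dist C g p z = 0"
    "\<And>z. \<exists>Z. open Z \<and> z \<in> Z \<and>
      (smooth_near C z (dist_sq C g p) \<and> (\<forall>y\<in>Z. f y = concave_cutoff \<delta> (dist_sq C g p y))
        \<or> (\<exists>k. \<forall>y\<in>Z. f y = k))"
proof -
  let ?D = "dist_sq C g p"
  obtain Z0 where Z0: "open Z0" "p \<in> Z0" "\<And>y. y \<in> Z0 \<Longrightarrow> smooth_near C y ?D"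
    using smooth_near_open[OF D] by blast
  obtain c where c: "c \<in> C" "p \<in> fst c" by (rule chart_at)
  have "open (snd c ` (fst c \<inter> Z0))" "snd c p \<in> snd c ` (fst c \<inter> Z0)"
    using is_chart_open_image[OF is_chart[OF c(1)] Z0(1)] c Z0 by auto
  then obtain r0 where r0: "r0 > 0" "cball (snd c p) r0 \<subseteq> snd c ` (fst c \<inter> Z0)"
    using open_contains_cball by blast
  \<comment> \<open>Two radii are used so that the open ball \<open>?N'\<close> and the complement
    of the compact smaller ball \<open>?K\<close> overlap and cover the manifold. On the first set
    \<open>f\<close> is the cutoff of the squared distance, on the second it is constant.\<close>
  define r where "r = r0 / 2"
  have r: "0 < r" "r < r0" and r0': "cball (snd c p) r0 \<subseteq> snd c ` fst c"
    using r0 by (auto simp: r_def)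
  then have r': "cball (snd c p) r \<subseteq> snd c ` fst c"
    by (meson less_imp_le order_trans subset_cball)
  let ?N = "fst c \<inter> snd c -` ball (snd c p) r" and ?N' = "fst c \<inter> snd c -` ball (snd c p) r0"
  let ?K = "chart_inv c ` cball (snd c p) r"
  have N': "open ?N'"
    by (rule is_chart_open_preimage[OF is_chart[OF c(1)] open_ball])
  have "continuous_on (snd c ` fst c) (chart_inv c)"
    using is_chart[OF c(1)] by (auto simp: is_chart_def homeomorphism_def)
  then have "compact ?K"
    using compact_continuous_image[OF continuous_on_subset[OF _ r'] compact_cball] by blast
  then have K: "open (- ?K)"
    using compact_imp_closed by blast
  have NK: "z \<in> ?K" if "z \<in> ?N" for z
    using that c by (intro image_eqI[of _ _ "snd c z"]) auto
  have KN': "z \<in> ?N'" if "z \<in> ?K" for z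
    using that r' r c by auto
  have N'Z0: "z \<in> Z0" if z: "z \<in> ?N'" for z
  proof -
    have "snd c z \<in> snd c ` (fst c \<inter> Z0)"
      using z r0(2) by auto
    then obtain z' where z': "z' \<in> fst c" "z' \<in> Z0" "snd c z = snd c z'"
      by auto
    then have "z = z'"
      using chart_inverse[OF c(1)] z by (metis IntD1)
    with z' show ?thesis by simp
  qed
  obtain M where M: "\<And>y y'. y \<in> cball (snd c p) r0 \<Longrightarrow> y' \<in> cball (snd c p) r0 \<Longrightarrow>
      riem_dist C g (chart_inv c y) (chart_inv c y') \<le> ennreal (M * norm (y' - y))"
    using riem_dist_chart_le[OF c(1) compact_cball convex_cball r0'] by metis
  \<comment> \<open>Finiteness excludes the junk value of \<open>enn2real\<close> at infinity, so
    that on this ball a vanishing squared distance means distance 0.\<close>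
  have fin: "riem_dist C g p z < \<infinity>" if z: "z \<in> ?N'" for z
  proof -
    have "riem_dist C g p z \<le> ennreal (M * norm (snd c z - snd c p))"
      using M[of "snd c p" "snd c z"] z c r0(1) by auto
    then show ?thesis
      using ennreal_less_top le_less_trans infinity_ennreal_def by metis
  qed
  obtain \<delta>0 where \<delta>0: "\<delta>0 > 0" "\<And>z. z \<notin> ?N \<Longrightarrow> ennreal \<delta>0 \<le> riem_dist C g p z"
    by (rule riem_dist_outside_ball[OF c r(1) r']) blast
  \<comment> \<open>Outside \<open>?N\<close>, where it is finite, the distance has a square of at
    least \<open>\<delta>0^2\<close>, and there the cutoff has to be constant already; 1/2 is the
    limit for concavity.\<close>
  define \<delta> where "\<delta> = min (\<delta>0\<^sup>2) (1/2)"
  have \<delta>: "0 < \<delta>" "\<delta> \<le> 1/2"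
    using \<delta>0 by (auto simp: \<delta>_def)
  define f where "f z = (if z \<in> ?N then concave_cutoff \<delta> (?D z) else flat_exp 1 \<delta>)" for z
  \<comment> \<open>On the shell between the two balls both branches in the definition of
    \<open>f\<close> coincide.\<close>
  have fN': "f z = concave_cutoff \<delta> (?D z)" if z: "z \<in> ?N'" for z
  proof (cases "z \<in> ?N")
    case False
    have "\<delta>0 \<le> enn2real (riem_dist C g p z)"
      using enn2real_mono[OF \<delta>0(2)[OF False]] fin[OF z] \<delta>0(1) by (simp add: infinity_ennreal_def)
    then have "\<delta>0\<^sup>2 \<le> ?D z"
      using \<delta>0(1) unfolding dist_sq_def by (intro power_mono) auto
    then show ?thesis
      using False by (auto simp: f_def \<delta>_def concave_cutoff_ge)
  qed (simp add: f_def)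
  have fK: "f z = flat_exp 1 \<delta>" if "z \<in> - ?K" for z
    using that NK[of z] by (auto simp: f_def)
  have pN: "p \<in> ?N"
    using c r by auto
  show ?thesis
  proof (rule that[OF \<delta>])
    show "smooth_near C z f" for z
    proof (cases "z \<in> ?N'")
      case True
      have "smooth_near C z (concave_cutoff \<delta> \<circ> ?D)"
        using smooth_near_comp_real[OF Z0(3)[OF N'Z0[OF True]] concave_cutoff_smooth] .
      then show ?thesis
        by (rule smooth_near_cong[OF _ N' True]) (simp add: fN')
    next
      case False
      then have "z \<in> - ?K"
        using KN' by blast
      from smooth_near_const[of z "flat_exp 1 \<delta>"] K this show ?thesis
        by (rule smooth_near_cong) (simp add: fK)
    qed
    show "f z \<ge> 0" for z
      using concave_cutoff_nonneg[OF dist_sq_nonneg] by (auto simp: f_def flat_exp_def)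
    show "f p = 0"
      using pN by (simp add: f_def dist_sq_def riem_dist_self concave_cutoff_def)
    show "riem_dist C g p z = 0" if "f z = 0" for z
    proof -
      have z: "z \<in> ?N"
        using that \<delta> by (auto simp: f_def flat_exp_def split: if_splits)
      then have "?D z = 0"
        using that concave_cutoff_eq_0[OF \<delta>(1) dist_sq_nonneg] by (auto simp: f_def)
      moreover have "riem_dist C g p z < \<infinity>"
        by (rule fin) (use z r in auto)
      ultimately show ?thesis
        by (auto simp: dist_sq_def enn2real_eq_0_iff)
    qed
    show "\<exists>Z. open Z \<and> z \<in> Z \<and> (smooth_near C z ?D \<and> (\<forall>y\<in>Z. f y = concave_cutoff \<delta> (?D y))
        \<or> (\<exists>k. \<forall>y\<in>Z. f y = k))" for z
    proof (cases "z \<in> ?N'")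
      case True
      then show ?thesis
        using N' Z0(3)[OF N'Z0[OF True]] fN' by (intro exI[of _ ?N']) simp
    next
      case False
      then have "z \<in> - ?K"
        using KN' by blast
      then show ?thesis
        using K fK by (intro exI[of _ "- ?K"]) auto
    qed
  qed
qed

end

text \<open>
  The martingale part dominates the process and has expectation 0.
\<close>

lemma nonneg_nonpos_drift_vanishes:
  fixes W :: "real \<Rightarrow> 'w \<Rightarrow> real ^ 'd::finite"
  assumes FQ: "filtered_prob_space Q F" and W: "wiener_process Q F W"
    and I: "\<And>l. ito_integral Q F (\<lambda>t \<omega>. W t \<omega> $ l) T (H l) (I l)"
    and K: "\<And>l \<omega> s. \<omega> \<in> space Q \<Longrightarrow> s \<in> {0<..T} \<Longrightarrow> \<bar>H l s \<omega>\<bar> \<le> K"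
    and eq: "AE \<omega> in Q. \<forall>t\<in>{0..T}. Y t \<omega> = Y 0 \<omega> + (LBINT s:{0..t}. b s \<omega>) + (\<Sum>l\<in>UNIV. I l t \<omega>)"
    and b: "AE \<omega> in Q. \<forall>t\<in>{0..T}. b t \<omega> \<le> 0"
    and Y: "AE \<omega> in Q. Y 0 \<omega> = 0" "\<And>t \<omega>. Y t \<omega> \<ge> 0" and t: "t \<in> {0..T}"
  shows "AE \<omega> in Q. Y t \<omega> = 0"
proof -
  interpret prob_space Q using FQ by (simp add: filtered_prob_space_def)
  have I0: "integrable Q (I l t)" "expectation (I l t) = 0" for l
    using brownian_increments.ito_integral_bounded_expectation[OF wiener_brownian_increments[OF FQ W] I t K]
    by auto
  \<comment> \<open>This holds whether or not the drift is integrable, the default value 0 of the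
    integral being nonpositive as well.\<close>
  have bint: "AE \<omega> in Q. (LBINT s:{0..t}. b s \<omega>) \<le> 0"
    using b
  proof eventually_elim
    case (elim \<omega>)
    then have "0 \<le> (LBINT s:{0..t}. - b s \<omega>)"
      using t unfolding set_lebesgue_integral_def
      by (intro Bochner_Integration.integral_nonneg) (auto split: split_indicator)
    then show ?case
      by (simp add: set_lebesgue_integral_def)
  qed
  have "AE \<omega> in Q. 0 \<le> (\<Sum>l\<in>UNIV. I l t \<omega>)"
    using eq Y(1) bint
  proof eventually_elim
    case (elim \<omega>)
    have "Y t \<omega> = Y 0 \<omega> + (LBINT s:{0..t}. b s \<omega>) + (\<Sum>l\<in>UNIV. I l t \<omega>)"
      using elim(1) t by blast
    then show ?case
      using elim(2-) Y(2)[of t \<omega>] by linarith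
  qed
  moreover have "expectation (\<lambda>\<omega>. \<Sum>l\<in>UNIV. I l t \<omega>) = 0" "integrable Q (\<lambda>\<omega>. \<Sum>l\<in>UNIV. I l t \<omega>)"
    using I0 by (auto simp: Bochner_Integration.integral_sum)
  ultimately have "AE \<omega> in Q. (\<Sum>l\<in>UNIV. I l t \<omega>) = 0"
    using integral_nonneg_eq_0_iff_AE by blast
  \<comment> \<open>Without its martingale part, the nonnegative \<open>Y t\<close> equals the
    integral of a nonpositive drift.\<close>
  with eq Y(1) bint show ?thesis
  proof eventually_elim
    case (elim \<omega>)
    have "Y t \<omega> = Y 0 \<omega> + (LBINT s:{0..t}. b s \<omega>) + (\<Sum>l\<in>UNIV. I l t \<omega>)"
      using elim(1) t by blast
    then show ?case
      using elim(2-) Y(2)[of t \<omega>] by linarith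
  qed
qed

lemma manifold_semimartingale_fst:
  fixes X :: "real \<Rightarrow> 'w \<Rightarrow> 'm::second_countable_topology"
    and U :: "real \<Rightarrow> 'w \<Rightarrow> 'n::second_countable_topology"
  assumes "filtered_prob_space Q F" "manifold_semimartingale Q F A T (\<lambda>t \<omega>. (X t \<omega>, U t \<omega>))"
  shows "t \<in> {0..T} \<Longrightarrow> X t \<in> Q \<rightarrow>\<^sub>M borel" "\<omega> \<in> space Q \<Longrightarrow> continuous_on {0..T} (\<lambda>t. X t \<omega>)"
proof -
  assume t: "t \<in> {0..T}"
  have "(\<lambda>\<omega>. (X t \<omega>, U t \<omega>)) \<in> F t \<rightarrow>\<^sub>M borel"
    using assms(2) t by (simp add: manifold_semimartingale_def)
  moreover have "fst \<in> (borel :: ('m \<times> 'n) measure) \<rightarrow>\<^sub>M borel"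
    by (intro borel_measurable_continuous_onI continuous_on_fst continuous_on_id)
  ultimately have "(\<lambda>\<omega>. fst (X t \<omega>, U t \<omega>)) \<in> F t \<rightarrow>\<^sub>M borel"
    by (rule measurable_compose)
  then show "X t \<in> Q \<rightarrow>\<^sub>M borel"
    using assms(1) measurable_from_subalg[of Q "F t" "X t" borel]
    by (simp add: filtered_prob_space_def filtration_def subalgebra_def)
next
  assume "\<omega> \<in> space Q"
  then have "continuous_on {0..T} (\<lambda>t. fst (X t \<omega>, U t \<omega>))"
    using assms(2) by (intro continuous_on_fst) (simp add: manifold_semimartingale_def)
  then show "continuous_on {0..T} (\<lambda>t. X t \<omega>)"
    by simp
qed

text \<open>
  The filtration is not assumed complete, so measurability of the exceedance event has to come from the
  continuity of the distance, for every sample path.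
\<close>

lemma (in riemannian_atlas) exceeds_event_measurable:
  fixes Z :: "real \<Rightarrow> 'w \<Rightarrow> 'p"
  assumes Z: "\<And>s. s \<in> {0..t} \<Longrightarrow> Z s \<in> Q \<rightarrow>\<^sub>M borel"
    and cont: "\<And>\<omega>. \<omega> \<in> space Q \<Longrightarrow> continuous_on {0..t} (\<lambda>s. Z s \<omega>)" and t: "0 < t"
  shows "{\<omega>\<in>space Q. (SUP s\<in>{0..t}. riem_dist C g p (Z s \<omega>)) > e} \<in> sets Q"
proof -
  have rd: "continuous_on UNIV (riem_dist C g p)"
    by (simp add: continuous_at_imp_continuous_on isCont_riem_dist)
  \<comment> \<open>A supremum exceeds \<open>e\<close> only if some value does, and by continuity a
    value at a rational time then does too.\<close>
  have "{\<omega>\<in>space Q. (SUP s\<in>{0..t}. riem_dist C g p (Z s \<omega>)) > e}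
      = (\<Union>q\<in>{0..t} \<inter> \<rat>. {\<omega>\<in>space Q. riem_dist C g p (Z q \<omega>) > e})"
  proof (intro equalityI subsetI)
    fix \<omega> assume "\<omega> \<in> {\<omega>\<in>space Q. (SUP s\<in>{0..t}. riem_dist C g p (Z s \<omega>)) > e}"
    then obtain s where \<omega>: "\<omega> \<in> space Q" and s: "s \<in> {0..t}" "riem_dist C g p (Z s \<omega>) \<in> {e<..}"
      by (auto simp: less_SUP_iff)
    have c: "continuous_on {0..t} (\<lambda>s. riem_dist C g p (Z s \<omega>))"
      by (rule continuous_on_compose2[OF rd cont[OF \<omega>] subset_UNIV])
    obtain q where "q \<in> {0..t} \<inter> \<rat>" "riem_dist C g p (Z q \<omega>) \<in> {e<..}"
      using rational_in_open_preimage[OF c open_greaterThan t s] by blast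
    with \<omega> show "\<omega> \<in> (\<Union>q\<in>{0..t} \<inter> \<rat>. {\<omega>\<in>space Q. riem_dist C g p (Z q \<omega>) > e})"
      by blast
  qed (auto simp: less_SUP_iff)
  moreover have "{\<omega>\<in>space Q. riem_dist C g p (Z q \<omega>) > e} \<in> sets Q" if "q \<in> {0..t}" for q
  proof -
    have [measurable]: "(\<lambda>\<omega>. riem_dist C g p (Z q \<omega>)) \<in> borel_measurable Q"
      using measurable_compose[OF Z[OF that] borel_measurable_continuous_onI[OF rd]] .
    show ?thesis by measurable
  qed
  moreover have "countable ({0..t} \<inter> \<rat>)"
    by (simp add: countable_Int2 countable_rat)
  ultimately show ?thesis
    by (simp only:) (intro sets.countable_UN'', auto)
qed

theorem proposition4p3:
  fixes A :: "('m::{t2_space,second_countable_topology}, 'a::euclidean_space) chart set"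
    and B :: "('n::{t2_space,second_countable_topology}, 'b::euclidean_space) chart set"
    and C :: "('p::{t2_space,second_countable_topology}, 'c::euclidean_space) chart set"
    and g :: "'p \<Rightarrow> 'p diffop \<Rightarrow> 'p diffop \<Rightarrow> real"
    and p :: 'p and h :: "'m \<Rightarrow> 'p"
    and Q :: "'w measure" and F :: "real \<Rightarrow> 'w measure"
    and W :: "real \<Rightarrow> 'w \<Rightarrow> real ^ 'd::finite"
    and G :: "'m \<Rightarrow> 'm diffop \<Rightarrow> 'm diffop"
    and V :: "'m \<Rightarrow> 'n \<Rightarrow> 'm diffop"
    and \<sigma> :: "'d \<Rightarrow> 'm \<Rightarrow> 'n \<Rightarrow> 'm diffop"
    and \<Lambda> :: real
  assumes "smooth_manifold A" and "smooth_manifold B" and "smooth_manifold C"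
    and "riemannian_metric C g"
    and "smooth_map A C h"
    and "filtered_prob_space Q F" and "wiener_process Q F W"
    and "diffusion_generator A G"
    and "\<And>x u. V x u \<in> tangent_space A x"
    and "\<And>l x u. \<sigma> l x u \<in> tangent_space A x"
  shows "\<forall>\<epsilon>>0. \<forall>\<alpha>\<in>{0<..1}. \<exists>b>\<Lambda> / (\<alpha> * \<epsilon> ^ 4).
    \<forall>a>0. \<forall>(X :: real \<Rightarrow> 'w \<Rightarrow> 'm) (U :: real \<Rightarrow> 'w \<Rightarrow> 'n).
      solution_from_constraint Q F W A B G V \<sigma> h p a X U \<longrightarrow>
      (\<forall>\<omega>\<in>space Q. \<forall>t\<in>{0..a}. smooth_near C (h (X t \<omega>)) (dist_sq C g p)) \<longrightarrow>
      bdd_above ((\<lambda>(x, u). \<Sum>l\<in>UNIV. (pushforward h (\<sigma> l x u) (dist_sq C g p))\<^sup>2) ` range_set Q a X U) \<longrightarrow>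
      \<Lambda> = (SUP (x, u)\<in>range_set Q a X U. \<Sum>l\<in>UNIV. (pushforward h (\<sigma> l x u) (dist_sq C g p))\<^sup>2) \<longrightarrow>
      (AE \<omega> in Q. \<forall>t\<in>{0..a}. constraint_drift G V \<sigma> h (X t \<omega>) (U t \<omega>) (dist_sq C g p)
         = - b * dist_sq C g p (h (X t \<omega>))) \<longrightarrow>
      (\<forall>t\<in>{0<..a}. exceeds_with_prob_le Q C g h p X \<epsilon> \<alpha> t) \<and>
      local_bounded_m_solution Q F W A B C g G V \<sigma> h p \<epsilon> \<alpha> X U"
proof (intro allI impI ballI)
  fix \<epsilon> \<alpha> :: real
  assume \<epsilon>: "0 < \<epsilon>" and \<alpha>: "\<alpha> \<in> {0<..1}"
  interpret A: smooth_atlas A by (rule smooth_atlas.intro) fact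
  interpret C: riemannian_atlas C g
    by (intro riemannian_atlas.intro smooth_atlas.intro riemannian_atlas_axioms.intro) fact+
  interpret prob_space Q using assms(6) by (simp add: filtered_prob_space_def)
  let ?D = "dist_sq C g p"
  \<comment> \<open>\<open>b\<close> is fixed before \<open>\<Lambda>\<close> is known to be a
    supremum of sums of squares, so \<open>\<Lambda>\<close> may still be negative here; the maximum
    makes \<open>b\<close> positive in any case.\<close>
  define b where "b = max (\<Lambda> / (\<alpha> * \<epsilon> ^ 4)) 0 + 1"
  have b: "b > \<Lambda> / (\<alpha> * \<epsilon> ^ 4)" "b > 0"
    by (auto simp: b_def)
  show "\<exists>b>\<Lambda> / (\<alpha> * \<epsilon> ^ 4).
    \<forall>a>0. \<forall>(X :: real \<Rightarrow> 'w \<Rightarrow> 'm) (U :: real \<Rightarrow> 'w \<Rightarrow> 'n).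
      solution_from_constraint Q F W A B G V \<sigma> h p a X U \<longrightarrow>
      (\<forall>\<omega>\<in>space Q. \<forall>t\<in>{0..a}. smooth_near C (h (X t \<omega>)) (dist_sq C g p)) \<longrightarrow>
      bdd_above ((\<lambda>(x, u). \<Sum>l\<in>UNIV. (pushforward h (\<sigma> l x u) (dist_sq C g p))\<^sup>2) ` range_set Q a X U) \<longrightarrow>
      \<Lambda> = (SUP (x, u)\<in>range_set Q a X U. \<Sum>l\<in>UNIV. (pushforward h (\<sigma> l x u) (dist_sq C g p))\<^sup>2) \<longrightarrow>
      (AE \<omega> in Q. \<forall>t\<in>{0..a}. constraint_drift G V \<sigma> h (X t \<omega>) (U t \<omega>) (dist_sq C g p)
         = - b * dist_sq C g p (h (X t \<omega>))) \<longrightarrow>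
      (\<forall>t\<in>{0<..a}. exceeds_with_prob_le Q C g h p X \<epsilon> \<alpha> t) \<and>
      local_bounded_m_solution Q F W A B C g G V \<sigma> h p \<epsilon> \<alpha> X U"
  proof (intro exI[of _ b] conjI[OF b(1)] allI impI)
    fix a :: real and X :: "real \<Rightarrow> 'w \<Rightarrow> 'm" and U :: "real \<Rightarrow> 'w \<Rightarrow> 'n"
    assume a: "0 < a" and sol: "solution_from_constraint Q F W A B G V \<sigma> h p a X U"
      and smooth: "\<forall>\<omega>\<in>space Q. \<forall>t\<in>{0..a}. smooth_near C (h (X t \<omega>)) ?D"
      and bdd: "bdd_above ((\<lambda>(x, u). \<Sum>l\<in>UNIV. (pushforward h (\<sigma> l x u) ?D)\<^sup>2) ` range_set Q a X U)"
      and drift: "AE \<omega> in Q. \<forall>t\<in>{0..a}. constraint_drift G V \<sigma> h (X t \<omega>) (U t \<omega>) ?D = - b * ?D (h (X t \<omega>))"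
    have start: "AE \<omega> in Q. h (X 0 \<omega>) = p" and sde: "solves_sde Q F W A G V \<sigma> a X U"
      and semi: "manifold_semimartingale Q F (prod_atlas A B) a (\<lambda>t \<omega>. (X t \<omega>, U t \<omega>))"
      using sol by (auto simp: solution_from_constraint_def)
    have h: "continuous_on UNIV h"
      using assms(5) by (simp add: smooth_map_def)
    have hX: "(\<lambda>\<omega>. h (X t \<omega>)) \<in> Q \<rightarrow>\<^sub>M borel" if "t \<in> {0..a}" for t
      using measurable_compose[OF manifold_semimartingale_fst(1)[OF assms(6) semi that]
          borel_measurable_continuous_onI[OF h]] .
    have hX_cont: "continuous_on {0..a} (\<lambda>t. h (X t \<omega>))" if "\<omega> \<in> space Q" for \<omega>
      by (rule continuous_on_compose2[OF h manifold_semimartingale_fst(2)[OF assms(6) semi that] subset_UNIV])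
    \<comment> \<open>Smoothness is given at the points visited by the paths, and almost every path
      is at \<open>p\<close> at time 0. The conclusion does not mention \<open>\<omega>\<close>, so
      on a probability space it holds outright.\<close>
    have "AE \<omega> in Q. smooth_near C p ?D"
      using start AE_space
    proof eventually_elim
      case (elim \<omega>)
      then show ?case
        using smooth a by (metis atLeastAtMost_iff less_imp_le order_refl)
    qed
    then have "smooth_near C p ?D"
      by simp
    then obtain \<delta> f where \<delta>: "0 < \<delta>" "\<delta> \<le> 1/2" and f: "\<And>z. smooth_near C z f" "\<And>z. f z \<ge> 0" "f p = 0"
        "\<And>z. f z = 0 \<Longrightarrow> riem_dist C g p z = 0"
      and f_local: "\<And>z. \<exists>Z. open Z \<and> z \<in> Z \<and>
        (smooth_near C z ?D \<and> (\<forall>y\<in>Z. f y = concave_cutoff \<delta> (?D y)) \<or> (\<exists>k. \<forall>y\<in>Z. f y = k))"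
      by (rule C.truncated_dist_sq) blast
    note near = A.smooth_near_map[OF C.smooth_atlas_axioms assms(5)]
    have fh: "smooth_fun_on A UNIV (f \<circ> h)"
      by (rule A.smooth_near_imp_smooth_fun_on) (rule near[OF f(1)])
    let ?\<eta>' = "\<lambda>y. flat_exp (flat_diff 1) (\<delta> - y)" and ?\<eta>'' = "\<lambda>y. - flat_exp (flat_diff (flat_diff 1)) (\<delta> - y)"
    \<comment> \<open>The alternative is available at every \<open>x\<close>: wherever
      \<open>?D \<circ> h\<close> fails to be smooth, \<open>f \<circ> h\<close> is locally
      constant.\<close>
    have f_cases: "(\<exists>Z. open Z \<and> x \<in> Z \<and> smooth_near A x (?D \<circ> h)
          \<and> (\<forall>y\<in>Z. (f \<circ> h) y = (concave_cutoff \<delta> \<circ> (?D \<circ> h)) y))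
        \<or> (\<exists>Z k. open Z \<and> x \<in> Z \<and> (\<forall>y\<in>Z. (f \<circ> h) y = k))" for x
    proof -
      obtain Z where Z: "open Z" "h x \<in> Z"
        "smooth_near C (h x) ?D \<and> (\<forall>y\<in>Z. f y = concave_cutoff \<delta> (?D y)) \<or> (\<exists>k. \<forall>y\<in>Z. f y = k)"
        using f_local[of "h x"] by blast
      have "open (h -` Z)" "x \<in> h -` Z"
        using h Z by (auto simp: continuous_on_open_vimage[OF open_UNIV])
      with Z(3) near[of x ?D] show ?thesis
        by (metis comp_apply vimageE)
    qed
    obtain Mb where Mb: "\<And>x u. (x, u) \<in> range_set Q a X U \<Longrightarrow> (\<Sum>l\<in>UNIV. (\<sigma> l x u (?D \<circ> h))\<^sup>2) \<le> Mb"
      using bdd by (fastforce simp: bdd_above_def pushforward_def)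
    obtain K where K: "K \<ge> 0" "\<And>s. s \<le> \<delta> \<Longrightarrow> \<bar>flat_exp (flat_diff 1) s\<bar> \<le> K"
      using flat_exp_bounded by blast
    \<comment> \<open>The absolute value makes the bound nonnegative, as the case of a locally
      constant function requires; there the coefficient is 0.\<close>
    have H: "\<bar>\<sigma> l (X s \<omega>) (U s \<omega>) (f \<circ> h)\<bar> \<le> K * sqrt \<bar>Mb\<bar>" if "\<omega> \<in> space Q" "s \<in> {0<..a}" for l s \<omega>
    proof -
      let ?x = "X s \<omega>" and ?u = "U s \<omega>"
      consider Z where "open Z" "?x \<in> Z" "smooth_near A ?x (?D \<circ> h)"
          "\<And>y. y \<in> Z \<Longrightarrow> (f \<circ> h) y = (concave_cutoff \<delta> \<circ> (?D \<circ> h)) y"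
        | Z k where "open Z" "?x \<in> Z" "\<And>y. y \<in> Z \<Longrightarrow> (f \<circ> h) y = k"
        using f_cases[of ?x] by blast
      then show ?thesis
      proof cases
        case 1
        have "(\<sigma> l ?x ?u (?D \<circ> h))\<^sup>2 \<le> (\<Sum>l\<in>UNIV. (\<sigma> l ?x ?u (?D \<circ> h))\<^sup>2)"
          by (rule member_le_sum) auto
        also have "\<dots> \<le> \<bar>Mb\<bar>"
          using Mb[of ?x ?u] that by (fastforce simp: range_set_def)
        finally have "\<bar>\<sigma> l ?x ?u (?D \<circ> h)\<bar> \<le> sqrt \<bar>Mb\<bar>"
          using real_sqrt_le_mono by fastforce
        moreover have "\<bar>?\<eta>' (?D (h ?x))\<bar> \<le> K"
          by (rule K(2)) (simp add: dist_sq_nonneg)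
        moreover have "\<sigma> l ?x ?u (f \<circ> h) = ?\<eta>' (?D (h ?x)) * \<sigma> l ?x ?u (?D \<circ> h)"
        proof -
          have "\<sigma> l ?x ?u (f \<circ> h) = \<sigma> l ?x ?u (concave_cutoff \<delta> \<circ> (?D \<circ> h))"
            by (rule A.tangent_space_cong[OF assms(10) 1(1,2)]) (rule 1(4))
          then show ?thesis
            using A.tangent_space_comp_real[OF assms(10) 1(3) concave_cutoff_smooth concave_cutoff_derivs]
            by simp
        qed
        ultimately show ?thesis
          using K(1) by (simp add: abs_mult mult_mono)
      next
        case 2
        have "\<sigma> l ?x ?u (f \<circ> h) = \<sigma> l ?x ?u (\<lambda>_. k)"
          by (rule A.tangent_space_cong[OF assms(10) 2(1,2)]) (rule 2(3))
        then show ?thesis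
          using A.tangent_space_const[OF assms(10)] K(1) by simp
      qed
    qed
    have nonpos: "AE \<omega> in Q. \<forall>s\<in>{0..a}. drift_op G V \<sigma> (X s \<omega>) (U s \<omega>) (f \<circ> h) \<le> 0"
      using drift
    proof eventually_elim
      case (elim \<omega>)
      show ?case
      proof
        fix s assume s: "s \<in> {0..a}"
        let ?x = "X s \<omega>" and ?u = "U s \<omega>"
        consider Z where "open Z" "?x \<in> Z" "smooth_near A ?x (?D \<circ> h)"
            "\<And>y. y \<in> Z \<Longrightarrow> (f \<circ> h) y = (concave_cutoff \<delta> \<circ> (?D \<circ> h)) y"
          | Z k where "open Z" "?x \<in> Z" "\<And>y. y \<in> Z \<Longrightarrow> (f \<circ> h) y = k"
          using f_cases[of ?x] by blast
        then show "drift_op G V \<sigma> ?x ?u (f \<circ> h) \<le> 0"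
        proof cases
          case 1
          have "drift_op G V \<sigma> ?x ?u (?D \<circ> h) = - b * ?D (h ?x)"
            using elim s by (simp add: constraint_drift_eq_drift_op)
          moreover have "drift_op G V \<sigma> ?x ?u (f \<circ> h) = drift_op G V \<sigma> ?x ?u (concave_cutoff \<delta> \<circ> (?D \<circ> h))"
            by (rule A.drift_op_cong[where G = G and V = V and \<sigma> = \<sigma> and x = "?x" and u = "?u", OF assms(8,9,10) 1(1,2)]) (rule 1(4))
          ultimately have "drift_op G V \<sigma> ?x ?u (f \<circ> h) = ?\<eta>' (?D (h ?x)) * (- b * ?D (h ?x))
              + ?\<eta>'' (?D (h ?x)) / 2 * (\<Sum>l\<in>UNIV. (\<sigma> l ?x ?u (?D \<circ> h))\<^sup>2)"
            using A.drift_op_comp_real[where G = G and V = V and \<sigma> = \<sigma> and x = "?x" and u = "?u", OF assms(8,9,10) 1(3) concave_cutoff_smooth concave_cutoff_derivs]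
            by simp
          \<comment> \<open>Both terms are nonpositive: \<open>?\<eta>'\<close> is nonnegative and
            multiplies \<open>- b * ?D (h ?x)\<close>, while \<open>?\<eta>''\<close> is nonpositive
            because \<open>\<delta> - ?D (h ?x)\<close> is at most 1/2, and it multiplies a sum of
            squares.\<close>
          also have "\<dots> \<le> 0"
            using flat_exp_diff_1_nonneg[of "\<delta> - ?D (h ?x)"] flat_exp_diff2_1_nonneg[of "\<delta> - ?D (h ?x)"]
              \<delta>(2) b(2) dist_sq_nonneg[of C g p "h ?x"]
            by (intro add_nonpos_nonpos mult_nonneg_nonpos mult_nonpos_nonneg sum_nonneg) auto
          finally show ?thesis .
        next
          case 2
          have "drift_op G V \<sigma> ?x ?u (f \<circ> h) = drift_op G V \<sigma> ?x ?u (\<lambda>_. k)"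
            by (rule A.drift_op_cong[where G = G and V = V and \<sigma> = \<sigma> and x = "?x" and u = "?u", OF assms(8,9,10) 2(1,2)]) (rule 2(3))
          then show ?thesis
            using A.drift_op_const[where G = G and V = V and \<sigma> = \<sigma> and x = "?x" and u = "?u", OF assms(8,9,10)] by simp
        qed
      qed
    qed
    obtain I where I: "\<And>l. ito_integral Q F (\<lambda>t \<omega>. W t \<omega> $ l) a (\<lambda>s \<omega>. \<sigma> l (X s \<omega>) (U s \<omega>) (f \<circ> h)) (I l)"
      and eq: "AE \<omega> in Q. \<forall>t\<in>{0..a}. (f \<circ> h) (X t \<omega>) = (f \<circ> h) (X 0 \<omega>)
          + (LBINT s:{0..t}. drift_op G V \<sigma> (X s \<omega>) (U s \<omega>) (f \<circ> h)) + (\<Sum>l\<in>UNIV. I l t \<omega>)"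
      using sde fh unfolding solves_sde_def by blast
    have "AE \<omega> in Q. f (h (X t \<omega>)) = 0" if "t \<in> {0..a}" for t
    proof -
      have start0: "AE \<omega> in Q. (f \<circ> h) (X 0 \<omega>) = 0"
        using start by eventually_elim (simp add: f(3))
      have "AE \<omega> in Q. (f \<circ> h) (X t \<omega>) = 0"
      proof (rule nonneg_nonpos_drift_vanishes[OF assms(6,7) I _ eq nonpos start0 _ that])
        show "\<bar>\<sigma> l (X s \<omega>) (U s \<omega>) (f \<circ> h)\<bar> \<le> K * sqrt \<bar>Mb\<bar>"
          if "\<omega> \<in> space Q" "s \<in> {0<..a}" for l s \<omega>
          using H that .
        show "(f \<circ> h) (X t \<omega>) \<ge> 0" for t \<omega>
          by (simp add: f(2))
      qed
      then show ?thesis by simp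
    qed
    \<comment> \<open>Each time has its own null set. Restricting to rational times gives a single
      one, and continuity of \<open>f\<close> along the paths then extends the identity to all
      times.\<close>
    then have "AE \<omega> in Q. \<forall>q\<in>{0..a} \<inter> \<rat>. f (h (X q \<omega>)) = 0"
      by (intro AE_ball_countable' countable_Int2 countable_rat) auto
    then have zero: "AE \<omega> in Q. \<forall>t\<in>{0..a}. riem_dist C g p (h (X t \<omega>)) = 0"
      using AE_space
    proof eventually_elim
      case (elim \<omega>)
      have "continuous_on UNIV f"
        using f(1) C.smooth_near_isCont by (simp add: continuous_at_imp_continuous_on)
      then have cont: "continuous_on {0..a} (\<lambda>t. f (h (X t \<omega>)))"
        by (rule continuous_on_compose2[OF _ hX_cont[OF elim(2)] subset_UNIV])
      show ?case
      proof
        fix t assume t: "t \<in> {0..a}"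
        have "f (h (X t \<omega>)) = 0"
        proof (rule ccontr)
          assume "f (h (X t \<omega>)) \<noteq> 0"
          then obtain q where "q \<in> {0..a} \<inter> \<rat>" "f (h (X q \<omega>)) \<in> - {0}"
            using rational_in_open_preimage[OF cont _ a t, of "- {0}"] by auto
          then show False
            using elim(1) by auto
        qed
        then show "riem_dist C g p (h (X t \<omega>)) = 0"
          by (rule f(4))
      qed
    qed
    have exceeds: "exceeds_with_prob_le Q C g h p X \<epsilon> \<alpha> t" if t: "t \<in> {0<..a}" for t
    proof -
      let ?E = "{\<omega>\<in>space Q. (SUP s\<in>{0..t}. riem_dist C g p (h (X s \<omega>))) > ennreal \<epsilon>}"
      have E: "?E \<in> sets Q"
        using t by (intro C.exceeds_event_measurable hX continuous_on_subset[OF hX_cont]) auto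
      moreover have "prob ?E = 0"
      proof (subst prob_eq_0[OF E])
        show "AE \<omega> in Q. \<omega> \<notin> ?E"
          using zero
        proof eventually_elim
          case (elim \<omega>)
          then have "(SUP s\<in>{0..t}. riem_dist C g p (h (X s \<omega>))) \<le> 0"
            using t by (intro SUP_least) auto
          then show ?case
            by (auto simp: not_less intro: order_trans)
        qed
      qed
      ultimately show ?thesis
        using \<alpha> by (simp add: exceeds_with_prob_le_def)
    qed
    \<comment> \<open>The horizon \<open>a\<close> of the given solution serves as the interval of
      existence of the bounded solution.\<close>
    then show "(\<forall>t\<in>{0<..a}. exceeds_with_prob_le Q C g h p X \<epsilon> \<alpha> t) \<and>
        local_bounded_m_solution Q F W A B C g G V \<sigma> h p \<epsilon> \<alpha> X U"
      using a sol unfolding local_bounded_m_solution_def by blast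
  qed
qed

end
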